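(* Let $G$ be a lacunary hyperbolic group with an approximating sequence $(G_k,S_k)_{k\in\mathbb{N}}$, hyperbolicity constants $\delta_k$ and natural epimorphisms $\eta_k\colon G_k\to G$ as described in the context. Assume that $G$ has property $(\mathrm{F}\mathbb{R})$ and $$\lim_{k\to+\infty}\frac{\mathrm{inj}(\eta_k)}{\delta_k^2}=\infty.$$ Let $\Lambda=\{\|\Phi\| : \Phi\in\mathrm{Out}(G)\}$. Then there exist $A,B>0$ and $k_0\in\mathbb{N}$ such that for every $k\ge k_0$, the set $\Lambda\cap\left(A\delta_k,\ B\,\mathrm{inj}(\eta_k)/\delta_k\right)$ is empty.
   Context: Setting: $G$ is a lacunary hyperbolic group with a finite generating set $S$ for which $(G,S)$ is the direct limit of a sequence of groups with finite generating sets and epimorphisms $\alpha_k\colon(G_k,S_k)\to(G_{k+1},S_{k+1})$, $k\in\mathbb{N}$, with $\alpha_k(S_k)=S_{k+1}$, such that: (1) the Cayley graph of $G_k$ with respect to $S_k$ is $\delta_k$-hyperbolic ($\delta_k>0$; every side of a geodesic triangle lies in the $\delta_k$-neighbourhood of the union of the other two); (2) $\lim_{k\to\infty}\mathrm{inj}(\eta_k)/\delta_k=\infty$, where $\eta_k\colon G_k\to G$ is the natural epimorphism (so $\eta_k(S_k)=S$) and $\mathrm{inj}(\eta_k)\in\mathbb{N}\cup\{\infty\}$ is the largest $R$ such that $\eta_k$ is injective on every ball of radius $R$ of $G_k$ for the word metric of $S_k$. (Existence of such a sequence characterizes lacunary hyperbolic groups.) Convention on the constants $\delta_k$: $G_k$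 admits a presentation with generating set $S_k$ whose relators have length at most $10\delta_k$. A group has property $(\mathrm{F}\mathbb{R})$ if every action of it by isometries on an $\mathbb{R}$-tree has a global fixed point. For $g\in G$, $|g|_S$ is the word length and $\iota_g$ is the inner automorphism $x\mapsto gxg^{-1}$. For an endomorphism $\phi$ of $G$, $|\phi|=\max_{s\in S}|\phi(s)|_S$ and $\|\phi\|=\inf_{g\in G}|\iota_g\circ\phi|$. For $\Phi\in\mathrm{Out}(G)$, $\|\Phi\|=\|\phi\|$ for any representative $\phi\in\mathrm{Aut}(G)$. *)

theory Defs
  imports "HOL-Analysis.Analysis" "HOL-Algebra.Algebra"
begin

section \<open>Words, word metrics and presentations\<close>

text \<open>A word over \<open>S\<close> is a list of letters \<open>(s, b)\<close> with \<open>s \<in> S\<close>; the letter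
  \<open>(s, True)\<close> stands for \<open>s\<close> and \<open>(s, False)\<close> for its formal inverse.\<close>

definition words :: "'a set \<Rightarrow> ('a \<times> bool) list set" where
  "words S = lists (S \<times> UNIV)"

definition letter_val :: "('a, 'm) monoid_scheme \<Rightarrow> 'a \<times> bool \<Rightarrow> 'a" where
  "letter_val G a = (if snd a then fst a else inv\<^bsub>G\<^esub> fst a)"

definition word_val :: "('a, 'm) monoid_scheme \<Rightarrow> ('a \<times> bool) list \<Rightarrow> 'a" where
  "word_val G w = foldr (\<lambda>a x. letter_val G a \<otimes>\<^bsub>G\<^esub> x) w \<one>\<^bsub>G\<^esub>"

definition word_length :: "('a, 'm) monoid_scheme \<Rightarrow> 'a set \<Rightarrow> 'a \<Rightarrow> nat" where
  "word_length G S g = (LEAST n. \<exists>w\<in>words S. length w = n \<and> word_val G w = g)"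

definition word_dist :: "('a, 'm) monoid_scheme \<Rightarrow> 'a set \<Rightarrow> 'a \<Rightarrow> 'a \<Rightarrow> nat" where
  "word_dist G S x y = word_length G S (inv\<^bsub>G\<^esub> x \<otimes>\<^bsub>G\<^esub> y)"

definition word_ball :: "('a, 'm) monoid_scheme \<Rightarrow> 'a set \<Rightarrow> 'a \<Rightarrow> nat \<Rightarrow> 'a set" where
  "word_ball G S x R = {y \<in> carrier G. word_dist G S x y \<le> R}"

definition finite_generating_set :: "('a, 'm) monoid_scheme \<Rightarrow> 'a set \<Rightarrow> bool" where
  "finite_generating_set G S \<longleftrightarrow>
     finite S \<and> S \<subseteq> carrier G \<and> generate G S = carrier G"

text \<open>The group \<open>\<langle>S | R\<rangle>\<close> is the set of words over \<open>S\<close> modulo the congruence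
  generated by free cancellation and by deletion of relators.\<close>

inductive presented_eq ::
  "'a set \<Rightarrow> ('a \<times> bool) list set \<Rightarrow> ('a \<times> bool) list \<Rightarrow> ('a \<times> bool) list \<Rightarrow> bool"
  for S :: "'a set" and R :: "('a \<times> bool) list set" where
  refl: "w \<in> words S \<Longrightarrow> presented_eq S R w w"
| sym: "presented_eq S R v w \<Longrightarrow> presented_eq S R w v"
| trans: "presented_eq S R u v \<Longrightarrow> presented_eq S R v w \<Longrightarrow> presented_eq S R u w"
| cancel: "u \<in> words S \<Longrightarrow> v \<in> words S \<Longrightarrow> s \<in> S \<Longrightarrow>
    presented_eq S R (u @ [(s, b), (s, \<not> b)] @ v) (u @ v)"
| relator: "u \<in> words S \<Longrightarrow> v \<in> words S \<Longrightarrow> r \<in> R \<Longrightarrow>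
    presented_eq S R (u @ r @ v) (u @ v)"

text \<open>\<open>G\<close> is presented by \<open>\<langle>S | R\<rangle>\<close>: the map from words over \<open>S\<close> to \<open>G\<close> is onto and
  induces an injection on \<open>\<langle>S | R\<rangle>\<close>.\<close>

definition presentation ::
  "('a, 'm) monoid_scheme \<Rightarrow> 'a set \<Rightarrow> ('a \<times> bool) list set \<Rightarrow> bool" where
  "presentation G S R \<longleftrightarrow>
     S \<subseteq> carrier G \<and> generate G S = carrier G \<and> R \<subseteq> words S \<and>
     (\<forall>v\<in>words S. \<forall>w\<in>words S. word_val G v = word_val G w \<longleftrightarrow> presented_eq S R v w)"

section \<open>Geodesics, hyperbolicity and real trees\<close>

definition geodesic :: "'x set \<Rightarrow> ('x \<Rightarrow> 'x \<Rightarrow> real) \<Rightarrow> real \<Rightarrow> (real \<Rightarrow> 'x) \<Rightarrow> bool" where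
  "geodesic M d l \<gamma> \<longleftrightarrow>
     0 \<le> l \<and> \<gamma> ` {0..l} \<subseteq> M \<and> (\<forall>s\<in>{0..l}. \<forall>t\<in>{0..l}. d (\<gamma> s) (\<gamma> t) = \<bar>s - t\<bar>)"

definition geodesic_segment ::
  "'x set \<Rightarrow> ('x \<Rightarrow> 'x \<Rightarrow> real) \<Rightarrow> 'x \<Rightarrow> 'x \<Rightarrow> 'x set \<Rightarrow> bool" where
  "geodesic_segment M d x y A \<longleftrightarrow>
     (\<exists>l \<gamma>. geodesic M d l \<gamma> \<and> \<gamma> 0 = x \<and> \<gamma> l = y \<and> A = \<gamma> ` {0..l})"

text \<open>Only the side \<open>A\<close> is mentioned: the other two are covered by permuting the vertices
  cyclically.\<close>

definition thin_triangles :: "'x set \<Rightarrow> ('x \<Rightarrow> 'x \<Rightarrow> real) \<Rightarrow> real \<Rightarrow> bool" where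
  "thin_triangles M d \<delta> \<longleftrightarrow>
     (\<forall>x\<in>M. \<forall>y\<in>M. \<forall>z\<in>M. \<forall>A B C.
        geodesic_segment M d x y A \<and> geodesic_segment M d y z B \<and> geodesic_segment M d z x C
        \<longrightarrow> (\<forall>p\<in>A. \<exists>q\<in>B \<union> C. d p q \<le> \<delta>))"

definition arc_between ::
  "'x set \<Rightarrow> ('x \<Rightarrow> 'x \<Rightarrow> real) \<Rightarrow> 'x \<Rightarrow> 'x \<Rightarrow> 'x set \<Rightarrow> bool" where
  "arc_between M d x y A \<longleftrightarrow>
     (\<exists>\<gamma>. pathin (Metric_space.mtopology M d) \<gamma> \<and> inj_on \<gamma> {0..1} \<and>
          \<gamma> 0 = x \<and> \<gamma> 1 = y \<and> A = \<gamma> ` {0..1})"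

definition real_tree :: "'x set \<Rightarrow> ('x \<Rightarrow> 'x \<Rightarrow> real) \<Rightarrow> bool" where
  "real_tree M d \<longleftrightarrow>
     Metric_space M d \<and> M \<noteq> {} \<and>
     (\<forall>x\<in>M. \<forall>y\<in>M. \<exists>A. geodesic_segment M d x y A \<and> (\<forall>B. arc_between M d x y B \<longrightarrow> B = A))"

definition isometric_action ::
  "('a, 'm) monoid_scheme \<Rightarrow> 'x set \<Rightarrow> ('x \<Rightarrow> 'x \<Rightarrow> real) \<Rightarrow> ('a \<Rightarrow> 'x \<Rightarrow> 'x) \<Rightarrow> bool" where
  "isometric_action G M d \<phi> \<longleftrightarrow>
     group_action G M \<phi> \<and> (\<forall>g\<in>carrier G. \<forall>x\<in>M. \<forall>y\<in>M. d (\<phi> g x) (\<phi> g y) = d x y)"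

text \<open>A definition cannot quantify over all types of points of a tree.  It is enough to consider
  trees with points in \<open>'a \<times> real\<close>, since the subtree spanned by an orbit can be embedded in
  this type; see \<open>property_FR_fixed_point\<close> below for trees over an arbitrary type.\<close>

definition property_FR :: "('a, 'm) monoid_scheme \<Rightarrow> bool" where
  "property_FR G \<longleftrightarrow>
     (\<forall>(T :: ('a \<times> real) set) d \<phi>. real_tree T d \<and> isometric_action G T d \<phi> \<longrightarrow>
        (\<exists>x\<in>T. \<forall>g\<in>carrier G. \<phi> g x = x))"

section \<open>Cayley graphs\<close>

text \<open>The Cayley graph has vertex set \<open>carrier G\<close> and an edge of length \<open>1\<close> between any two distinct
  vertices \<open>g\<close> and \<open>g \<otimes> s\<close>, \<open>s \<in> S\<close>.  Points of its geometric realization are given by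
  barycentric coordinates.  A path between two points that are not in the interior of the
  same edge, or that leaves that edge, runs through an end point \<open>a\<close> of the edge carrying \<open>p\<close>
  and an end point \<open>b\<close> of the edge carrying \<open>q\<close>; \<open>1 - p a\<close> is the distance of \<open>p\<close> from \<open>a\<close>.\<close>

definition supp :: "('a \<Rightarrow> real) \<Rightarrow> 'a set" where
  "supp p = {a. p a \<noteq> 0}"

definition cayley_points :: "('a, 'm) monoid_scheme \<Rightarrow> 'a set \<Rightarrow> ('a \<Rightarrow> real) set" where
  "cayley_points G S =
     {p. (\<forall>a. 0 \<le> p a) \<and> (\<Sum>a\<in>supp p. p a) = 1 \<and>
         (\<exists>g\<in>carrier G. supp p = {g} \<or> (\<exists>s\<in>S. supp p = {g, g \<otimes>\<^bsub>G\<^esub> s}))}"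

definition cayley_dist ::
  "('a, 'm) monoid_scheme \<Rightarrow> 'a set \<Rightarrow> ('a \<Rightarrow> real) \<Rightarrow> ('a \<Rightarrow> real) \<Rightarrow> real" where
  "cayley_dist G S p q =
     (if supp p = supp q then MAX a\<in>supp p. \<bar>p a - q a\<bar>
      else MIN (a, b)\<in>supp p \<times> supp q. (1 - p a) + real (word_dist G S a b) + (1 - q b))"

definition cayley_hyperbolic :: "('a, 'm) monoid_scheme \<Rightarrow> 'a set \<Rightarrow> real \<Rightarrow> bool" where
  "cayley_hyperbolic G S \<delta> \<longleftrightarrow> thin_triangles (cayley_points G S) (cayley_dist G S) \<delta>"

section \<open>Direct limits of sequences of groups\<close>

primrec transition :: "(nat \<Rightarrow> 'b \<Rightarrow> 'b) \<Rightarrow> nat \<Rightarrow> nat \<Rightarrow> 'b \<Rightarrow> 'b" where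
  "transition \<alpha> k 0 = id"
| "transition \<alpha> k (Suc m) = \<alpha> (k + m) \<circ> transition \<alpha> k m"

text \<open>\<open>G\<close> with the maps \<open>\<eta> k\<close> is the quotient of the disjoint union of the groups by eventual
  equality.  The universal property is \<open>direct_limit_universal\<close> below.\<close>

definition direct_limit ::
  "(nat \<Rightarrow> ('b, 'n) monoid_scheme) \<Rightarrow> (nat \<Rightarrow> 'b \<Rightarrow> 'b) \<Rightarrow>
   ('a, 'm) monoid_scheme \<Rightarrow> (nat \<Rightarrow> 'b \<Rightarrow> 'a) \<Rightarrow> bool" where
  "direct_limit Gs \<alpha> G \<eta> \<longleftrightarrow>
     (\<forall>k. \<eta> k \<in> hom (Gs k) G) \<and>
     (\<forall>k. \<forall>x\<in>carrier (Gs k). \<eta> (Suc k) (\<alpha> k x) = \<eta> k x) \<and>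
     carrier G = (\<Union>k. \<eta> k ` carrier (Gs k)) \<and>
     (\<forall>k. \<forall>x\<in>carrier (Gs k). \<forall>y\<in>carrier (Gs k).
        \<eta> k x = \<eta> k y \<longrightarrow> (\<exists>m. transition \<alpha> k m x = transition \<alpha> k m y))"

definition injectivity_radius ::
  "('b, 'n) monoid_scheme \<Rightarrow> 'b set \<Rightarrow> ('b \<Rightarrow> 'a) \<Rightarrow> enat" where
  "injectivity_radius H T f =
     Sup {enat R | R. \<forall>x\<in>carrier H. inj_on f (word_ball H T x R)}"

text \<open>The approximating sequences that characterize lacunary hyperbolic groups.\<close>

locale lacunary_hyperbolic_approximation =
  fixes G :: "('a, 'm) monoid_scheme" and S :: "'a set"
    and Gs :: "nat \<Rightarrow> ('b, 'n) monoid_scheme" and Ss :: "nat \<Rightarrow> 'b set"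
    and \<alpha> :: "nat \<Rightarrow> 'b \<Rightarrow> 'b" and \<eta> :: "nat \<Rightarrow> 'b \<Rightarrow> 'a" and \<delta> :: "nat \<Rightarrow> real"
  assumes group_limit: "group G"
    and generating_limit: "finite_generating_set G S"
    and group_seq: "\<And>k. group (Gs k)"
    and generating_seq: "\<And>k. finite_generating_set (Gs k) (Ss k)"
    and \<alpha>_epi: "\<And>k. \<alpha> k \<in> epi (Gs k) (Gs (Suc k))"
    and \<alpha>_generators: "\<And>k. \<alpha> k ` Ss k = Ss (Suc k)"
    and limit: "direct_limit Gs \<alpha> G \<eta>"
    and \<eta>_generators: "\<And>k. \<eta> k ` Ss k = S"
    and \<delta>_pos: "\<And>k. 0 < \<delta> k"
    and hyperbolic: "\<And>k. cayley_hyperbolic (Gs k) (Ss k) (\<delta> k)"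
    and lacunary:
      "(\<lambda>k. ereal_of_enat (injectivity_radius (Gs k) (Ss k) (\<eta> k)) / ereal (\<delta> k))
         \<longlonglongrightarrow> \<infinity>"
    and short_relators:
      "\<And>k. \<exists>R. presentation (Gs k) (Ss k) R \<and> (\<forall>r\<in>R. real (length r) \<le> 10 * \<delta> k)"

section \<open>Outer automorphisms and their norms\<close>

definition inner_aut :: "('a, 'm) monoid_scheme \<Rightarrow> 'a \<Rightarrow> 'a \<Rightarrow> 'a" where
  "inner_aut G g = (\<lambda>x\<in>carrier G. g \<otimes>\<^bsub>G\<^esub> x \<otimes>\<^bsub>G\<^esub> inv\<^bsub>G\<^esub> g)"

definition Inn :: "('a, 'm) monoid_scheme \<Rightarrow> ('a \<Rightarrow> 'a) set" where
  "Inn G = inner_aut G ` carrier G"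

definition Out :: "('a, 'm) monoid_scheme \<Rightarrow> ('a \<Rightarrow> 'a) set monoid" where
  "Out G = AutoGroup G Mod Inn G"

text \<open>Inserting \<open>0\<close> only matters if \<open>S\<close> is empty.\<close>

definition endo_size :: "('a, 'm) monoid_scheme \<Rightarrow> 'a set \<Rightarrow> ('a \<Rightarrow> 'a) \<Rightarrow> nat" where
  "endo_size G S \<phi> = Max (insert 0 ((\<lambda>s. word_length G S (\<phi> s)) ` S))"

definition endo_norm :: "('a, 'm) monoid_scheme \<Rightarrow> 'a set \<Rightarrow> ('a \<Rightarrow> 'a) \<Rightarrow> nat" where
  "endo_norm G S \<phi> = (INF g\<in>carrier G. endo_size G S (inner_aut G g \<circ> \<phi>))"

text \<open>Independence of the representative is \<open>out_norm_eq\<close> below.\<close>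

definition out_norm :: "('a, 'm) monoid_scheme \<Rightarrow> 'a set \<Rightarrow> ('a \<Rightarrow> 'a) set \<Rightarrow> nat" where
  "out_norm G S \<Phi> = endo_norm G S (SOME \<phi>. \<phi> \<in> \<Phi>)"

definition out_norms :: "('a, 'm) monoid_scheme \<Rightarrow> 'a set \<Rightarrow> nat set" where
  "out_norms G S = out_norm G S ` carrier (Out G)"

section \<open>Adequacy of the definitions\<close>

lemma arc_between_Lipschitz:
  assumes "Metric_space M d" "0 < L" "r ` {0..L} \<subseteq> M" "inj_on r {0..L}"
    and lip: "\<And>s t. s \<in> {0..L} \<Longrightarrow> t \<in> {0..L} \<Longrightarrow> d (r s) (r t) \<le> \<bar>s - t\<bar>"
  shows "arc_between M d (r 0) (r L) (r ` {0..L})"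
proof -
  interpret Metric_space M d by fact
  have im: "(*) L ` {0..1} = {0..L}"
    using \<open>0 < L\<close> by (simp add: image_mult_atLeastAtMost)
  have mem: "L * u \<in> {0..L}" if "u \<in> {0..1}" for u
    using im that by blast
  have "continuous_map (top_of_set {0..1}) mtopology (\<lambda>u. r (L * u))"
    unfolding continuous_map_to_metric
  proof (intro ballI allI impI)
    fix u and e :: real assume u: "u \<in> topspace (top_of_set {0..1::real})" and e: "0 < e"
    let ?U = "{0..1} \<inter> ball u (e / L)"
    have "r (L * v) \<in> mball (r (L * u)) e" if v: "v \<in> ?U" for v
    proof -
      have "d (r (L * u)) (r (L * v)) \<le> \<bar>L * u - L * v\<bar>"
        using u v by (intro lip mem) auto
      also have "\<dots> = L * \<bar>u - v\<bar>" using \<open>0 < L\<close> by (simp add: abs_mult flip: right_diff_distrib)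
      also have "\<dots> < e" using v \<open>0 < L\<close> by (simp add: dist_real_def field_simps)
      finally show ?thesis
        using assms(3) u v mem by (auto simp: in_mball image_subset_iff)
    qed
    moreover have "openin (top_of_set {0..1}) ?U" by (simp add: openin_open_Int)
    moreover have "u \<in> ?U" using u e \<open>0 < L\<close> by simp
    ultimately show "\<exists>U. openin (top_of_set {0..1}) U \<and> u \<in> U \<and>
        (\<forall>v\<in>U. r (L * v) \<in> mball (r (L * u)) e)"
      by blast
  qed
  moreover have "inj_on (\<lambda>u. r (L * u)) {0..1}"
  proof (rule inj_onI)
    fix u v assume "u \<in> {0..1::real}" "v \<in> {0..1}" "r (L * u) = r (L * v)"
    hence "L * u = L * v" using inj_onD[OF \<open>inj_on r {0..L}\<close>] mem by blast
    thus "u = v" using \<open>0 < L\<close> by simp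
  qed
  moreover have "r ` {0..L} = (\<lambda>u. r (L * u)) ` {0..1}"
    by (simp flip: im add: image_image)
  ultimately show ?thesis
    unfolding arc_between_def pathin_def by (intro exI[of _ "\<lambda>u. r (L * u)"]) simp
qed

lemma geodesic_segment_sym:
  assumes "geodesic_segment M d x y A"
  shows "geodesic_segment M d y x A"
proof -
  obtain l \<gamma> where g: "geodesic M d l \<gamma>" "\<gamma> 0 = x" "\<gamma> l = y" "A = \<gamma> ` {0..l}"
    using assms by (auto simp: geodesic_segment_def)
  have im: "(\<lambda>t. l - t) ` {0..l} = {0..l}" by simp
  have "geodesic M d l (\<lambda>t. \<gamma> (l - t))"
    using g(1) unfolding geodesic_def by auto
  moreover have "A = (\<lambda>t. \<gamma> (l - t)) ` {0..l}"
    unfolding g(4) by (subst im[symmetric]) (simp only: image_image)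
  ultimately show ?thesis
    using g unfolding geodesic_segment_def by (intro exI[of _ l] exI[of _ "\<lambda>t. \<gamma> (l - t)"]) simp
qed

lemma real_tree_tripod:
  assumes T: "real_tree M d"
    and A: "geodesic_segment M d x z A" and B: "geodesic_segment M d y z B"
    and C: "geodesic_segment M d x y C"
  shows "C \<subseteq> A \<union> B"
proof -
  interpret Metric_space M d using T by (simp add: real_tree_def)
  obtain a p where p: "geodesic M d a p" "p 0 = x" "p a = z" "A = p ` {0..a}"
    using A by (auto simp: geodesic_segment_def)
  obtain b q where q: "geodesic M d b q" "q 0 = y" "q b = z" "B = q ` {0..b}"
    using B by (auto simp: geodesic_segment_def)
  obtain c r where r: "geodesic M d c r" "r 0 = x" "r c = y" "C = r ` {0..c}"
    using C by (auto simp: geodesic_segment_def)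
  note P = p(1)[unfolded geodesic_def] and Q = q(1)[unfolded geodesic_def]
  have pM: "p t \<in> M" if "t \<in> {0..a}" for t using P that by blast
  have qM: "q t \<in> M" if "t \<in> {0..b}" for t using Q that by blast
  have pd: "d (p s) (p t) = \<bar>s - t\<bar>" if "s \<in> {0..a}" "t \<in> {0..a}" for s t using P that by blast
  have qd: "d (q s) (q t) = \<bar>s - t\<bar>" if "s \<in> {0..b}" "t \<in> {0..b}" for s t using Q that by blast
  have a0: "0 \<le> a" and b0: "0 \<le> b" using P Q by auto
  have meet: "s = b - a + t" if "s \<in> {0..b}" "t \<in> {0..a}" "p t = q s" for s t
  proof -
    have "\<bar>t - a\<bar> = d (p t) (p a)" using pd[of t a] that(2) a0 by simp
    also have "\<dots> = d (q s) (q b)" unfolding that(3) p(3) q(3) ..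
    also have "\<dots> = \<bar>s - b\<bar>" using qd[of s b] that(1) b0 by simp
    finally show ?thesis using that(1,2) by simp
  qed
  define W where "W = {t \<in> {0..a}. p t \<in> B}"
  define t0 where "t0 = Inf W"
  have aW: "a \<in> W" using a0 b0 p q unfolding W_def
    by (metis (mono_tags, lifting) CollectI atLeastAtMost_iff image_eqI order_refl)
  have bdd: "bdd_below W" by (auto simp: W_def intro!: bdd_belowI[of _ 0])
  have W: "b - a + t \<in> {0..b} \<and> p t = q (b - a + t)" if "t \<in> W" for t
    using that meet unfolding W_def q(4) by force
  have t0a: "t0 \<le> a" unfolding t0_def by (rule cInf_lower[OF aW bdd])
  have t00: "0 \<le> t0" unfolding t0_def using aW by (intro cInf_greatest) (auto simp: W_def)
  have "a - b \<le> t0" unfolding t0_def using aW W by (intro cInf_greatest) force+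
  define s0 where "s0 = b - a + t0"
  have s0: "s0 \<in> {0..b}" using \<open>a - b \<le> t0\<close> t0a by (simp add: s0_def)
  have "d (p t0) (q s0) \<le> 0 + e" if e0: "0 < e" for e
  proof -
    obtain t where t: "t \<in> W" "t < t0 + e / 2"
      using cInf_lessD[of W "t0 + e / 2"] aW e0 unfolding t0_def by auto
    have tt: "t0 \<le> t" unfolding t0_def by (rule cInf_lower[OF t(1) bdd])
    have ta: "t \<in> {0..a}" using t by (simp add: W_def)
    have wt: "b - a + t \<in> {0..b}" "p t = q (b - a + t)" using W[OF t(1)] by auto
    have "d (p t0) (q s0) \<le> d (p t0) (p t) + d (p t) (q s0)"
      using t00 t0a ta s0 by (intro triangle pM qM) auto
    also have "d (p t0) (p t) = t - t0" using t00 t0a ta tt by (simp add: pd)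
    also have "d (p t) (q s0) = t - t0" unfolding wt(2) using wt s0 tt by (subst qd) (auto simp: s0_def)
    finally show ?thesis using t by simp
  qed
  hence "d (p t0) (q s0) \<le> 0" by (rule field_le_epsilon)
  hence eq: "p t0 = q s0"
    using nonneg[of "p t0" "q s0"] zero pM[of t0] qM[OF s0] t00 t0a by (simp add: antisym)
  define L where "L = t0 + s0"
  have L0: "0 \<le> L" using t00 s0 by (simp add: L_def)
  define \<rho> where "\<rho> v = (if v \<le> t0 then p v else q (L - v))" for v
  have \<rho>p: "\<rho> v = p v" if "v \<le> t0" for v using that by (simp add: \<rho>_def)
  have \<rho>q: "\<rho> v = q (L - v)" if "t0 \<le> v" for v
    using that eq by (auto simp: \<rho>_def L_def)
  have vp: "v \<in> {0..a}" if "0 \<le> v" "v \<le> t0" for v using that t0a by auto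
  have vq: "L - v \<in> {0..b}" if "t0 \<le> v" "v \<le> L" for v using that s0 by (auto simp: L_def)
  have \<rho>M: "\<rho> ` {0..L} \<subseteq> M"
    using pM qM vp vq unfolding \<rho>_def by fastforce
  have \<rho>AB: "\<rho> ` {0..L} \<subseteq> A \<union> B"
    using vp vq unfolding \<rho>_def p q by fastforce
  have lip1: "d (\<rho> s) (\<rho> t) \<le> t - s" if "0 \<le> s" "s \<le> t" "t \<le> L" for s t
  proof -
    consider "t \<le> t0" | "t0 \<le> s" | "s \<le> t0" "t0 \<le> t" by linarith
    thus ?thesis
    proof cases
      case 1 thus ?thesis using that vp by (simp add: \<rho>p pd)
    next
      case 2 thus ?thesis using that vq[of s] vq[of t] by (simp add: \<rho>q qd)
    next
      case 3
      have "d (\<rho> s) (\<rho> t) \<le> d (\<rho> s) (\<rho> t0) + d (\<rho> t0) (\<rho> t)"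
        using that 3 \<rho>M by (intro triangle) (auto simp: image_subset_iff)
      also have "d (\<rho> s) (\<rho> t0) = t0 - s"
        using 3 that vp[of s] vp[of t0] t00 by (simp add: \<rho>p pd)
      also have "d (\<rho> t0) (\<rho> t) = t - t0"
        using 3 that vq[of t] vq[of t0] s0 t00 by (subst (1 2) \<rho>q) (simp_all add: qd)
      finally show ?thesis by simp
    qed
  qed
  have lip: "d (\<rho> s) (\<rho> t) \<le> \<bar>s - t\<bar>" if "s \<in> {0..L}" "t \<in> {0..L}" for s t
    using lip1[of s t] lip1[of t s] that commute[of "\<rho> s" "\<rho> t"] by (cases "s \<le> t") auto
  have nB: "p v \<notin> B" if "0 \<le> v" "v < t0" for v
  proof
    assume "p v \<in> B"
    hence "v \<in> W" using that t0a by (simp add: W_def)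
    hence "t0 \<le> v" unfolding t0_def by (rule cInf_lower[OF _ bdd])
    thus False using that by simp
  qed
  have inj1: "\<rho> s \<noteq> \<rho> t" if "0 \<le> s" "s < t" "t \<le> L" for s t
  proof -
    consider "t \<le> t0" | "t0 \<le> s" | "s < t0" "t0 \<le> t" by linarith
    thus ?thesis
    proof cases
      case 1
      hence "d (\<rho> s) (\<rho> t) = t - s" using that vp by (simp add: \<rho>p pd)
      thus ?thesis using that zero[of "\<rho> s" "\<rho> s"] \<rho>M by (auto simp: image_subset_iff)
    next
      case 2
      hence "d (\<rho> s) (\<rho> t) = t - s" using that vq[of s] vq[of t] by (simp add: \<rho>q qd)
      thus ?thesis using that zero[of "\<rho> s" "\<rho> s"] \<rho>M by (auto simp: image_subset_iff)
    next
      case 3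
      have "\<rho> t \<in> B" using 3 that vq by (simp add: \<rho>q q)
      moreover have "\<rho> s \<notin> B" using nB[of s] 3 that by (simp add: \<rho>p)
      ultimately show ?thesis by auto
    qed
  qed
  have inj: "inj_on \<rho> {0..L}"
  proof (rule inj_onI)
    fix s t assume "s \<in> {0..L}" "t \<in> {0..L}" "\<rho> s = \<rho> t"
    thus "s = t" using inj1[of s t] inj1[of t s] by (metis atLeastAtMost_iff linorder_neqE_linordered_idom)
  qed
  have ends: "\<rho> 0 = x" "\<rho> L = y"
    using t00 s0 p q by (simp_all add: \<rho>p \<rho>q L_def)
  have xM: "x \<in> M" and yM: "y \<in> M" using pM[of 0] qM[of 0] a0 b0 p q by auto
  note R = r(1)[unfolded geodesic_def]
  have rd: "d (r s) (r t) = \<bar>s - t\<bar>" if "s \<in> {0..c}" "t \<in> {0..c}" for s t using R that by blast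
  have c0: "0 \<le> c" using R by auto
  have dxy: "d x y = c" using rd[of 0 c] c0 r by simp
  show ?thesis
  proof (cases "x = y")
    case True
    hence "c = 0" using dxy zero[OF xM xM] by simp
    hence "C = {x}" using r by simp
    thus ?thesis using p a0 by force
  next
    case False
    have "L \<noteq> 0" using ends False by auto
    hence "arc_between M d x y (\<rho> ` {0..L})"
      using arc_between_Lipschitz[OF Metric_space_axioms _ \<rho>M inj lip] L0 ends by simp
    moreover have "c \<noteq> 0" using False dxy zero[OF xM yM] by simp
    hence "0 < c" using c0 by simp
    hence "arc_between M d x y C"
    proof -
      have "inj_on r {0..c}"
      proof (rule inj_onI)
        fix s t assume "s \<in> {0..c}" "t \<in> {0..c}" "r s = r t"
        thus "s = t" using rd[of s t] rd[of t t] by simp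
      qed
      thus ?thesis
        using arc_between_Lipschitz[OF Metric_space_axioms \<open>0 < c\<close>, of r] R r rd by auto
    qed
    ultimately have "\<rho> ` {0..L} = C"
      using T xM yM unfolding real_tree_def by metis
    thus ?thesis using \<rho>AB by simp
  qed
qed

lemma real_tree_transfer:
  assumes T: "real_tree M d" and "N \<noteq> {}" and inj: "inj_on h N" and sub: "h ` N \<subseteq> M"
    and conv: "\<And>x y A. x \<in> N \<Longrightarrow> y \<in> N \<Longrightarrow> geodesic_segment M d (h x) (h y) A \<Longrightarrow> A \<subseteq> h ` N"
  shows "real_tree N (\<lambda>x y. d (h x) (h y))"
proof -
  let ?e = "\<lambda>x y. d (h x) (h y)"
  interpret M: Metric_space M d using T by (simp add: real_tree_def)
  have N: "Metric_space N ?e"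
  proof
    show "?e x y = 0 \<longleftrightarrow> x = y" if "x \<in> N" "y \<in> N" for x y
      using that inj sub by (metis M.zero image_subset_iff inj_on_eq_iff)
    show "?e x z \<le> ?e x y + ?e y z" if "x \<in> N" "y \<in> N" "z \<in> N" for x y z
      using that sub by (intro M.triangle) auto
  qed (auto simp: M.commute)
  interpret N: Metric_space N ?e by (rule N)
  have cont: "continuous_map N.mtopology M.mtopology h"
    unfolding N.metric_continuous_map[OF M.Metric_space_axioms] using sub by auto
  have "\<exists>A. geodesic_segment N ?e x y A \<and> (\<forall>B. arc_between N ?e x y B \<longrightarrow> B = A)"
    if x: "x \<in> N" and y: "y \<in> N" for x y
  proof -
    have "h x \<in> M" "h y \<in> M" using x y sub by auto
    then obtain A where A: "geodesic_segment M d (h x) (h y) A"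
      and uniq: "\<And>B. arc_between M d (h x) (h y) B \<Longrightarrow> B = A"
      using T unfolding real_tree_def by metis
    obtain l \<gamma> where g: "geodesic M d l \<gamma>" "\<gamma> 0 = h x" "\<gamma> l = h y" "A = \<gamma> ` {0..l}"
      using A by (auto simp: geodesic_segment_def)
    define k where "k = inv_into N h"
    have AN: "A \<subseteq> h ` N" using conv[OF x y A] .
    have hk: "h (k z) = z" "k z \<in> N" if "z \<in> A" for z
      using that AN by (auto simp: k_def f_inv_into_f inv_into_into)
    have kh: "k (h z) = z" if "z \<in> N" for z using that inj by (simp add: k_def)
    have l0: "0 \<le> l" using g by (simp add: geodesic_def)
    have "geodesic N ?e l (k \<circ> \<gamma>)"
      using g hk unfolding geodesic_def by (auto simp: image_subset_iff)
    hence "geodesic_segment N ?e x y (k ` A)"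
      unfolding geodesic_segment_def using g x y
      by (intro exI[of _ l] exI[of _ "k \<circ> \<gamma>"]) (simp add: kh image_comp)
    moreover have "B = k ` A" if B: "arc_between N ?e x y B" for B
    proof -
      obtain \<beta> where b: "pathin N.mtopology \<beta>" "inj_on \<beta> {0..1}" "\<beta> 0 = x" "\<beta> 1 = y"
        "B = \<beta> ` {0..1}" using B by (auto simp: arc_between_def)
      have BN: "B \<subseteq> N"
        using b(1) unfolding b(5) pathin_def continuous_map_def by auto
      have "pathin M.mtopology (h \<circ> \<beta>)" using b(1) cont by (rule pathin_compose)
      moreover have "inj_on (h \<circ> \<beta>) {0..1}"
        using b(2) inj BN unfolding b(5) by (intro comp_inj_on inj_on_subset[OF inj]) auto
      ultimately have "arc_between M d (h x) (h y) (h ` B)"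
        unfolding arc_between_def using b by (intro exI[of _ "h \<circ> \<beta>"]) (auto simp: image_comp)
      hence "h ` B = A" by (rule uniq)
      thus ?thesis using BN kh by (force simp: image_iff)
    qed
    ultimately show ?thesis by blast
  qed
  thus ?thesis using N \<open>N \<noteq> {}\<close> by (auto simp: real_tree_def)
qed


lemma property_FR_fixed_point:
  fixes G :: "('a, 'm) monoid_scheme" and T :: "'x set"
  assumes FR: "property_FR G" and T: "real_tree T d" and act: "isometric_action G T d \<phi>"
  shows "\<exists>x\<in>T. \<forall>g\<in>carrier G. \<phi> g x = x"
proof -
  interpret group_action G T \<phi> using act by (simp add: isometric_action_def)
  interpret G: group G using group_hom group_hom.axioms(1) by auto
  have iso: "d (\<phi> g x) (\<phi> g y) = d x y" if "g \<in> carrier G" "x \<in> T" "y \<in> T" for g x y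
    using act that by (simp add: isometric_action_def)
  have \<phi>T: "\<phi> g x \<in> T" if "g \<in> carrier G" "x \<in> T" for g x
    using that element_image by blast
  obtain x0 where x0: "x0 \<in> T" using T by (auto simp: real_tree_def)
  have "\<exists>l \<gamma>. geodesic T d l \<gamma> \<and> \<gamma> 0 = x0 \<and> \<gamma> l = \<phi> g x0" if "g \<in> carrier G" for g
    using T x0 \<phi>T[OF that x0] unfolding real_tree_def geodesic_segment_def by metis
  then obtain l \<gamma> where \<gamma>: "\<And>g. g \<in> carrier G \<Longrightarrow> geodesic T d (l g) (\<gamma> g)"
    and \<gamma>0: "\<And>g. g \<in> carrier G \<Longrightarrow> \<gamma> g 0 = x0"
    and \<gamma>l: "\<And>g. g \<in> carrier G \<Longrightarrow> \<gamma> g (l g) = \<phi> g x0"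
    by metis
  define Y where "Y = (\<Union>g\<in>carrier G. \<gamma> g ` {0..l g})"
  have l0: "0 \<le> l g" if "g \<in> carrier G" for g using \<gamma>[OF that] by (simp add: geodesic_def)
  have YT: "Y \<subseteq> T" using \<gamma> unfolding Y_def geodesic_def by blast
  have orbitY: "\<phi> g x0 \<in> Y" if "g \<in> carrier G" for g
    unfolding Y_def using that l0[OF that] \<gamma>l[OF that] by (auto intro!: bexI[of _ g] image_eqI[of _ _ "l g"])
  have star: "\<exists>A. geodesic_segment T d y x0 A \<and> A \<subseteq> Y" if "y \<in> Y" for y
  proof -
    obtain g t where g: "g \<in> carrier G" "t \<in> {0..l g}" "y = \<gamma> g t" using \<open>y \<in> Y\<close> by (auto simp: Y_def)
    have "geodesic T d t (\<gamma> g)"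
      using \<gamma>[OF g(1)] g(2) unfolding geodesic_def by (auto simp: image_subset_iff)
    hence "geodesic_segment T d x0 y (\<gamma> g ` {0..t})"
      unfolding geodesic_segment_def using g \<gamma>0 by blast
    hence "geodesic_segment T d y x0 (\<gamma> g ` {0..t})" by (rule geodesic_segment_sym)
    moreover have "\<gamma> g ` {0..t} \<subseteq> Y" using g by (force simp: Y_def)
    ultimately show ?thesis by blast
  qed
  have convY: "A \<subseteq> Y" if xy: "x \<in> Y" "y \<in> Y" "geodesic_segment T d x y A" for x y A
  proof -
    obtain B C where "geodesic_segment T d x x0 B" "B \<subseteq> Y" "geodesic_segment T d y x0 C" "C \<subseteq> Y"
      using star[OF xy(1)] star[OF xy(2)] by auto
    thus ?thesis using real_tree_tripod[OF T _ _ xy(3), of x0 B C] by auto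
  qed
  have invY: "\<phi> g y \<in> Y" if g: "g \<in> carrier G" and "y \<in> Y" for g y
  proof -
    obtain k t where k: "k \<in> carrier G" "t \<in> {0..l k}" "y = \<gamma> k t" using \<open>y \<in> Y\<close> by (auto simp: Y_def)
    have kT: "\<gamma> k s \<in> T" if "s \<in> {0..l k}" for s using \<gamma>[OF k(1)] that by (auto simp: geodesic_def)
    have "geodesic T d (l k) (\<phi> g \<circ> \<gamma> k)"
      using \<gamma>[OF k(1)] kT \<phi>T[OF g] iso[OF g] unfolding geodesic_def by auto
    moreover have "(\<phi> g \<circ> \<gamma> k) 0 = \<phi> g x0" using \<gamma>0 k by simp
    moreover have "(\<phi> g \<circ> \<gamma> k) (l k) = \<phi> (g \<otimes>\<^bsub>G\<^esub> k) x0"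
      using \<gamma>l k g x0 by (simp add: composition_rule)
    ultimately have "geodesic_segment T d (\<phi> g x0) (\<phi> (g \<otimes>\<^bsub>G\<^esub> k) x0) ((\<phi> g \<circ> \<gamma> k) ` {0..l k})"
      unfolding geodesic_segment_def by blast
    hence "(\<phi> g \<circ> \<gamma> k) ` {0..l k} \<subseteq> Y" using orbitY g k by (intro convY) auto
    thus ?thesis using k by auto
  qed
  define h where "h = (\<lambda>(g, t). \<gamma> g t)"
  have "\<exists>n :: 'a \<times> real. h n = y" if "y \<in> Y" for y
    using that unfolding h_def Y_def by auto
  then obtain f :: "'x \<Rightarrow> 'a \<times> real" where hf: "\<And>y. y \<in> Y \<Longrightarrow> h (f y) = y"
    by metis
  define N where "N = f ` Y"
  have hN: "h n \<in> Y" "f (h n) = n" if "n \<in> N" for n using that hf by (auto simp: N_def)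
  have fN: "f y \<in> N" if "y \<in> Y" for y using that by (simp add: N_def)
  have hNY: "h ` N = Y" using hf by (force simp: N_def)
  have "real_tree N (\<lambda>x y. d (h x) (h y))"
  proof (rule real_tree_transfer[OF T])
    show "N \<noteq> {}" using orbitY[OF G.one_closed] by (auto simp: N_def)
    show "inj_on h N" using hN by (metis inj_onI)
    show "h ` N \<subseteq> T" using hNY YT by simp
    show "A \<subseteq> h ` N" if "x \<in> N" "y \<in> N" "geodesic_segment T d (h x) (h y) A" for x y A
      unfolding hNY using that hN by (intro convY) auto
  qed
  define \<psi> where "\<psi> g = (\<lambda>n\<in>N. f (\<phi> g (h n)))" for g
  have \<psi>N: "\<psi> g n \<in> N" if "g \<in> carrier G" "n \<in> N" for g n
    using that by (simp add: \<psi>_def hN fN invY)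
  have \<psi>\<psi>: "\<psi> (g \<otimes>\<^bsub>G\<^esub> k) n = \<psi> g (\<psi> k n)" if "g \<in> carrier G" "k \<in> carrier G" "n \<in> N" for g k n
    using that \<psi>N[OF that(2,3)] hN[OF that(3)] YT
    by (simp add: \<psi>_def hf invY composition_rule subset_iff)
  have \<psi>1: "\<psi> \<one>\<^bsub>G\<^esub> n = n" if "n \<in> N" for n
    using that hN YT by (simp add: \<psi>_def subset_iff flip: id_eq_one)
  have bij: "\<psi> g \<in> Bij N" if g: "g \<in> carrier G" for g
  proof -
    have "bij_betw (\<psi> g) N N"
      using \<psi>N \<psi>\<psi>[OF g] \<psi>\<psi>[of "inv\<^bsub>G\<^esub> g" g] \<psi>1 g
      by (intro bij_betw_byWitness[where f' = "\<psi> (inv\<^bsub>G\<^esub> g)"]) (auto simp flip: \<psi>\<psi>)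
    thus ?thesis by (simp add: Bij_def \<psi>_def)
  qed
  have "\<psi> \<in> hom G (BijGroup N)"
  proof (rule homI)
    show "\<psi> g \<in> carrier (BijGroup N)" if "g \<in> carrier G" for g
      using bij[OF that] by (simp add: BijGroup_def)
    show "\<psi> (g \<otimes>\<^bsub>G\<^esub> k) = \<psi> g \<otimes>\<^bsub>BijGroup N\<^esub> \<psi> k" if "g \<in> carrier G" "k \<in> carrier G" for g k
    proof -
      have "\<psi> (g \<otimes>\<^bsub>G\<^esub> k) = compose N (\<psi> g) (\<psi> k)"
        using \<psi>\<psi>[OF that] by (intro extensionalityI[of _ N]) (auto simp: compose_eq \<psi>_def[of "g \<otimes>\<^bsub>G\<^esub> k"])
      thus ?thesis using that bij by (simp add: BijGroup_def)
    qed
  qed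
  hence "group_action G N \<psi>"
    by (simp add: group_action_def group_hom_def group_hom_axioms_def group_BijGroup G.is_group)
  moreover have "d (h (\<psi> g m)) (h (\<psi> g n)) = d (h m) (h n)"
    if "g \<in> carrier G" "m \<in> N" "n \<in> N" for g m n
    using that hN YT by (simp add: \<psi>_def hf invY iso subset_iff)
  ultimately have "isometric_action G N (\<lambda>x y. d (h x) (h y)) \<psi>"
    by (simp add: isometric_action_def)
  with \<open>real_tree N _\<close> FR obtain n where n: "n \<in> N" "\<And>g. g \<in> carrier G \<Longrightarrow> \<psi> g n = n"
    unfolding property_FR_def by metis
  have "\<phi> g (h n) = h n" if "g \<in> carrier G" for g
  proof -
    have "f (\<phi> g (h n)) = n" using n(1) n(2)[OF that] by (simp add: \<psi>_def)
    thus ?thesis using hf[OF invY[OF that hN(1)[OF n(1)]]] by simp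
  qed
  thus ?thesis using n hN YT by blast
qed

lemma transition_hom:
  assumes "\<And>k. \<alpha> k \<in> hom (Gs k) (Gs (Suc k))"
  shows "transition \<alpha> k m \<in> hom (Gs k) (Gs (k + m))"
proof (induction m)
  case 0 show ?case by (auto simp: hom_def)
next
  case (Suc m)
  have "\<alpha> (k + m) \<circ> transition \<alpha> k m \<in> hom (Gs k) (Gs (Suc (k + m)))"
    by (rule Group.hom_compose[OF Suc assms])
  thus ?case by (simp add: comp_def)
qed

lemma transition_cocone:
  assumes hom: "\<And>k. \<alpha> k \<in> hom (Gs k) (Gs (Suc k))"
    and comp: "\<And>k x. x \<in> carrier (Gs k) \<Longrightarrow> \<psi> (Suc k) (\<alpha> k x) = \<psi> k x"
    and x: "x \<in> carrier (Gs k)"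
  shows "\<psi> (k + m) (transition \<alpha> k m x) = \<psi> k x"
proof (induction m)
  case (Suc m)
  have "transition \<alpha> k m x \<in> carrier (Gs (k + m))"
    using transition_hom[of \<alpha> Gs k m, OF hom] x by (auto simp: hom_def)
  thus ?case using Suc comp by simp
qed simp

lemma direct_limit_universal:
  fixes H :: "('c, 'h) monoid_scheme"
  assumes lim: "direct_limit Gs \<alpha> G \<eta>"
    and grp: "\<And>k. group (Gs k)"
    and hom: "\<And>k. \<alpha> k \<in> hom (Gs k) (Gs (Suc k))"
    and \<psi>: "\<And>k. \<psi> k \<in> hom (Gs k) H"
    and comp: "\<And>k x. x \<in> carrier (Gs k) \<Longrightarrow> \<psi> (Suc k) (\<alpha> k x) = \<psi> k x"
  shows "\<exists>!f. f \<in> hom G H \<inter> extensional (carrier G) \<and>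
              (\<forall>k. \<forall>x\<in>carrier (Gs k). f (\<eta> k x) = \<psi> k x)"
proof -
  have \<eta>: "\<And>k. \<eta> k \<in> hom (Gs k) G"
    and \<eta>c: "\<And>k x. x \<in> carrier (Gs k) \<Longrightarrow> \<eta> (Suc k) (\<alpha> k x) = \<eta> k x"
    and cov: "carrier G = (\<Union>k. \<eta> k ` carrier (Gs k))"
    and ker: "\<And>k x y. x \<in> carrier (Gs k) \<Longrightarrow> y \<in> carrier (Gs k) \<Longrightarrow> \<eta> k x = \<eta> k y \<Longrightarrow>
                \<exists>m. transition \<alpha> k m x = transition \<alpha> k m y"
    using lim unfolding direct_limit_def by (elim conjE; simp)+
  have tr: "transition \<alpha> k m x \<in> carrier (Gs (k + m))" if "x \<in> carrier (Gs k)" for k m x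
    using transition_hom[of \<alpha> Gs k m, OF hom] that by (auto simp: hom_def)
  have lift: "\<exists>x'\<in>carrier (Gs (k + j)). \<eta> (k + j) x' = \<eta> k x \<and> \<psi> (k + j) x' = \<psi> k x"
    if "x \<in> carrier (Gs k)" for k j x
    using tr[OF that] transition_cocone[of \<alpha> Gs \<eta>, OF hom \<eta>c that]
      transition_cocone[of \<alpha> Gs \<psi>, OF hom comp that] by blast
  have common: "\<exists>n. \<exists>x'\<in>carrier (Gs n). \<exists>y'\<in>carrier (Gs n).
       \<eta> n x' = \<eta> k x \<and> \<psi> n x' = \<psi> k x \<and> \<eta> n y' = \<eta> j y \<and> \<psi> n y' = \<psi> j y"
    if "x \<in> carrier (Gs k)" "y \<in> carrier (Gs j)" for k j x y
    using lift[OF that(1), of j] lift[OF that(2), of k] by (metis add.commute)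
  have wd: "\<psi> k x = \<psi> j y"
    if xy: "x \<in> carrier (Gs k)" "y \<in> carrier (Gs j)" "\<eta> k x = \<eta> j y" for k j x y
  proof -
    obtain n x' y' where n: "x' \<in> carrier (Gs n)" "y' \<in> carrier (Gs n)"
      "\<eta> n x' = \<eta> k x" "\<psi> n x' = \<psi> k x" "\<eta> n y' = \<eta> j y" "\<psi> n y' = \<psi> j y"
      using common[OF xy(1,2)] by blast
    then obtain m where "transition \<alpha> n m x' = transition \<alpha> n m y'"
      using ker[OF n(1,2)] xy(3) by auto
    thus ?thesis
      using transition_cocone[of \<alpha> Gs \<psi>, OF hom comp] n by metis
  qed
  have "\<exists>z. \<forall>k. \<forall>x\<in>carrier (Gs k). \<eta> k x = g \<longrightarrow> \<psi> k x = z" for g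
    using wd by metis
  then obtain f where f: "\<And>g k x. x \<in> carrier (Gs k) \<Longrightarrow> \<eta> k x = g \<Longrightarrow> \<psi> k x = f g"
    by metis
  have \<eta>G: "\<eta> k x \<in> carrier G" if "x \<in> carrier (Gs k)" for k x
    using \<eta> that by (auto simp: hom_def)
  show ?thesis
  proof (rule ex_ex1I)
    have "restrict f (carrier G) \<in> hom G H"
    proof (rule homI)
      fix g assume "g \<in> carrier G"
      then obtain k x where "x \<in> carrier (Gs k)" "g = \<eta> k x" using cov by auto
      thus "restrict f (carrier G) g \<in> carrier H"
        using f[of x k g] \<eta>G hom_in_carrier[OF \<psi>[of k], of x] by simp
    next
      fix g g' assume g: "g \<in> carrier G" "g' \<in> carrier G"
      then obtain k x j y where "x \<in> carrier (Gs k)" "g = \<eta> k x" "y \<in> carrier (Gs j)" "g' = \<eta> j y"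
        using cov by auto
      then obtain n x' y' where n: "x' \<in> carrier (Gs n)" "y' \<in> carrier (Gs n)" "\<eta> n x' = g" "\<eta> n y' = g'"
        using common[of x k y j] by auto
      have xy: "x' \<otimes>\<^bsub>Gs n\<^esub> y' \<in> carrier (Gs n)" using n grp[of n] by (simp add: group.subgroup_self subgroup.m_closed)
      have e: "\<eta> n (x' \<otimes>\<^bsub>Gs n\<^esub> y') = g \<otimes>\<^bsub>G\<^esub> g'" using \<eta>[of n] n by (auto simp: hom_def)
      have "f (g \<otimes>\<^bsub>G\<^esub> g') = \<psi> n (x' \<otimes>\<^bsub>Gs n\<^esub> y')" using f[OF xy e] by simp
      also have "\<dots> = \<psi> n x' \<otimes>\<^bsub>H\<^esub> \<psi> n y'" using \<psi>[of n] n by (auto simp: hom_def)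
      also have "\<dots> = f g \<otimes>\<^bsub>H\<^esub> f g'" using f n by simp
      finally show "restrict f (carrier G) (g \<otimes>\<^bsub>G\<^esub> g') =
          restrict f (carrier G) g \<otimes>\<^bsub>H\<^esub> restrict f (carrier G) g'"
        using g \<eta>G[OF xy] e by simp
    qed
    thus "\<exists>f. f \<in> hom G H \<inter> extensional (carrier G) \<and>
        (\<forall>k. \<forall>x\<in>carrier (Gs k). f (\<eta> k x) = \<psi> k x)"
      using f \<eta>G by (intro exI[of _ "restrict f (carrier G)"]) auto
  next
    fix f f'
    assume f: "f \<in> hom G H \<inter> extensional (carrier G) \<and> (\<forall>k. \<forall>x\<in>carrier (Gs k). f (\<eta> k x) = \<psi> k x)"
      and f': "f' \<in> hom G H \<inter> extensional (carrier G) \<and> (\<forall>k. \<forall>x\<in>carrier (Gs k). f' (\<eta> k x) = \<psi> k x)"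
    show "f = f'"
    proof (rule extensionalityI)
      show "f g = f' g" if "g \<in> carrier G" for g using that f f' unfolding cov by auto
    qed (use f f' in auto)
  qed
qed

lemma (in group) inner_aut_auto:
  assumes "g \<in> carrier G"
  shows "inner_aut G g \<in> auto G"
proof -
  have "inner_aut G g \<in> hom G G"
    using assms unfolding inner_aut_def
    by (intro homI) (simp_all add: m_assoc, simp add: l_inv flip: m_assoc[of "inv g" g])
  moreover have "inner_aut G g \<in> Bij (carrier G)"
    using assms conjugation_is_bij by (simp add: Bij_def inner_aut_def)
  ultimately show ?thesis by (simp add: auto_def)
qed

lemma (in group) inner_aut_mult:
  assumes "g \<in> carrier G" "h \<in> carrier G" "x \<in> carrier G"
  shows "inner_aut G g (inner_aut G h x) = inner_aut G (g \<otimes> h) x"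
  using assms by (simp add: inner_aut_def m_assoc inv_mult_group)

lemma (in group) endo_norm_inner_aut:
  assumes S: "S \<subseteq> carrier G" and h: "h \<in> carrier G" and \<psi>: "\<psi> \<in> carrier G \<rightarrow> carrier G"
  shows "endo_norm G S (compose (carrier G) (inner_aut G h) \<psi>) = endo_norm G S \<psi>"
proof -
  have "endo_size G S (inner_aut G g \<circ> compose (carrier G) (inner_aut G h) \<psi>) =
        endo_size G S (inner_aut G (g \<otimes> h) \<circ> \<psi>)" if "g \<in> carrier G" for g
  proof -
    have "inner_aut G g (compose (carrier G) (inner_aut G h) \<psi> s) = inner_aut G (g \<otimes> h) (\<psi> s)"
      if "s \<in> S" for s
      using that S \<psi> \<open>g \<in> carrier G\<close> h by (subst inner_aut_mult[symmetric]) (auto simp: compose_eq)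
    thus ?thesis unfolding endo_size_def by (intro arg_cong[of _ _ "\<lambda>Z. Max (insert 0 Z)"] image_cong) auto
  qed
  hence "(\<lambda>g. endo_size G S (inner_aut G g \<circ> compose (carrier G) (inner_aut G h) \<psi>)) ` carrier G =
         (\<lambda>g. endo_size G S (inner_aut G g \<circ> \<psi>)) ` ((\<lambda>g. g \<otimes> h) ` carrier G)"
    by (simp add: image_image)
  also have "(\<lambda>g. g \<otimes> h) ` carrier G = carrier G"
    
  proof (intro equalityI subsetI)
    fix k assume "k \<in> carrier G"
    hence "k = k \<otimes> inv h \<otimes> h" using h by (simp add: m_assoc)
    thus "k \<in> (\<lambda>g. g \<otimes> h) ` carrier G" using h \<open>k \<in> carrier G\<close> by blast
  qed (use h in auto)
  finally show ?thesis unfolding endo_norm_def by (rule arg_cong[of _ _ Inf])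
qed

lemma (in group) out_norm_eq:
  assumes S: "S \<subseteq> carrier G" and \<Phi>: "\<Phi> \<in> carrier (Out G)" and \<phi>: "\<phi> \<in> \<Phi>"
  shows "out_norm G S \<Phi> = endo_norm G S \<phi>"
proof -
  obtain \<psi> where \<psi>: "\<psi> \<in> auto G" and \<Phi>_eq: "\<Phi> = Inn G #>\<^bsub>AutoGroup G\<^esub> \<psi>"
    using \<Phi> by (auto simp: Out_def FactGroup_def RCOSETS_def AutoGroup_def)
  have \<psi>': "\<psi> \<in> carrier G \<rightarrow> carrier G" "\<psi> \<in> Bij (carrier G)" using \<psi> by (auto simp: auto_def hom_def)
  have "endo_norm G S \<theta> = endo_norm G S \<psi>" if \<theta>: "\<theta> \<in> \<Phi>" for \<theta>
  proof -
    obtain h where h: "h \<in> carrier G" "\<theta> = inner_aut G h \<otimes>\<^bsub>AutoGroup G\<^esub> \<psi>"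
      using \<theta> by (auto simp: \<Phi>_eq r_coset_def Inn_def)
    moreover have "inner_aut G h \<in> Bij (carrier G)" using inner_aut_auto[OF h(1)] by (simp add: auto_def)
    ultimately have "\<theta> = compose (carrier G) (inner_aut G h) \<psi>"
      using \<psi>' by (simp add: AutoGroup_def BijGroup_def)
    thus ?thesis using endo_norm_inner_aut[OF S h(1) \<psi>'(1)] by simp
  qed
  thus ?thesis unfolding out_norm_def using \<phi> by (metis someI)
qed

end

theory Submission
  imports Defs "HOL-Complex_Analysis.Great_Picard"
begin

text \<open>Suppose that for every \<open>n\<close> the interval with \<open>A = n + 1\<close> and \<open>B = 1/10\<close> contains the norm \<open>N n\<close> of an
  outer automorphism at some index \<open>k n \<ge> n\<close>, and let \<open>\<psi> n\<close> be a representative of minimal size.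
  Choose lifts of the elements \<open>\<psi> n s\<close>, \<open>s \<in> S\<close>, of length at most \<open>N n\<close> in the group \<open>Gs (k n)\<close>.
  A relator of this group has length at most \<open>10 \<delta>\<close>, so substituting the lifts into it gives an
  element of length at most \<open>10 \<delta> N n\<close>; this element is trivial in \<open>G\<close> and lies in a ball on which
  \<open>\<eta>\<close> is injective (this is the role of the upper end of the interval), hence is trivial
  (\<open>lifted_relation\<close>).  Therefore every relation of \<open>G\<close> is respected by the lifts for all large \<open>n\<close>, and
  they define maps \<open>u n\<close> from \<open>G\<close> to \<open>Gs (k n)\<close> that are multiplicative in the limit.  By minimality
  of \<open>\<psi> n\<close>, every vertex of the Cayley graph of \<open>Gs (k n)\<close> is moved by at least \<open>N n\<close> by some \<open>u n s\<close>.

  This is impossible by a rescaling argument in the manner of Bestvina and Paulin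
  (\<open>asymptotic_homs_have_small_displacement\<close>).  After division by \<open>N n\<close> the hyperbolicity constants tend
  to \<open>0\<close> (this is the role of the lower end of the interval), and along a subsequence the distances
  of the points \<open>u n g\<close> converge to a left-invariant pseudo-metric on \<open>G\<close> that satisfies the
  four-point condition without error.  Such a metric spans a real tree on which \<open>G\<close> acts.
  The tree is realized by functions on \<open>G\<close>, a point being identified with its distance function to
  the points of \<open>G\<close>; a fixed point is then a constant function, and it exists only if the diameter of the
  pseudo-metric is attained by some pair \<open>x\<close>, \<open>y\<close> (\<open>property_FR_diameter_attained\<close>).  The midpoints of
  geodesics from \<open>u n x\<close> to \<open>u n y\<close> are then almost fixed by the generators, a contradiction.

  Geodesics and midpoints are taken in the set of vertices, which costs bounded errors.  They are
  harmless since \<open>N n\<close> tends to infinity unless \<open>\<delta> k < 1/10\<close> for infinitely many \<open>k\<close>.  In the latter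
  case these groups have no nonempty relators, so the exponent sum is well-defined on \<open>G\<close> and pulls
  the metric of the integers back to \<open>G\<close>.  If there is a generator, then the diameter of this metric is
  infinite and not attained; hence \<open>S\<close> is empty (\<open>no_generators_if_frequently_free\<close>) and all norms are \<open>0\<close>.\<close>

section \<open>Real trees from the four-point condition\<close>

text \<open>Gromov's four-point condition.  For \<open>\<epsilon> = 0\<close> it characterizes the subspaces of real trees.\<close>

definition four_point :: "'x set \<Rightarrow> ('x \<Rightarrow> 'x \<Rightarrow> real) \<Rightarrow> real \<Rightarrow> bool" where
  "four_point M d \<epsilon> \<longleftrightarrow>
     (\<forall>x\<in>M. \<forall>y\<in>M. \<forall>z\<in>M. \<forall>w\<in>M.
        d x y + d z w \<le> max (d x z + d y w) (d x w + d y z) + \<epsilon>)"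

lemma four_pointD:
  assumes "four_point M d \<epsilon>" "x \<in> M" "y \<in> M" "z \<in> M" "w \<in> M"
  shows "d x y + d z w \<le> max (d x z + d y w) (d x w + d y z) + \<epsilon>"
  using assms by (auto simp: four_point_def)

text \<open>Sending a point \<open>z\<close> to the point of a geodesic \<open>A\<close> from \<open>x\<close> to \<open>y\<close> whose distance from \<open>x\<close> is the Gromov
  product of \<open>y\<close> and \<open>z\<close> is a continuous retraction onto \<open>A\<close>, and it is locally constant outside \<open>A\<close>.  By
  connectedness a path can change its image under the retraction only by passing through it.
  So an arc from \<open>x\<close> to \<open>y\<close> covers \<open>A\<close>; and if it left \<open>A\<close>, it would have to come back through the point
  at which it left, contrary to injectivity.\<close>

lemma real_tree_if_geodesic_four_point:
  assumes metric: "Metric_space M d" and "M \<noteq> {}" and four: "four_point M d 0"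
    and geod: "\<And>x y. x \<in> M \<Longrightarrow> y \<in> M \<Longrightarrow> \<exists>A. geodesic_segment M d x y A"
  shows "real_tree M d"
proof -
  interpret Metric_space M d by fact
  note fp = four_pointD[OF four]
  have "B = A" if A: "geodesic_segment M d x y A" and B: "arc_between M d x y B" for x y A B
  proof -
    obtain l \<gamma> where "geodesic M d l \<gamma>" and \<gamma>0: "\<gamma> 0 = x" and \<gamma>l: "\<gamma> l = y" and A_eq: "A = \<gamma> ` {0..l}"
      using A by (auto simp: geodesic_segment_def)
    hence l0: "0 \<le> l" and \<gamma>M: "\<And>s. s \<in> {0..l} \<Longrightarrow> \<gamma> s \<in> M"
      and \<gamma>d: "\<And>s t. s \<in> {0..l} \<Longrightarrow> t \<in> {0..l} \<Longrightarrow> d (\<gamma> s) (\<gamma> t) = \<bar>s - t\<bar>"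
      by (auto simp: geodesic_def)
    have xM: "x \<in> M" and yM: "y \<in> M" using \<gamma>M[of 0] \<gamma>M[of l] \<gamma>0 \<gamma>l l0 by auto
    have dxy: "d x y = l" using \<gamma>d[of 0 l] \<gamma>0 \<gamma>l l0 by simp
    obtain \<beta> where path: "pathin mtopology \<beta>" and inj: "inj_on \<beta> {0..1}"
      and \<beta>0: "\<beta> 0 = x" and \<beta>1: "\<beta> 1 = y" and B_eq: "B = \<beta> ` {0..1}"
      using B by (auto simp: arc_between_def)
    have cont: "continuous_map (top_of_set {0..1}) mtopology \<beta>" using path by (simp add: pathin_def)
    have \<beta>M: "\<beta> t \<in> M" if "t \<in> {0..1}" for t
      using continuous_map_image_subset_topspace[OF cont] that by auto
    \<comment> \<open>The Gromov product of \<open>y\<close> and \<open>z\<close> with respect to \<open>x\<close>.\<close>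
    define P where "P z = (d x y + d x z - d y z) / 2" for z
    have P_range: "P z \<in> {0..l}" if "z \<in> M" for z
      using triangle[OF xM yM that] triangle[OF yM xM that] triangle[OF xM that yM] dxy
      by (auto simp: P_def commute)
    have P\<gamma>: "P (\<gamma> s) = s" if "s \<in> {0..l}" for s
      using \<gamma>d[of 0 s] \<gamma>d[of l s] that l0 dxy \<gamma>0 \<gamma>l by (simp add: P_def)
    have near: "\<exists>e>0. \<forall>t\<in>{0..1}. \<bar>t - u\<bar> < e \<longrightarrow> d (\<beta> u) (\<beta> t) < r" if u: "u \<in> {0..1}" and r: "0 < r" for u r
    proof -
      obtain U where U: "openin (top_of_set {0..1}) U" "u \<in> U" "\<And>t. t \<in> U \<Longrightarrow> \<beta> t \<in> mball (\<beta> u) r"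
        using cont u r unfolding continuous_map_to_metric by (metis topspace_euclidean_subtopology)
      then obtain e where "e > 0" "ball u e \<inter> {0..1} \<subseteq> U" by (auto simp: openin_contains_ball)
      thus ?thesis using U by (intro exI[of _ e]) (auto simp: dist_real_def abs_minus_commute subset_iff)
    qed
    have locally_const: "P w = P z" if z: "z \<in> M" and w: "w \<in> M" and r: "d z w < d z (\<gamma> (P z))" for z w
    proof -
      define p where "p = \<gamma> (P z)"
      have pM: "p \<in> M" and dxp: "d x p = P z" and dyp: "d y p = l - P z"
        using P_range[OF z] \<gamma>M \<gamma>d[of 0 "P z"] \<gamma>d[of l "P z"] l0 \<gamma>0 \<gamma>l by (auto simp: p_def)
      have Pz: "2 * P z = l + d x z - d y z" by (simp add: P_def dxy)
      have c: "d p y = d y p" "d p x = d x p" "d z x = d x z" "d z y = d y z" "d w z = d z w"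
        "d w y = d y w" "d w x = d x w" "d y x = d x y" by (simp_all add: commute)
      have "d z p + d x y \<le> max (d z x + d p y) (d z y + d p x) + 0"
        by (rule fp) (use z pM xM yM in auto)
      hence zp: "d z p \<le> d x z - P z" using Pz unfolding c dxp dyp dxy by linarith
      have "d x z \<le> d x w + d z w" "d y z \<le> d y w + d z w"
        using triangle[OF xM w z] triangle[OF yM w z] c by auto
      moreover have "d x w + d y z \<le> max (d x y + d w z) (d x z + d w y) + 0"
        by (rule fp) (use z w xM yM in auto)
      moreover have "d y w + d x z \<le> max (d y x + d w z) (d y z + d w x) + 0"
        by (rule fp) (use z w xM yM in auto)
      ultimately have "d x w - d y w = d x z - d y z"
        using r zp Pz unfolding p_def[symmetric] c dxy by linarith
      thus ?thesis by (simp add: P_def)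
    qed
    have P_lip: "\<bar>P z - P w\<bar> \<le> d z w" if "z \<in> M" "w \<in> M" for z w
    proof -
      have "\<bar>d x z - d x w\<bar> \<le> d z w" "\<bar>d y z - d y w\<bar> \<le> d z w"
        using mdist_reverse_triangle[of z x w] mdist_reverse_triangle[of z y w] that xM yM
        by (auto simp: commute)
      moreover have "P z - P w = ((d x z - d x w) - (d y z - d y w)) / 2"
        by (simp add: P_def field_simps)
      ultimately show ?thesis unfolding abs_le_iff by (simp add: field_simps)
    qed
    have contP: "continuous_on {0..1} (\<lambda>t. P (\<beta> t))"
      unfolding continuous_on_iff
    proof (intro ballI allI impI)
      fix u e :: real assume u: "u \<in> {0..1}" and "0 < e"
      then obtain r where r: "r > 0" "\<And>t. t \<in> {0..1} \<Longrightarrow> \<bar>t - u\<bar> < r \<Longrightarrow> d (\<beta> u) (\<beta> t) < e"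
        using near by metis
      have "dist (P (\<beta> t)) (P (\<beta> u)) < e" if "t \<in> {0..1}" "dist t u < r" for t
        using r(2)[of t] that P_lip[OF \<beta>M[OF u] \<beta>M[OF that(1)]]
        by (auto simp: dist_real_def abs_minus_commute)
      thus "\<exists>r>0. \<forall>t\<in>{0..1}. dist t u < r \<longrightarrow> dist (P (\<beta> t)) (P (\<beta> u)) < e" using r(1) by blast
    qed
    \<comment> \<open>The times at which the retraction \<open>\<gamma> (P z)\<close> takes a given value form a closed set; it is open as well
      if the path avoids this value.\<close>
    have crossing: "P (\<beta> t) = P (\<beta> t0)"
      if ab: "0 \<le> a" "b \<le> 1" and t0: "t0 \<in> {a..b}" and t: "t \<in> {a..b}"
        and avoid: "\<gamma> (P (\<beta> t0)) \<notin> \<beta> ` {a..b}" for a b t0 t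
    proof -
      let ?s = "P (\<beta> t0)"
      let ?E = "{u \<in> {a..b}. P (\<beta> u) = ?s}"
      have cl: "closedin (top_of_set {a..b}) ?E"
        using ab by (intro continuous_closedin_preimage_constant continuous_on_subset[OF contP]) auto
      have op: "openin (top_of_set {a..b}) ?E"
        unfolding openin_contains_ball
      proof (intro conjI ballI)
        fix u assume u: "u \<in> ?E"
        hence u1: "u \<in> {0..1}" using ab by auto
        let ?p = "\<gamma> (P (\<beta> u))"
        have "?p \<in> M" "?p \<noteq> \<beta> u"
          using \<gamma>M[OF P_range[OF \<beta>M[OF u1]]] u avoid by auto
        hence "0 < d (\<beta> u) ?p" using mdist_pos_less[of "\<beta> u" ?p] \<beta>M[OF u1] by auto
        then obtain e where e: "e > 0" "\<And>t. t \<in> {0..1} \<Longrightarrow> \<bar>t - u\<bar> < e \<Longrightarrow> d (\<beta> u) (\<beta> t) < d (\<beta> u) ?p"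
          using near[OF u1] by metis
        have "P (\<beta> v) = ?s" if v: "v \<in> ball u e \<inter> {a..b}" for v
        proof -
          have v1: "v \<in> {0..1}" using v ab by auto
          have "P (\<beta> v) = P (\<beta> u)"
            using v by (intro locally_const \<beta>M u1 v1 e(2)) (auto simp: dist_real_def abs_minus_commute)
          thus ?thesis using u by simp
        qed
        thus "\<exists>e>0. ball u e \<inter> {a..b} \<subseteq> ?E" using e(1) by (intro exI[of _ e]) auto
      qed auto
      have "?E = {} \<or> ?E = {a..b}"
        using connected_clopen[of "{a..b}"] cl op by auto
      thus ?thesis using t0 t by blast
    qed
    have P0: "P (\<beta> 0) = 0" and P1: "P (\<beta> 1) = l"
      using P\<gamma>[of 0] P\<gamma>[of l] \<gamma>0 \<gamma>l \<beta>0 \<beta>1 l0 by auto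
    have "x \<noteq> y" using inj_onD[OF inj, of 0 1] \<beta>0 \<beta>1 by auto
    hence l: "0 < l" using dxy mdist_pos_less xM yM by blast
    have "A \<subseteq> B"
    proof
      fix p assume "p \<in> A"
      then obtain s where s: "s \<in> {0..l}" "p = \<gamma> s" by (auto simp: A_eq)
      then obtain t0 where t0: "t0 \<in> {0..1}" "P (\<beta> t0) = s"
        using IVT'[of "\<lambda>t. P (\<beta> t)" 0 s 1] P0 P1 contP by auto
      show "p \<in> B"
      proof (rule ccontr)
        assume "p \<notin> B"
        hence "P (\<beta> 0) = s" "P (\<beta> 1) = s"
          using crossing[of 0 1 t0 0] crossing[of 0 1 t0 1] t0 s(2) by (auto simp: B_eq)
        thus False using P0 P1 l by simp
      qed
    qed
    moreover have "B \<subseteq> A"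
    proof
      fix q assume "q \<in> B"
      then obtain t0 where t0: "t0 \<in> {0..1}" "q = \<beta> t0" by (auto simp: B_eq)
      let ?p = "\<gamma> (P q)"
      have r: "P q \<in> {0..l}" using P_range \<beta>M t0 by auto
      have pA: "?p \<in> A" using r by (auto simp: A_eq)
      have "?p \<in> \<beta> ` {0..t0}"
      proof (rule ccontr)
        assume *: "?p \<notin> \<beta> ` {0..t0}"
        hence "P q = 0" using crossing[of 0 t0 t0 0] t0 P0 by auto
        moreover have "\<beta> 0 \<in> \<beta> ` {0..t0}" using t0 by auto
        ultimately show False using * \<gamma>0 \<beta>0 by simp
      qed
      moreover have "?p \<in> \<beta> ` {t0..1}"
      proof (rule ccontr)
        assume *: "?p \<notin> \<beta> ` {t0..1}"
        hence "P q = l" using crossing[of t0 1 t0 1] t0 P1 by auto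
        moreover have "\<beta> 1 \<in> \<beta> ` {t0..1}" using t0 by auto
        ultimately show False using * \<gamma>l \<beta>1 by simp
      qed
      ultimately obtain t1 t2 where t12: "t1 \<in> {0..t0}" "t2 \<in> {t0..1}" "?p = \<beta> t1" "?p = \<beta> t2" by blast
      hence "t1 = t2" using inj_onD[OF inj, of t1 t2] t0 by auto
      hence "?p = q" using t12 t0 by auto
      thus "q \<in> A" using pA by simp
    qed
    ultimately show "B = A" by blast
  qed
  moreover have "\<exists>A. geodesic_segment M d x y A" if "x \<in> M" "y \<in> M" for x y by (rule geod[OF that])
  ultimately show ?thesis using metric \<open>M \<noteq> {}\<close> unfolding real_tree_def by meson
qed

section \<open>The tree spanned by a zero-hyperbolic space\<close>

locale zero_hyperbolic =
  fixes Y :: "'x set" and d :: "'x \<Rightarrow> 'x \<Rightarrow> real"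
  assumes nonempty: "Y \<noteq> {}"
    and dist_self: "\<And>x. x \<in> Y \<Longrightarrow> d x x = 0"
    and dist_sym: "\<And>x y. x \<in> Y \<Longrightarrow> y \<in> Y \<Longrightarrow> d x y = d y x"
    and four: "four_point Y d 0"
begin

lemma fp:
  assumes "x \<in> Y" "y \<in> Y" "z \<in> Y" "w \<in> Y"
  shows "d x y + d z w \<le> max (d x z + d y w) (d x w + d y z)"
  using four_pointD[OF four assms] by simp

text \<open>In a real tree the point at distance \<open>a\<close> from \<open>x\<close> and \<open>b\<close> from \<open>y\<close> on the segment from \<open>x\<close> to \<open>y\<close> has this
  distance from \<open>z\<close>.  These functions are the points of the tight span on segments between points of the space.\<close>

definition span_point :: "'x \<Rightarrow> 'x \<Rightarrow> real \<Rightarrow> real \<Rightarrow> 'x \<Rightarrow> real" where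
  "span_point x y a b = (\<lambda>z\<in>Y. max (d x z - a) (d y z - b))"

definition tree_span :: "('x \<Rightarrow> real) set" where
  "tree_span =
     {span_point x y a b | x y a b. x \<in> Y \<and> y \<in> Y \<and> 0 \<le> a \<and> 0 \<le> b \<and> a + b = d x y}"

lemma tree_span_extensional:
  assumes "f \<in> tree_span" shows "f \<in> extensional Y"
  using assms by (auto simp: tree_span_def span_point_def)

lemma tree_span_sum_ge:
  assumes f: "f \<in> tree_span" and z: "z \<in> Y" "w \<in> Y"
  shows "d z w \<le> f z + f w"
proof -
  obtain x y a b where *: "x \<in> Y" "y \<in> Y" "a + b = d x y" "f = span_point x y a b"
    using f by (auto simp: tree_span_def)
  have "d z w + d x y \<le> max (d x z + d y w) (d y z + d x w)"
    using fp[of z w x y] * z by (simp add: dist_sym add.commute)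
  moreover have "d x z - a \<le> f z" "d y z - b \<le> f z" "d x w - a \<le> f w" "d y w - b \<le> f w"
    using * z by (auto simp: span_point_def)
  ultimately show ?thesis using *(3) by linarith
qed

text \<open>The four-point condition for three points of the space and one point of the tree, whose
  distance from \<open>z\<close> is \<open>f z\<close>.\<close>

lemma tree_span_four_point:
  assumes f: "f \<in> tree_span" and xyz: "x \<in> Y" "y \<in> Y" "z \<in> Y"
  shows "f z + d x y \<le> max (f x + d y z) (f y + d x z)"
proof -
  obtain u v a b where *: "u \<in> Y" "v \<in> Y" "f = span_point u v a b"
    using f by (auto simp: tree_span_def)
  have "d u z + d x y \<le> max (d u x + d y z) (d u y + d x z)"
    using fp[of u z x y] * xyz by (simp add: dist_sym add.commute)
  moreover have "d v z + d x y \<le> max (d v x + d y z) (d v y + d x z)"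
    using fp[of v z x y] * xyz by (simp add: dist_sym add.commute)
  moreover have "f z = max (d u z - a) (d v z - b)"
    "d u x - a \<le> f x" "d v x - b \<le> f x" "d u y - a \<le> f y" "d v y - b \<le> f y"
    using * xyz by (auto simp: span_point_def)
  ultimately show ?thesis by linarith
qed

lemma tree_span_nonneg:
  assumes "f \<in> tree_span" "z \<in> Y" shows "0 \<le> f z"
  using tree_span_sum_ge[OF assms(1,2,2)] assms by (simp add: dist_self)

lemma span_point_ends:
  assumes "x \<in> Y" "y \<in> Y" "0 \<le> a" "0 \<le> b" "a + b = d x y"
  shows "span_point x y a b x = a" "span_point x y a b y = b"
  using assms by (auto simp: span_point_def dist_self dist_sym)

lemma span_point_in_tree_span:
  assumes "x \<in> Y" "y \<in> Y" "0 \<le> a" "0 \<le> b" "a + b = d x y"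
  shows "span_point x y a b \<in> tree_span"
  using assms by (auto simp: tree_span_def)

text \<open>A point of the tree is determined by its distances from the ends of any segment that contains it.\<close>

lemma tree_span_eq_span_point:
  assumes f: "f \<in> tree_span" and xy: "x \<in> Y" "y \<in> Y" "f x + f y = d x y"
  shows "f = span_point x y (f x) (f y)"
proof (rule extensionalityI)
  fix z assume z: "z \<in> Y"
  show "f z = span_point x y (f x) (f y) z"
    using tree_span_four_point[OF f xy(1,2) z] tree_span_sum_ge[OF f xy(1) z]
      tree_span_sum_ge[OF f xy(2) z] xy z by (simp add: span_point_def)
qed (use f tree_span_extensional in \<open>auto simp: span_point_def\<close>)

lemma tree_span_ends:
  assumes "f \<in> tree_span"
  obtains x y where "x \<in> Y" "y \<in> Y" "f x + f y = d x y"
    "\<And>z. z \<in> Y \<Longrightarrow> f z = d x z - f x \<or> f z = d y z - f y"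
proof -
  obtain x y a b where *: "x \<in> Y" "y \<in> Y" "0 \<le> a" "0 \<le> b" "a + b = d x y" "f = span_point x y a b"
    using assms by (auto simp: tree_span_def)
  moreover have "f z = d x z - f x \<or> f z = d y z - f y" if "z \<in> Y" for z
    using span_point_ends[OF *(1-5)] *(6) that by (auto simp: span_point_def)
  ultimately show ?thesis using span_point_ends[OF *(1-5)] that by metis
qed

text \<open>The outer absolute value makes the distance nonnegative for all functions; a metric space
  demands this of its distance function also outside its set of points.\<close>

definition span_dist :: "('x \<Rightarrow> real) \<Rightarrow> ('x \<Rightarrow> real) \<Rightarrow> real" where
  "span_dist f h = \<bar>SUP z\<in>Y. \<bar>f z - h z\<bar>\<bar>"

text \<open>If \<open>f\<close> lies on the segment from \<open>x\<close> to \<open>y\<close>, then seen from \<open>h\<close> one of the two ends lies behind \<open>f\<close>, and at this end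
  the supremum is attained.\<close>

lemma span_dist_attained:
  assumes f: "f \<in> tree_span" and h: "h \<in> tree_span"
  shows "\<exists>z\<in>Y. span_dist f h = h z - f z"
    and "\<And>z. z \<in> Y \<Longrightarrow> \<bar>f z - h z\<bar> \<le> span_dist f h"
proof -
  obtain x y where xy: "x \<in> Y" "y \<in> Y" "f x + f y = d x y"
    and fz: "\<And>z. z \<in> Y \<Longrightarrow> f z = d x z - f x \<or> f z = d y z - f y"
    using tree_span_ends[OF f] by blast
  define m where "m = max (h x - f x) (h y - f y)"
  have le: "\<bar>f z - h z\<bar> \<le> m" if z: "z \<in> Y" for z
  proof -
    have "f z - h z \<le> m"
      using fz[OF z] tree_span_sum_ge[OF h xy(1) z] tree_span_sum_ge[OF h xy(2) z]
      by (auto simp: m_def)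
    moreover have "h z - f z \<le> m"
      using tree_span_four_point[OF h xy(1,2) z] tree_span_sum_ge[OF f xy(1) z]
        tree_span_sum_ge[OF f xy(2) z] xy(3) unfolding m_def by linarith
    ultimately show ?thesis by linarith
  qed
  have "m \<in> (\<lambda>z. h z - f z) ` Y" using xy by (auto simp: m_def max_def)
  then obtain z where z: "z \<in> Y" "m = h z - f z" by blast
  have "m = \<bar>f z - h z\<bar>" using le[OF z(1)] z(2) by linarith
  hence "m \<le> (SUP z\<in>Y. \<bar>f z - h z\<bar>)"
    using z(1) le by (auto intro!: cSUP_upper2 bdd_aboveI2)
  moreover have "(SUP z\<in>Y. \<bar>f z - h z\<bar>) \<le> m"
    using nonempty le by (intro cSUP_least)
  ultimately have m: "span_dist f h = m"
    using \<open>m = \<bar>f z - h z\<bar>\<close> by (simp add: span_dist_def)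
  show "\<exists>z\<in>Y. span_dist f h = h z - f z" using z m by auto
  show "\<bar>f z - h z\<bar> \<le> span_dist f h" if "z \<in> Y" for z using le[OF that] m by simp
qed

lemma span_dist_sym: "span_dist f h = span_dist h f"
  unfolding span_dist_def by (simp add: abs_minus_commute)

lemma Metric_space_tree_span: "Metric_space tree_span span_dist"
proof
  show "0 \<le> span_dist f h" for f h by (simp add: span_dist_def)
  show "span_dist f h = span_dist h f" for f h by (rule span_dist_sym)
  show "span_dist f h = 0 \<longleftrightarrow> f = h" if f: "f \<in> tree_span" and h: "h \<in> tree_span" for f h
  proof
    assume "span_dist f h = 0"
    thus "f = h"
      using span_dist_attained(2)[OF f h] f h tree_span_extensional
      by (intro extensionalityI[of f Y h]) force+
  next
    assume "f = h"
    thus "span_dist f h = 0" using span_dist_attained(1)[OF f h] by auto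
  qed
  show "span_dist f k \<le> span_dist f h + span_dist h k"
    if f: "f \<in> tree_span" and h: "h \<in> tree_span" and k: "k \<in> tree_span" for f h k
  proof -
    obtain z where "z \<in> Y" "span_dist f k = k z - f z" using span_dist_attained(1)[OF f k] by blast
    thus ?thesis using span_dist_attained(2)[OF f h, of z] span_dist_attained(2)[OF h k, of z] by linarith
  qed
qed

lemma span_dist_nonneg: "0 \<le> span_dist f h"
  by (simp add: span_dist_def)

text \<open>The four-point condition for two points of the tree and two points of the space.\<close>

lemma span_dist_split:
  assumes f: "f \<in> tree_span" and h: "h \<in> tree_span" and z: "z \<in> Y" and w: "w \<in> Y"
  shows "f z + h w \<le> max (span_dist f h + d z w) (f w + h z)"
proof -
  obtain x where x: "x \<in> Y" and fz: "f z = d x z - f x"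
    using tree_span_ends[OF f] z by metis
  have "h w + d x z \<le> max (h x + d z w) (h z + d x w)"
    using tree_span_four_point[OF h x z w] .
  moreover have "h x - f x \<le> span_dist f h" using span_dist_attained(2)[OF f h x] by linarith
  moreover have "d x w \<le> f x + f w" by (rule tree_span_sum_ge[OF f x w])
  ultimately show ?thesis unfolding fz by linarith
qed

lemma four_point_tree_span: "four_point tree_span span_dist 0"
  unfolding four_point_def
proof (intro ballI)
  fix f g h k assume fghk: "f \<in> tree_span" "g \<in> tree_span" "h \<in> tree_span" "k \<in> tree_span"
  obtain z where z: "z \<in> Y" "span_dist f g = f z - g z"
    using span_dist_attained(1)[OF fghk(2,1)] span_dist_sym by metis
  obtain w where w: "w \<in> Y" "span_dist h k = h w - k w"
    using span_dist_attained(1)[OF fghk(4,3)] span_dist_sym by metis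
  have "f z + h w \<le> max (span_dist f h + d z w) (f w + h z)"
    by (rule span_dist_split) (use fghk z w in auto)
  moreover have "d z w \<le> g z + g w" by (rule tree_span_sum_ge) (use fghk z w in auto)
  moreover have "g w - k w \<le> span_dist g k" "f w - k w \<le> span_dist f k" "h z - g z \<le> span_dist g h"
    using span_dist_attained(2)[OF fghk(2,4) w(1)] span_dist_attained(2)[OF fghk(1,4) w(1)]
      span_dist_attained(2)[OF fghk(2,3) z(1)] by linarith+
  ultimately show "span_dist f g + span_dist h k
      \<le> max (span_dist f h + span_dist g k) (span_dist f k + span_dist g h) + 0"
    unfolding z(2) w(2) by linarith
qed

text \<open>Prolong the segment from \<open>f\<close> to \<open>h\<close> on both sides to points \<open>z\<close> and \<open>w\<close> of the space and move along
  the segment from \<open>z\<close> to \<open>w\<close>, on which \<open>f\<close> and \<open>h\<close> lie.\<close>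

lemma tree_span_geodesic:
  assumes f: "f \<in> tree_span" and h: "h \<in> tree_span"
  shows "\<exists>A. geodesic_segment tree_span span_dist f h A"
proof -
  define L where "L = span_dist f h"
  have L0: "0 \<le> L" by (simp add: L_def span_dist_nonneg)
  obtain w where w: "w \<in> Y" "L = f w - h w"
    using span_dist_attained(1)[OF h f] span_dist_sym unfolding L_def by metis
  obtain z where z: "z \<in> Y" "f w = d z w - f z"
    using tree_span_ends[OF f] w(1) by metis
  have hz: "h z = f z + L"
    using span_dist_attained(2)[OF f h z(1)] tree_span_sum_ge[OF h z(1) w(1)] z(2) w(2)
    unfolding L_def by linarith
  define k where "k t = span_point z w (f z + t) (f w - t)" for t
  have range: "0 \<le> f z + t" "0 \<le> f w - t" "(f z + t) + (f w - t) = d z w" if "t \<in> {0..L}" for t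
    using that tree_span_nonneg[OF f z(1)] tree_span_nonneg[OF h w(1)] z(2) w(2) by auto
  have kT: "k t \<in> tree_span" if "t \<in> {0..L}" for t
    unfolding k_def by (rule span_point_in_tree_span[OF z(1) w(1) range[OF that]])
  have kz: "k t z = f z + t" if "t \<in> {0..L}" for t
    unfolding k_def by (rule span_point_ends[OF z(1) w(1) range[OF that]])
  have dist: "span_dist (k s) (k t) = \<bar>s - t\<bar>" if s: "s \<in> {0..L}" and t: "t \<in> {0..L}" for s t
  proof (rule antisym)
    obtain v where v: "v \<in> Y" "span_dist (k s) (k t) = k t v - k s v"
      using span_dist_attained(1)[OF kT[OF s] kT[OF t]] by blast
    show "span_dist (k s) (k t) \<le> \<bar>s - t\<bar>"
      unfolding v(2) using v(1) by (auto simp: k_def span_point_def max_def)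
    show "\<bar>s - t\<bar> \<le> span_dist (k s) (k t)"
      using span_dist_attained(2)[OF kT[OF s] kT[OF t] z(1)] unfolding kz[OF s] kz[OF t] by simp
  qed
  have "k 0 = f" "k L = h"
    using tree_span_eq_span_point[OF f z(1) w(1)] tree_span_eq_span_point[OF h z(1) w(1)] z(2) w(2) hz
    by (auto simp: k_def)
  moreover have "geodesic tree_span span_dist L k"
    using L0 kT dist by (auto simp: geodesic_def)
  ultimately show ?thesis unfolding geodesic_segment_def by blast
qed

lemma real_tree_tree_span: "real_tree tree_span span_dist"
proof (rule real_tree_if_geodesic_four_point[OF Metric_space_tree_span _ four_point_tree_span tree_span_geodesic])
  obtain x where "x \<in> Y" using nonempty by blast
  thus "tree_span \<noteq> {}" using span_point_in_tree_span[of x x 0 0] by (auto simp: dist_self)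
qed

end

text \<open>\<open>G\<close> acts on the spanned tree by translation of functions.  A function fixed by this action is a
  constant \<open>c\<close>; as it lies on some segment from \<open>x\<close> to \<open>y\<close>, the length of this segment is \<open>2 c\<close>, while all
  distances are at most \<open>2 c\<close>.\<close>

theorem property_FR_diameter_attained:
  fixes G :: "('a, 'm) monoid_scheme" (structure)
  assumes G: "group G" and FR: "property_FR G" and zh: "zero_hyperbolic (carrier G) d"
    and inv: "\<And>g x y. g \<in> carrier G \<Longrightarrow> x \<in> carrier G \<Longrightarrow> y \<in> carrier G \<Longrightarrow>
      d (g \<otimes>\<^bsub>G\<^esub> x) (g \<otimes>\<^bsub>G\<^esub> y) = d x y"
  shows "\<exists>x\<in>carrier G. \<exists>y\<in>carrier G. \<forall>z\<in>carrier G. \<forall>w\<in>carrier G. d z w \<le> d x y"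
proof -
  interpret group G by fact
  interpret zero_hyperbolic "carrier G" d by fact
  define \<rho> where "\<rho> g = (\<lambda>f\<in>tree_span. \<lambda>z\<in>carrier G. f (inv g \<otimes> z))" for g
  have \<rho>_eq: "\<rho> g f z = f (inv g \<otimes> z)" if "f \<in> tree_span" "z \<in> carrier G" for g f z
    using that by (simp add: \<rho>_def)
  have \<rho>_ext: "\<rho> g f \<in> extensional (carrier G)" if "f \<in> tree_span" for g f
    using that by (simp add: \<rho>_def)
  have \<rho>T: "\<rho> g f \<in> tree_span" if g: "g \<in> carrier G" and f: "f \<in> tree_span" for g f
  proof -
    obtain x y a b where *: "x \<in> carrier G" "y \<in> carrier G" "0 \<le> a" "0 \<le> b" "a + b = d x y"
      "f = span_point x y a b"
      using f by (auto simp: tree_span_def)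
    have "d x (inv g \<otimes> z) = d (g \<otimes> x) z" if "x \<in> carrier G" "z \<in> carrier G" for x z
      using inv[OF g that(1), of "inv g \<otimes> z"] that g by (simp flip: m_assoc)
    hence "\<rho> g f = span_point (g \<otimes> x) (g \<otimes> y) a b"
      using * f g unfolding \<rho>_def by (simp add: span_point_def) (rule restrict_ext, simp)
    thus ?thesis using * g by (simp add: span_point_in_tree_span inv)
  qed
  have \<rho>_mult: "\<rho> (g \<otimes> h) f = \<rho> g (\<rho> h f)" if "g \<in> carrier G" "h \<in> carrier G" "f \<in> tree_span" for g h f
    using that \<rho>T \<rho>_ext
    by (intro extensionalityI[of _ "carrier G"]) (auto simp: \<rho>_eq inv_mult_group m_assoc)
  have \<rho>_one: "\<rho> \<one> f = f" if "f \<in> tree_span" for f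
    using that \<rho>_ext tree_span_extensional
    by (intro extensionalityI[of _ "carrier G"]) (auto simp: \<rho>_eq)
  have bij: "\<rho> g \<in> Bij tree_span" if g: "g \<in> carrier G" for g
  proof -
    have "bij_betw (\<rho> g) tree_span tree_span"
      using g \<rho>T \<rho>_mult[of g "inv g"] \<rho>_mult[of "inv g" g] \<rho>_one
      by (intro bij_betw_byWitness[where f' = "\<rho> (inv g)"]) auto
    thus ?thesis by (simp add: Bij_def \<rho>_def)
  qed
  have "\<rho> \<in> hom G (BijGroup tree_span)"
  proof (rule homI)
    show "\<rho> g \<in> carrier (BijGroup tree_span)" if "g \<in> carrier G" for g
      using bij[OF that] by (simp add: BijGroup_def)
    show "\<rho> (g \<otimes> h) = \<rho> g \<otimes>\<^bsub>BijGroup tree_span\<^esub> \<rho> h" if gh: "g \<in> carrier G" "h \<in> carrier G" for g h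
    proof -
      have "\<rho> (g \<otimes> h) = compose tree_span (\<rho> g) (\<rho> h)"
        using \<rho>_mult[OF gh]
        by (intro extensionalityI[of _ tree_span]) (auto simp: compose_eq \<rho>_def[of "g \<otimes> h"])
      thus ?thesis using gh bij by (simp add: BijGroup_def)
    qed
  qed
  hence "group_action G tree_span \<rho>"
    by (simp add: group_action_def group_hom_def group_hom_axioms_def group_BijGroup is_group)
  moreover have "span_dist (\<rho> g f) (\<rho> g h) = span_dist f h"
    if g: "g \<in> carrier G" and fh: "f \<in> tree_span" "h \<in> tree_span" for g f h
  proof -
    have "(\<lambda>z. \<bar>\<rho> g f z - \<rho> g h z\<bar>) ` carrier G = (\<lambda>z. \<bar>f z - h z\<bar>) ` ((\<lambda>z. inv g \<otimes> z) ` carrier G)"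
      using fh by (auto simp: image_image \<rho>_eq)
    also have "(\<lambda>z. inv g \<otimes> z) ` carrier G = carrier G"
      using g by (intro surj_const_mult) simp
    finally show ?thesis by (simp add: span_dist_def)
  qed
  ultimately have "isometric_action G tree_span span_dist \<rho>"
    by (simp add: isometric_action_def)
  then obtain f where f: "f \<in> tree_span" and fix_f: "\<And>g. g \<in> carrier G \<Longrightarrow> \<rho> g f = f"
    using property_FR_fixed_point[OF FR real_tree_tree_span] by blast
  have const: "f z = f \<one>" if "z \<in> carrier G" for z
    using \<rho>_eq[OF f that, of z] fix_f[OF that] that by simp
  obtain x y where xy: "x \<in> carrier G" "y \<in> carrier G" "f x + f y = d x y"
    using tree_span_ends[OF f] by metis
  have "d z w \<le> d x y" if "z \<in> carrier G" "w \<in> carrier G" for z w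
    using tree_span_sum_ge[OF f that] xy const that by metis
  thus ?thesis using xy by blast
qed

section \<open>Words and word metrics\<close>

lemma words_Nil [simp]: "[] \<in> words S"
  and words_Cons [simp]: "a # w \<in> words S \<longleftrightarrow> fst a \<in> S \<and> w \<in> words S"
  and words_append [simp]: "v @ w \<in> words S \<longleftrightarrow> v \<in> words S \<and> w \<in> words S"
  by (auto simp: words_def mem_Times_iff)

definition map_word :: "('a \<Rightarrow> 'b) \<Rightarrow> ('a \<times> bool) list \<Rightarrow> ('b \<times> bool) list" where
  "map_word f = map (map_prod f id)"

lemma map_word_simps [simp]:
  "map_word f [] = []" "map_word f (a # w) = (f (fst a), snd a) # map_word f w"
  "map_word f (v @ w) = map_word f v @ map_word f w" "length (map_word f w) = length w"
  by (auto simp: map_word_def map_prod_def split: prod.splits)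

lemma map_word_in_words: "w \<in> words S \<Longrightarrow> f ` S \<subseteq> T \<Longrightarrow> map_word f w \<in> words T"
  by (induction w) auto

lemma map_word_compose: "map_word f (map_word g w) = map_word (\<lambda>x. f (g x)) w"
  by (induction w) auto

lemma map_word_cong: "w \<in> words S \<Longrightarrow> (\<And>s. s \<in> S \<Longrightarrow> f s = g s) \<Longrightarrow> map_word f w = map_word g w"
  by (induction w) auto

lemma map_word_id: "w \<in> words S \<Longrightarrow> (\<And>s. s \<in> S \<Longrightarrow> f s = s) \<Longrightarrow> map_word f w = w"
  by (induction w) auto

definition exponent_sum :: "('a \<times> bool) list \<Rightarrow> int" where
  "exponent_sum w = (\<Sum>a\<leftarrow>w. if snd a then 1 else - 1)"

lemma exponent_sum_simps [simp]:
  "exponent_sum [] = 0" "exponent_sum (a # w) = (if snd a then 1 else - 1) + exponent_sum w"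
  "exponent_sum (v @ w) = exponent_sum v + exponent_sum w"
  by (auto simp: exponent_sum_def)

lemma exponent_sum_map_word [simp]: "exponent_sum (map_word f w) = exponent_sum w"
  by (induction w) auto

lemma word_val_Nil [simp]: "word_val G [] = \<one>\<^bsub>G\<^esub>"
  and word_val_Cons [simp]: "word_val G (a # w) = letter_val G a \<otimes>\<^bsub>G\<^esub> word_val G w"
  by (simp_all add: word_val_def)

definition inverse_word :: "('a \<times> bool) list \<Rightarrow> ('a \<times> bool) list" where
  "inverse_word w = rev (map (\<lambda>a. (fst a, \<not> snd a)) w)"

lemma inverse_word_in_words: "w \<in> words S \<Longrightarrow> inverse_word w \<in> words S"
  by (induction w) (auto simp: inverse_word_def)

context group begin

lemma letter_val_closed: "fst a \<in> carrier G \<Longrightarrow> letter_val G a \<in> carrier G"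
  by (simp add: letter_val_def)

lemma word_val_closed: "w \<in> words S \<Longrightarrow> S \<subseteq> carrier G \<Longrightarrow> word_val G w \<in> carrier G"
  by (induction w) (auto simp: letter_val_closed)

lemma word_val_append:
  assumes "v \<in> words S" "w \<in> words S" "S \<subseteq> carrier G"
  shows "word_val G (v @ w) = word_val G v \<otimes> word_val G w"
  using assms
proof (induction v)
  case Nil thus ?case by (simp add: word_val_closed)
next
  case (Cons a v)
  have "letter_val G a \<in> carrier G" "word_val G v \<in> carrier G" "word_val G w \<in> carrier G"
    using Cons.prems by (auto simp: letter_val_closed word_val_closed)
  thus ?case using Cons by (simp add: m_assoc)
qed

lemma word_val_inverse_word:
  assumes "w \<in> words S" "S \<subseteq> carrier G"
  shows "word_val G (inverse_word w) = inv (word_val G w)"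
  using assms
proof (induction w)
  case Nil thus ?case by (simp add: inverse_word_def)
next
  case (Cons a w)
  let ?b = "(fst a, \<not> snd a)"
  have a: "fst a \<in> carrier G" using Cons.prems by auto
  have wc: "word_val G w \<in> carrier G" using Cons.prems by (auto intro: word_val_closed)
  have "word_val G (inverse_word w @ [?b]) = word_val G (inverse_word w) \<otimes> word_val G [?b]"
    by (rule word_val_append[of _ S]) (use Cons.prems in \<open>auto intro: inverse_word_in_words\<close>)
  also have "word_val G [?b] = inv (letter_val G a)"
    using a by (simp add: letter_val_def)
  also have "word_val G (inverse_word w) = inv (word_val G w)" using Cons by simp
  finally show ?case
    using a wc by (simp add: inverse_word_def inv_mult_group letter_val_closed)
qed

end

lemma word_val_map_word:
  assumes "group G" "group H" "f \<in> hom G H" "w \<in> words S" "S \<subseteq> carrier G"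
  shows "f (word_val G w) = word_val H (map_word f w)"
proof -
  interpret group_hom G H f using assms by (simp add: group_hom_def group_hom_axioms_def)
  have letter: "f (letter_val G a) = letter_val H (f (fst a), snd a)" if "fst a \<in> carrier G" for a
    using that by (simp add: letter_val_def)
  show ?thesis using assms(4)
  proof (induction w)
    case (Cons a w)
    hence "fst a \<in> carrier G" "word_val G w \<in> carrier G"
      using assms(5) by (auto intro: G.word_val_closed)
    thus ?case using Cons letter[of a] by (simp add: G.letter_val_closed)
  qed simp
qed

locale generated_group = group G for G (structure) +
  fixes S
  assumes S_carrier: "S \<subseteq> carrier G" and generates: "generate G S = carrier G"
begin

abbreviation len where "len \<equiv> word_length G S"
abbreviation wdist where "wdist \<equiv> word_dist G S"

lemma word_exists:
  assumes "g \<in> carrier G"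
  shows "\<exists>w\<in>words S. word_val G w = g"
proof -
  have "g \<in> generate G S" using assms generates by simp
  thus ?thesis
  proof induction
    case one thus ?case by (intro bexI[of _ "[]"]) auto
  next
    case (incl h) thus ?case using S_carrier
      by (intro bexI[of _ "[(h, True)]"]) (auto simp: letter_val_def)
  next
    case (inv h) thus ?case using S_carrier
      by (intro bexI[of _ "[(h, False)]"]) (auto simp: letter_val_def)
  next
    case (eng h1 h2) thus ?case using word_val_append[OF _ _ S_carrier] words_append by metis
  qed
qed

lemma length_attained:
  assumes "g \<in> carrier G"
  obtains w where "w \<in> words S" "length w = len g" "word_val G w = g"
proof -
  have "\<exists>n. \<exists>w\<in>words S. length w = n \<and> word_val G w = g" using word_exists[OF assms] by blast
  from LeastI_ex[OF this] show ?thesis using that unfolding word_length_def by blast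
qed

lemma len_le: "w \<in> words S \<Longrightarrow> word_val G w = g \<Longrightarrow> len g \<le> length w"
  unfolding word_length_def by (rule Least_le) blast

lemma len_one [simp]: "len \<one> = 0"
  using len_le[of "[]" \<one>] by simp

lemma len_mult:
  assumes "g \<in> carrier G" "h \<in> carrier G"
  shows "len (g \<otimes> h) \<le> len g + len h"
proof -
  obtain v where v: "v \<in> words S" "length v = len g" "word_val G v = g" using length_attained[OF assms(1)] .
  obtain w where w: "w \<in> words S" "length w = len h" "word_val G w = h" using length_attained[OF assms(2)] .
  show ?thesis using len_le[of "v @ w"] word_val_append[OF v(1) w(1) S_carrier] v w by simp
qed

lemma len_inv_le:
  assumes "g \<in> carrier G"
  shows "len (inv g) \<le> len g"
proof -
  obtain v where v: "v \<in> words S" "length v = len g" "word_val G v = g" using length_attained[OF assms(1)] .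
  show ?thesis
    using len_le[of "inverse_word v"] inverse_word_in_words[OF v(1)]
      word_val_inverse_word[OF v(1) S_carrier] v by (simp add: inverse_word_def)
qed

lemma len_inv: "g \<in> carrier G \<Longrightarrow> len (inv g) = len g"
  using len_inv_le[of g] len_inv_le[of "inv g"] by simp

lemma wdist_self [simp]: "x \<in> carrier G \<Longrightarrow> wdist x x = 0"
  by (simp add: word_dist_def)

lemma wdist_sym: "x \<in> carrier G \<Longrightarrow> y \<in> carrier G \<Longrightarrow> wdist x y = wdist y x"
  using len_inv[of "inv x \<otimes> y"] by (simp add: word_dist_def inv_mult_group)

lemma wdist_triangle:
  assumes "x \<in> carrier G" "y \<in> carrier G" "z \<in> carrier G"
  shows "wdist x z \<le> wdist x y + wdist y z"
proof -
  have "inv x \<otimes> z = (inv x \<otimes> y) \<otimes> (inv y \<otimes> z)"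
    using assms by (simp add: m_assoc) (simp flip: m_assoc)
  thus ?thesis unfolding word_dist_def using assms by (metis inv_closed len_mult m_closed)
qed

lemma wdist_left_mult:
  assumes "g \<in> carrier G" "x \<in> carrier G" "y \<in> carrier G"
  shows "wdist (g \<otimes> x) (g \<otimes> y) = wdist x y"
proof -
  have "inv (g \<otimes> x) \<otimes> (g \<otimes> y) = inv x \<otimes> y"
    using assms by (simp add: inv_mult_group m_assoc) (simp flip: m_assoc)
  thus ?thesis by (simp add: word_dist_def)
qed

lemma wdist_one: "g \<in> carrier G \<Longrightarrow> wdist \<one> g = len g"
  by (simp add: word_dist_def)

text \<open>A geodesic of the Cayley graph, given by the vertices that it visits.\<close>

definition word_geodesic :: "'a \<Rightarrow> 'a \<Rightarrow> (nat \<Rightarrow> 'a) \<Rightarrow> bool" where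
  "word_geodesic x y v \<longleftrightarrow>
     v 0 = x \<and> v (wdist x y) = y \<and> (\<forall>i\<le>wdist x y. v i \<in> carrier G) \<and>
     (\<forall>i\<le>wdist x y. \<forall>j\<le>wdist x y. real (wdist (v i) (v j)) = \<bar>real i - real j\<bar>) \<and>
     (\<forall>i<wdist x y. \<exists>s\<in>S. v (Suc i) = v i \<otimes> s \<or> v i = v (Suc i) \<otimes> s)"

lemma word_geodesic_exists:
  assumes x: "x \<in> carrier G" and y: "y \<in> carrier G"
  shows "\<exists>v. word_geodesic x y v"
proof -
  have "inv x \<otimes> y \<in> carrier G" using x y by simp
  then obtain w where w: "w \<in> words S" "length w = wdist x y" "word_val G w = inv x \<otimes> y"
    by (metis length_attained word_dist_def)
  define n where "n = wdist x y"
  define v where "v i = x \<otimes> word_val G (take i w)" for i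
  have tw: "take i w \<in> words S" "drop i w \<in> words S" for i
    using w(1) by (metis append_take_drop_id words_append)+
  have vc: "v i \<in> carrier G" for i using x word_val_closed[OF tw(1) S_carrier] by (simp add: v_def)
  have v0: "v 0 = x" using x by (simp add: v_def)
  have vn: "v n = y" using w x y by (simp add: v_def n_def flip: m_assoc)
  have seg: "inv (v i) \<otimes> v j = word_val G (drop i (take j w))" if "i \<le> j" for i j
  proof -
    have "take j w = take i w @ drop i (take j w)"
      using that by (metis append_take_drop_id min_absorb1 take_take)
    moreover have "drop i (take j w) \<in> words S" using tw(1)[of j] calculation by (metis words_append)
    ultimately have "word_val G (take j w) = word_val G (take i w) \<otimes> word_val G (drop i (take j w))"
      using word_val_append[OF tw(1) _ S_carrier] by metis
    thus ?thesis
      using x word_val_closed[OF tw(1) S_carrier] word_val_closed[OF \<open>drop i (take j w) \<in> words S\<close> S_carrier]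
      by (simp add: v_def inv_mult_group m_assoc) (simp flip: m_assoc)
  qed
  have le: "wdist (v i) (v j) \<le> j - i" if "i \<le> j" "j \<le> n" for i j
  proof -
    have "drop i (take j w) \<in> words S"
      using tw(1)[of j] by (metis append_take_drop_id words_append)
    thus ?thesis using len_le[of "drop i (take j w)"] seg[OF that(1)] that w(2)
      by (simp add: word_dist_def n_def)
  qed
  have dist: "wdist (v i) (v j) = j - i" if ij: "i \<le> j" "j \<le> n" for i j
  proof -
    have "n \<le> wdist (v 0) (v i) + wdist (v i) (v n)"
      using wdist_triangle[OF vc[of 0] vc[of i] vc[of n]] v0 vn by (simp add: n_def)
    also have "wdist (v i) (v n) \<le> wdist (v i) (v j) + wdist (v j) (v n)"
      by (rule wdist_triangle[OF vc vc vc])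
    finally show ?thesis using le[of 0 i] le[of i j] le[of j n] ij by simp
  qed
  have dist': "real (wdist (v i) (v j)) = \<bar>real i - real j\<bar>" if "i \<le> n" "j \<le> n" for i j
    using dist[of i j] dist[of j i] wdist_sym[OF vc vc, of i j] that by (cases "i \<le> j") auto
  have "\<exists>s\<in>S. v (Suc i) = v i \<otimes> s \<or> v i = v (Suc i) \<otimes> s" if i: "i < n" for i
  proof -
    have il: "i < length w" using i w(2) by (simp add: n_def)
    have s: "fst (w ! i) \<in> S" using w(1) nth_mem[OF il] by (auto simp: words_def in_lists_conv_set mem_Times_iff)
    hence sc: "fst (w ! i) \<in> carrier G" using S_carrier by auto
    have "drop i (take (Suc i) w) = [w ! i]" using il by (simp add: take_Suc_conv_app_nth)
    hence "inv (v i) \<otimes> v (Suc i) = letter_val G (w ! i)"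
      using seg[of i "Suc i"] sc by (simp add: letter_val_closed)
    hence "v (Suc i) = v i \<otimes> letter_val G (w ! i)"
      using vc sc by (metis inv_solve_left letter_val_closed)
    thus ?thesis
      using s sc vc by (cases "snd (w ! i)") (auto simp: letter_val_def inv_solve_right intro!: bexI[of _ "fst (w ! i)"])
  qed
  thus ?thesis using v0 vn vc dist' unfolding word_geodesic_def n_def by blast
qed

end

section \<open>The four-point condition in hyperbolic Cayley graphs\<close>

lemma abs_diff_nat_less_1:
  assumes "real i \<le> t" "t < real i + 1"
  shows "\<bar>t - real j\<bar> < 1 \<longleftrightarrow> j = i \<or> j = Suc i \<and> real i < t"
proof -
  consider "real j \<le> real i - 1" | "j = i" | "j = Suc i" | "real j \<ge> real i + 2"
    by (cases "j < i"; cases "j > Suc i") linarith+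
  thus ?thesis using assms by cases auto
qed

lemma nat_floor_bounds:
  assumes "0 \<le> t"
  shows "real (nat \<lfloor>t\<rfloor>) \<le> t" "t < real (nat \<lfloor>t\<rfloor>) + 1"
  using assms by simp_all

lemma nat_ceiling_bounds:
  assumes "0 \<le> t"
  shows "t \<le> real (nat \<lceil>t\<rceil>)" "real (nat \<lceil>t\<rceil>) < t + 1"
  using assms by simp_all linarith+

context generated_group begin

text \<open>The point at time \<open>t\<close> of the path in the Cayley graph that runs through the vertices \<open>v i\<close> at unit speed.  The
  vertex \<open>v i\<close> is recognized by its distance \<open>i\<close> from \<open>x\<close>, and its barycentric coordinate is \<open>1 - \<bar>t - i\<bar>\<close> as long
  as \<open>t\<close> is within distance \<open>1\<close> of \<open>i\<close>.\<close>

definition edge_path :: "'a \<Rightarrow> 'a \<Rightarrow> (nat \<Rightarrow> 'a) \<Rightarrow> real \<Rightarrow> 'a \<Rightarrow> real" where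
  "edge_path x y v t a =
     (if a \<in> v ` {..wdist x y} then max 0 (1 - \<bar>t - real (wdist x a)\<bar>) else 0)"

context
  fixes x y v
  assumes x: "x \<in> carrier G" and v: "word_geodesic x y v"
begin

lemma word_geodesicD:
  shows "v 0 = x" "v (wdist x y) = y"
    and "i \<le> wdist x y \<Longrightarrow> v i \<in> carrier G"
    and "i \<le> wdist x y \<Longrightarrow> j \<le> wdist x y \<Longrightarrow> real (wdist (v i) (v j)) = \<bar>real i - real j\<bar>"
    and "i < wdist x y \<Longrightarrow> \<exists>s\<in>S. v (Suc i) = v i \<otimes> s \<or> v i = v (Suc i) \<otimes> s"
  using v by (auto simp: word_geodesic_def)

lemma wdist_from_start:
  assumes i: "i \<le> wdist x y"
  shows "wdist x (v i) = i"
proof -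
  have "real (wdist (v 0) (v i)) = \<bar>real 0 - real i\<bar>" by (rule word_geodesicD(4)[OF le0 i])
  hence "real (wdist x (v i)) = real i" unfolding word_geodesicD(1) by simp
  thus ?thesis by (rule of_nat_eq_iff[THEN iffD1])
qed

lemma inj_word_geodesic: "inj_on v {..wdist x y}"
proof (rule inj_onI)
  fix i j assume ij: "i \<in> {..wdist x y}" "j \<in> {..wdist x y}" "v i = v j"
  have "i = wdist x (v i)" using ij(1) wdist_from_start[of i] by simp
  also have "\<dots> = j" unfolding ij(3) using ij(2) wdist_from_start[of j] by simp
  finally show "i = j" .
qed

lemma edge_path_vertex: "j \<le> wdist x y \<Longrightarrow> edge_path x y v t (v j) = max 0 (1 - \<bar>t - real j\<bar>)"
proof -
  assume j: "j \<le> wdist x y"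
  hence "v j \<in> v ` {..wdist x y}" by (intro imageI) simp
  thus ?thesis unfolding edge_path_def wdist_from_start[OF j] by (rule if_P)
qed

lemma supp_edge_path: "supp (edge_path x y v t) = v ` {j. j \<le> wdist x y \<and> \<bar>t - real j\<bar> < 1}"
proof (rule Set.set_eqI)
  fix a show "a \<in> supp (edge_path x y v t) \<longleftrightarrow> a \<in> v ` {j. j \<le> wdist x y \<and> \<bar>t - real j\<bar> < 1}"
  proof (cases "a \<in> v ` {..wdist x y}")
    case True
    then obtain j where j: "j \<in> {..wdist x y}" "a = v j" by blast
    have "v j \<in> v ` {j. j \<le> wdist x y \<and> \<bar>t - real j\<bar> < 1} \<longleftrightarrow>
        j \<in> {j. j \<le> wdist x y \<and> \<bar>t - real j\<bar> < 1}"
      by (rule inj_on_image_mem_iff[OF inj_word_geodesic j(1)]) auto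
    thus ?thesis using j by (auto simp: supp_def edge_path_vertex)
  next
    case False
    hence "a \<notin> v ` {j. j \<le> wdist x y \<and> \<bar>t - real j\<bar> < 1}" by blast
    moreover have "edge_path x y v t a = 0" unfolding edge_path_def using False by (rule if_not_P)
    ultimately show ?thesis by (simp add: supp_def)
  qed
qed

lemma edge_path_le_1: "edge_path x y v t a \<le> 1"
  unfolding edge_path_def by simp

lemma edge_path_in_cayley_points:
  assumes t: "t \<in> {0..real (wdist x y)}"
  shows "edge_path x y v t \<in> cayley_points G S"
proof -
  define i where "i = nat \<lfloor>t\<rfloor>"
  have i: "real i \<le> t" "t < real i + 1" using t nat_floor_bounds[of t] by (auto simp: i_def)
  have i_le: "i \<le> wdist x y" using i t by auto
  note index = abs_diff_nat_less_1[OF i]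
  have "(\<Sum>a\<in>supp (edge_path x y v t). edge_path x y v t a) = 1 \<and>
    (\<exists>g\<in>carrier G. supp (edge_path x y v t) = {g} \<or> (\<exists>s\<in>S. supp (edge_path x y v t) = {g, g \<otimes> s}))"
  proof (cases "t = real i")
    case True
    hence "{j. j \<le> wdist x y \<and> \<bar>t - real j\<bar> < 1} = {i}" using index i_le by auto
    hence "supp (edge_path x y v t) = {v i}" by (simp add: supp_edge_path)
    thus ?thesis using True i_le word_geodesicD(3)[OF i_le] by (auto simp: edge_path_vertex)
  next
    case False
    hence lt: "Suc i \<le> wdist x y" using i t by auto
    hence "{j. j \<le> wdist x y \<and> \<bar>t - real j\<bar> < 1} = {i, Suc i}" using index i False by auto
    hence *: "supp (edge_path x y v t) = {v i, v (Suc i)}" by (simp add: supp_edge_path)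
    have "v i \<noteq> v (Suc i)" using inj_onD[OF inj_word_geodesic, of i "Suc i"] lt by auto
    hence "(\<Sum>a\<in>supp (edge_path x y v t). edge_path x y v t a) = 1"
      unfolding * using i lt by (simp add: edge_path_vertex)
    moreover have "\<exists>g\<in>carrier G. \<exists>s\<in>S. supp (edge_path x y v t) = {g, g \<otimes> s}"
      using word_geodesicD(5)[of i] word_geodesicD(3)[of i] word_geodesicD(3)[of "Suc i"] lt unfolding *
      by (metis Suc_le_eq i_le insert_commute)
    ultimately show ?thesis by blast
  qed
  thus ?thesis by (auto simp: cayley_points_def edge_path_def)
qed

text \<open>Within an edge the distance is read off from the coordinates.  Otherwise the length of a
  connection through \<open>v i\<close> and \<open>v j\<close> is \<open>\<bar>s - i\<bar> + \<bar>i - j\<bar> + \<bar>j - t\<bar>\<close>, which is minimal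
  for \<open>i = \<lceil>s\<rceil>\<close> and \<open>j = \<lfloor>t\<rfloor>\<close> if \<open>s \<le> t\<close>.\<close>

lemma cayley_dist_edge_path:
  assumes s: "s \<in> {0..real (wdist x y)}" and t: "t \<in> {0..real (wdist x y)}"
  shows "cayley_dist G S (edge_path x y v s) (edge_path x y v t) = \<bar>s - t\<bar>"
proof -
  let ?p = "edge_path x y v s" and ?q = "edge_path x y v t"
  let ?I = "\<lambda>t. {j. j \<le> wdist x y \<and> \<bar>t - real j\<bar> < 1}"
  have floor_in: "nat \<lfloor>t\<rfloor> \<in> ?I t" and ceil_in: "nat \<lceil>t\<rceil> \<in> ?I t" if "t \<in> {0..real (wdist x y)}" for t
    using that nat_floor_bounds[of t] nat_ceiling_bounds[of t]
    by (simp_all only: atLeastAtMost_iff mem_Collect_eq) linarith+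
  have fin: "finite (supp ?p)" "finite (supp ?q)" by (simp_all add: supp_edge_path)
  have ne: "supp ?p \<noteq> {}" using ceil_in[OF s] unfolding supp_edge_path by blast
  show ?thesis
  proof (cases "supp ?p = supp ?q")
    case True
    hence I: "?I s = ?I t"
      using inj_on_image_eq_iff[OF inj_word_geodesic, of "?I s" "?I t"] by (auto simp: supp_edge_path)
    have no_crossing: "\<not> (a < real j \<and> real j < b)"
      if "?I a = ?I b" "j \<in> ?I a" "b \<le> real (wdist x y)" for a b j
    proof
      assume *: "a < real j \<and> real j < b"
      hence "Suc j \<in> ?I b" using that by auto
      hence "Suc j \<in> ?I a" using that by simp
      thus False using * by simp
    qed
    have "\<bar>?p a - ?q a\<bar> = \<bar>s - t\<bar>" if a: "a \<in> supp ?p" for a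
    proof -
      obtain j where j: "j \<in> ?I s" "a = v j" using a unfolding supp_edge_path by blast
      have jt: "j \<in> ?I t" using I j by blast
      have "?p a = 1 - \<bar>s - real j\<bar>" "?q a = 1 - \<bar>t - real j\<bar>"
        using j jt by (auto simp: edge_path_vertex)
      moreover have "\<not> (s < real j \<and> real j < t)" "\<not> (t < real j \<and> real j < s)"
        using no_crossing[OF I j(1)] no_crossing[OF I[symmetric] jt] s t by auto
      ultimately show ?thesis by (auto simp: abs_if)
    qed
    hence "(\<lambda>a. \<bar>?p a - ?q a\<bar>) ` supp ?p = {\<bar>s - t\<bar>}" using ne by auto
    thus ?thesis using True by (simp add: cayley_dist_def)
  next
    case False
    let ?D = "\<lambda>(a, b). (1 - ?p a) + real (word_dist G S a b) + (1 - ?q b)"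
    have D: "?D (v i, v j) = \<bar>s - real i\<bar> + \<bar>real i - real j\<bar> + \<bar>real j - t\<bar>"
      if "i \<in> ?I s" "j \<in> ?I t" for i j
      using that by (simp add: edge_path_vertex word_geodesicD(4) max_def abs_minus_commute)
    have attained: "\<exists>i\<in>?I s. \<exists>j\<in>?I t. \<bar>s - t\<bar> = \<bar>s - real i\<bar> + \<bar>real i - real j\<bar> + \<bar>real j - t\<bar>"
      if ne: "?I s \<noteq> ?I t" and s: "s \<in> {0..real (wdist x y)}" and t: "t \<in> {0..real (wdist x y)}" and "s \<le> t"
      for s t
    proof (intro bexI)
      note fl = nat_floor_bounds[of t] and ce = nat_ceiling_bounds[of s]
      have "nat \<lceil>s\<rceil> \<le> nat \<lfloor>t\<rfloor>"
      proof (rule ccontr)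
        assume "\<not> nat \<lceil>s\<rceil> \<le> nat \<lfloor>t\<rfloor>"
        hence "real (nat \<lfloor>t\<rfloor>) < s" using s ce by simp
        moreover have "t < real (nat \<lfloor>t\<rfloor>) + 1" using fl t by auto
        ultimately have "\<bar>s - real j\<bar> < 1 \<longleftrightarrow> \<bar>t - real j\<bar> < 1" for j
          using \<open>s \<le> t\<close> abs_diff_nat_less_1[of "nat \<lfloor>t\<rfloor>" s j]
            abs_diff_nat_less_1[of "nat \<lfloor>t\<rfloor>" t j] by linarith
        thus False using ne by auto
      qed
      hence "real (nat \<lceil>s\<rceil>) \<le> real (nat \<lfloor>t\<rfloor>)" by (rule of_nat_mono)
      moreover have "s \<le> real (nat \<lceil>s\<rceil>)" "real (nat \<lfloor>t\<rfloor>) \<le> t" using fl(1) ce(1) s t by auto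
      moreover have "\<bar>s - t\<bar> = \<bar>s - c\<bar> + \<bar>c - f\<bar> + \<bar>f - t\<bar>" if "s \<le> c" "c \<le> f" "f \<le> t" for c f :: real
        using that by simp
      ultimately show "\<bar>s - t\<bar> = \<bar>s - real (nat \<lceil>s\<rceil>)\<bar> + \<bar>real (nat \<lceil>s\<rceil>) - real (nat \<lfloor>t\<rfloor>)\<bar> + \<bar>real (nat \<lfloor>t\<rfloor>) - t\<bar>"
        by blast
    qed (use s t floor_in ceil_in in auto)
    have "?I s \<noteq> ?I t" using False by (auto simp: supp_edge_path)
    have "\<exists>i\<in>?I s. \<exists>j\<in>?I t. \<bar>s - t\<bar> = \<bar>s - real i\<bar> + \<bar>real i - real j\<bar> + \<bar>real j - t\<bar>"
    proof (cases "s \<le> t")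
      case True
      show ?thesis by (rule attained[OF \<open>?I s \<noteq> ?I t\<close> s t True])
    next
      case False
      hence "t \<le> s" by simp
      from attained[OF \<open>?I s \<noteq> ?I t\<close>[symmetric] t s this]
      obtain j i where "i \<in> ?I s" "j \<in> ?I t"
        "\<bar>t - s\<bar> = \<bar>t - real j\<bar> + \<bar>real j - real i\<bar> + \<bar>real i - s\<bar>" by blast
      moreover from this(3) have "\<bar>s - t\<bar> = \<bar>s - real i\<bar> + \<bar>real i - real j\<bar> + \<bar>real j - t\<bar>"
        by linarith
      ultimately show ?thesis by blast
    qed
    then obtain i j where ij: "i \<in> ?I s" "j \<in> ?I t"
      "\<bar>s - t\<bar> = \<bar>s - real i\<bar> + \<bar>real i - real j\<bar> + \<bar>real j - t\<bar>" by blast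
    have "Min (?D ` (supp ?p \<times> supp ?q)) = \<bar>s - t\<bar>"
    proof (rule Min_eqI)
      show "finite (?D ` (supp ?p \<times> supp ?q))" using fin by blast
      have "(v i, v j) \<in> supp ?p \<times> supp ?q" using ij by (auto simp: supp_edge_path)
      thus "\<bar>s - t\<bar> \<in> ?D ` (supp ?p \<times> supp ?q)" unfolding ij(3) D[OF ij(1,2), symmetric] by (rule imageI)
    next
      fix r assume "r \<in> ?D ` (supp ?p \<times> supp ?q)"
      then obtain a b where "a \<in> supp ?p" "b \<in> supp ?q" and r: "r = ?D (a, b)" by blast
      then obtain i' j' where ij': "i' \<in> ?I s" "j' \<in> ?I t" "a = v i'" "b = v j'"
        unfolding supp_edge_path by blast
      have "r = \<bar>s - real i'\<bar> + \<bar>real i' - real j'\<bar> + \<bar>real j' - t\<bar>"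
        unfolding r ij'(3,4) by (rule D[OF ij'(1,2)])
      thus "\<bar>s - t\<bar> \<le> r" by linarith
    qed
    thus ?thesis unfolding cayley_dist_def by (simp only: False if_False)
  qed
qed

lemma edge_path_nat:
  assumes i: "i \<le> wdist x y"
  shows "edge_path x y v (real i) = indicator {v i}"
proof
  fix a show "edge_path x y v (real i) a = indicator {v i} a"
  proof (cases "a \<in> v ` {..wdist x y}")
    case True
    then obtain j where j: "j \<in> {..wdist x y}" "a = v j" by blast
    have "v j = v i \<longleftrightarrow> j = i" by (rule inj_on_eq_iff[OF inj_word_geodesic j(1)]) (simp add: i)
    moreover have "1 \<le> \<bar>real i - real j\<bar>" if "j \<noteq> i" using that by linarith
    ultimately show ?thesis using j by (cases "j = i") (simp_all add: edge_path_vertex)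
  next
    case False
    hence "a \<noteq> v i" using i by blast
    thus ?thesis using False by (simp add: edge_path_def)
  qed
qed

lemma edge_path_segment:
  "geodesic_segment (cayley_points G S) (cayley_dist G S)
     (indicator {x}) (indicator {y}) (edge_path x y v ` {0..real (wdist x y)})"
proof -
  have "geodesic (cayley_points G S) (cayley_dist G S) (real (wdist x y)) (edge_path x y v)"
    unfolding geodesic_def image_subset_iff
    by (intro conjI ballI of_nat_0_le_iff edge_path_in_cayley_points cayley_dist_edge_path)
  moreover have "edge_path x y v 0 = indicator {x}"
    using edge_path_nat[of 0] word_geodesicD(1) by simp
  moreover have "edge_path x y v (real (wdist x y)) = indicator {y}"
    using edge_path_nat[of "wdist x y"] word_geodesicD(2) by simp
  ultimately show ?thesis unfolding geodesic_segment_def by blast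
qed

end

text \<open>Only the position of a vertex between \<open>x\<close> and \<open>z\<close> matters for distance estimates, so the geodesic through it
  is not specified.\<close>

definition near_geodesic :: "real \<Rightarrow> 'a \<Rightarrow> 'a \<Rightarrow> 'a \<Rightarrow> bool" where
  "near_geodesic r p x z \<longleftrightarrow>
     (\<exists>a\<in>carrier G. real (wdist p a) \<le> r \<and> wdist x a + wdist a z = wdist x z)"

lemma indicator_in_cayley_points:
  assumes g: "g \<in> carrier G"
  shows "indicator {g} \<in> cayley_points G S"
proof -
  obtain v where v: "word_geodesic g g v" using word_geodesic_exists g by blast
  have "edge_path g g v (real 0) \<in> cayley_points G S"
    by (rule edge_path_in_cayley_points[OF g v]) simp
  moreover have "edge_path g g v (real 0) = indicator {v 0}"
    by (rule edge_path_nat[OF g v]) simp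
  ultimately show ?thesis using word_geodesicD(1)[OF g v] by simp
qed

lemma near_geodesic_sym:
  assumes "near_geodesic r p x z" "x \<in> carrier G" "z \<in> carrier G"
  shows "near_geodesic r p z x"
  using assms unfolding near_geodesic_def by (metis add.commute wdist_sym)

text \<open>A point of an edge is joined to a vertex through an end of the edge, so that end is no
  further away than the point itself.  Hence passing from points to vertices costs nothing here.\<close>

lemma near_geodesic_if_close:
  assumes u: "word_geodesic x z u" and x: "x \<in> carrier G" and p: "p \<in> carrier G" and "0 \<le> \<delta>"
    and q: "q \<in> edge_path x z u ` {0..real (wdist x z)}" and close: "cayley_dist G S (indicator {p}) q \<le> \<delta>"
  shows "near_geodesic \<delta> p x z"
proof -
  obtain t where t: "t \<in> {0..real (wdist x z)}" "q = edge_path x z u t" using q by blast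
  have on: "b \<in> carrier G \<and> wdist x b + wdist b z = wdist x z" if "b \<in> supp q" for b
  proof -
    obtain j where j: "j \<le> wdist x z" "b = u j" using \<open>b \<in> supp q\<close> by (auto simp: t supp_edge_path[OF x u])
    thus ?thesis
      using word_geodesicD(3)[OF x u j(1)] word_geodesicD(4)[OF x u j(1), of "wdist x z"]
        word_geodesicD(2)[OF x u] wdist_from_start[OF x u j(1)] by auto
  qed
  have supp_p: "supp (indicator {p}) = {p}" by (auto simp: supp_def indicator_def)
  have "\<exists>b\<in>supp q. real (wdist p b) \<le> \<delta>"
  proof (cases "supp (indicator {p}) = supp q")
    case True
    hence "p \<in> supp q" using supp_p by blast
    thus ?thesis using p \<open>0 \<le> \<delta>\<close> by (intro bexI[of _ p]) simp_all
  next
    case False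
    let ?D = "\<lambda>(a, b). (1 - indicator {p} a) + real (wdist a b) + (1 - q b)"
    have fin: "finite ({p} \<times> supp q)" by (simp add: t supp_edge_path[OF x u])
    have "nat \<lfloor>t\<rfloor> \<in> {j. j \<le> wdist x z \<and> \<bar>t - real j\<bar> < 1}"
      using t nat_floor_bounds[of t] by (simp only: atLeastAtMost_iff mem_Collect_eq) linarith
    hence "supp q \<noteq> {}" unfolding t(2) supp_edge_path[OF x u] by blast
    hence "Min (?D ` ({p} \<times> supp q)) \<in> ?D ` ({p} \<times> supp q)" using fin by (intro Min_in) auto
    moreover have "Min (?D ` ({p} \<times> supp q)) \<le> \<delta>"
      using close False by (simp add: cayley_dist_def supp_p)
    ultimately obtain b where "b \<in> supp q" "real (wdist p b) + (1 - q b) \<le> \<delta>" by fastforce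
    moreover have "q b \<le> 1" unfolding t(2) by (rule edge_path_le_1[OF x u])
    ultimately show ?thesis by (intro bexI[of _ b]) auto
  qed
  thus ?thesis using on by (auto simp: near_geodesic_def)
qed

lemma thin_near_geodesic:
  assumes hyp: "cayley_hyperbolic G S \<delta>" and "0 \<le> \<delta>"
    and xyz: "x \<in> carrier G" "y \<in> carrier G" "z \<in> carrier G"
    and v: "word_geodesic x y v" and i: "i \<le> wdist x y"
  shows "near_geodesic \<delta> (v i) x z \<or> near_geodesic \<delta> (v i) y z"
proof -
  obtain u where u: "word_geodesic y z u" using word_geodesic_exists xyz by blast
  obtain w where w: "word_geodesic z x w" using word_geodesic_exists xyz by blast
  note thin = hyp[unfolded cayley_hyperbolic_def thin_triangles_def, rule_format]
  have vi: "v i \<in> carrier G" by (rule word_geodesicD(3)[OF xyz(1) v i])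
  have "\<exists>q\<in>edge_path y z u ` {0..real (wdist y z)} \<union> edge_path z x w ` {0..real (wdist z x)}.
      cayley_dist G S p q \<le> \<delta>" if "p \<in> edge_path x y v ` {0..real (wdist x y)}" for p
    using that edge_path_segment[OF xyz(1) v] edge_path_segment[OF xyz(2) u] edge_path_segment[OF xyz(3) w]
      indicator_in_cayley_points xyz
    by (intro thin[of "indicator {x}" "indicator {y}" "indicator {z}"]) auto
  moreover have "indicator {v i} \<in> edge_path x y v ` {0..real (wdist x y)}"
    unfolding edge_path_nat[OF xyz(1) v i, symmetric] using i by (intro imageI) simp
  ultimately obtain q where q: "q \<in> edge_path y z u ` {0..real (wdist y z)} \<union> edge_path z x w ` {0..real (wdist z x)}"
    "cayley_dist G S (indicator {v i}) q \<le> \<delta>" by blast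
  thus ?thesis
    using near_geodesic_if_close[OF u xyz(2) vi \<open>0 \<le> \<delta>\<close> _ q(2)]
      near_geodesic_if_close[OF w xyz(3) vi \<open>0 \<le> \<delta>\<close> _ q(2)] near_geodesic_sym xyz by blast
qed

text \<open>Walk along a geodesic from \<open>x\<close> to \<open>y\<close>.  A vertex that is close both to a side at \<open>x\<close> and to the opposite side at
  \<open>y\<close> of the quadrilateral \<open>x, z, y, w\<close> yields the inequality.  If there is no such vertex,
  then a vertex close to the two sides at \<open>x\<close> is followed by another one of this kind, since distances change
  by \<open>1\<close> in a step; but the last vertex \<open>y\<close> lies on the sides at \<open>y\<close>.\<close>

lemma four_point_if_hyperbolic:
  assumes hyp: "cayley_hyperbolic G S \<delta>" and \<delta>: "0 \<le> \<delta>"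
  shows "four_point (carrier G) (\<lambda>x y. real (wdist x y)) (4 * \<delta> + 2)"
  unfolding four_point_def
proof (intro ballI, rule ccontr)
  fix x y z w
  assume c: "x \<in> carrier G" "y \<in> carrier G" "z \<in> carrier G" "w \<in> carrier G"
  let ?d = "\<lambda>x y. real (wdist x y)"
  assume "\<not> ?d x y + ?d z w \<le> max (?d x z + ?d y w) (?d x w + ?d y z) + (4 * \<delta> + 2)"
  hence neg: "?d x z + ?d y w + (4 * \<delta> + 2) < ?d x y + ?d z w"
      "?d x w + ?d y z + (4 * \<delta> + 2) < ?d x y + ?d z w"
    unfolding max_def by (auto split: if_splits)
  obtain v where v: "word_geodesic x y v" using word_geodesic_exists c by blast
  note v_props = word_geodesicD[OF c(1) v]
  have bound: "?d x y + ?d s t \<le> ?d x s + ?d y t + 2 * r + 2 * r'"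
    if near: "near_geodesic r p x s" "near_geodesic r' p y t"
      and p: "p \<in> carrier G" and st: "s \<in> carrier G" "t \<in> carrier G" for p r r' s t
  proof -
    obtain a where a: "a \<in> carrier G" "?d p a \<le> r" "wdist x a + wdist a s = wdist x s"
      using near(1) by (auto simp: near_geodesic_def)
    obtain b where b: "b \<in> carrier G" "?d p b \<le> r'" "wdist y b + wdist b t = wdist y t"
      using near(2) by (auto simp: near_geodesic_def)
    have "wdist x y \<le> wdist x p + wdist p y" "wdist x p \<le> wdist x a + wdist a p"
      "wdist p y \<le> wdist p b + wdist b y" "wdist s t \<le> wdist s a + wdist a t"
      "wdist a t \<le> wdist a p + wdist p t" "wdist p t \<le> wdist p b + wdist b t"
      using wdist_triangle a(1) b(1) p c st by auto
    moreover have "wdist a p = wdist p a" "wdist b y = wdist y b" "wdist s a = wdist a s"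
      using wdist_sym a(1) b(1) p c st by auto
    ultimately have "wdist x y + wdist s t \<le> wdist x s + wdist y t + 2 * wdist p a + 2 * wdist p b"
      using a(3) b(3) by linarith
    hence "?d x y + ?d s t \<le> ?d x s + ?d y t + 2 * ?d p a + 2 * ?d p b" by linarith
    thus ?thesis using a(2) b(2) by linarith
  qed
  have all_near: "near_geodesic \<delta> (v i) x z" if "i \<le> wdist x y" for i
    using that
  proof (induction i)
    case 0
    show ?case using v_props(1) c \<delta> unfolding near_geodesic_def by (intro bexI[of _ x]) auto
  next
    case (Suc i)
    have vc: "v i \<in> carrier G" "v (Suc i) \<in> carrier G" using v_props(3) Suc.prems by auto
    have "\<not> near_geodesic \<delta> (v (Suc i)) y w"
    proof
      assume "near_geodesic \<delta> (v (Suc i)) y w"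
      then obtain a where a: "a \<in> carrier G" "?d (v (Suc i)) a \<le> \<delta>" "wdist y a + wdist a w = wdist y w"
        by (auto simp: near_geodesic_def)
      have "?d (v i) (v (Suc i)) = 1" using v_props(4)[of i "Suc i"] Suc.prems by simp
      hence "?d (v i) a \<le> \<delta> + 1" using wdist_triangle[OF vc a(1)] a(2) by linarith
      hence "near_geodesic (\<delta> + 1) (v i) y w" using a by (auto simp: near_geodesic_def)
      moreover have "near_geodesic \<delta> (v i) x z" using Suc by simp
        ultimately have "?d x y + ?d z w \<le> ?d x z + ?d y w + 2 * \<delta> + 2 * (\<delta> + 1)"
          using vc c by (intro bound)
        thus False using neg(1) by (simp add: distrib_left)
    qed
    hence "near_geodesic \<delta> (v (Suc i)) x w"
      using thin_near_geodesic[OF hyp \<delta> c(1,2,4) v Suc.prems] by blast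
    have "\<not> near_geodesic \<delta> (v (Suc i)) y z"
    proof
      assume "near_geodesic \<delta> (v (Suc i)) y z"
      with \<open>near_geodesic \<delta> (v (Suc i)) x w\<close>
      have "?d x y + ?d w z \<le> ?d x w + ?d y z + 2 * \<delta> + 2 * \<delta>" using vc c by (intro bound)
      thus False using neg(2)[unfolded wdist_sym[OF c(3,4)]] by linarith
    qed
    thus ?case using thin_near_geodesic[OF hyp \<delta> c(1,2,3) v Suc.prems] by blast
  qed
  have "near_geodesic \<delta> (v (wdist x y)) x z" by (rule all_near) simp
  hence "near_geodesic \<delta> y x z" unfolding v_props(2) .
  moreover have "near_geodesic 0 y y w"
    unfolding near_geodesic_def by (rule bexI[OF _ c(2)]) (simp add: c)
  ultimately have "?d x y + ?d z w \<le> ?d x z + ?d y w + 2 * \<delta> + 2 * 0"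
    by (rule bound[OF _ _ c(2,3,4)])
  thus False using neg(1) \<delta> by linarith
qed

end

section \<open>Limits of asymptotic homomorphisms\<close>

context generated_group begin

lemma wdist_le_len:
  assumes "x \<in> carrier G" "y \<in> carrier G"
  shows "wdist x y \<le> len x + len y"
  using len_mult[of "inv x" y] len_inv[of x] assms by (simp add: word_dist_def)

text \<open>Apply the four-point condition to \<open>m\<close>, \<open>g \<otimes> m\<close> and the ends of the two geodesics of which they are
  the midpoints.  If \<open>a\<close> and \<open>b\<close> nearly realize the diameter of the set of all four ends, then the bound is of the
  order of \<open>\<epsilon> + 1\<close>.\<close>

lemma midpoint_displacement:
  assumes four: "four_point (carrier G) (\<lambda>x y. real (wdist x y)) \<epsilon>"
    and a: "a \<in> carrier G" and b: "b \<in> carrier G"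
  shows "\<exists>m\<in>carrier G. \<forall>g\<in>carrier G.
    real (wdist m (g \<otimes> m)) \<le>
      max (max (real (wdist a (g \<otimes> a))) (real (wdist a (g \<otimes> b))))
          (max (real (wdist b (g \<otimes> a))) (real (wdist b (g \<otimes> b))))
      - real (wdist a b) + 1 + 2 * \<epsilon>"
proof -
  let ?d = "\<lambda>x y. real (wdist x y)"
  note fp = four_pointD[OF four]
  obtain v where v: "word_geodesic a b v" using word_geodesic_exists a b by blast
  define k where "k = wdist a b div 2"
  have k: "k \<le> wdist a b" by (simp add: k_def)
  define m where "m = v k"
  have m: "m \<in> carrier G" unfolding m_def by (rule word_geodesicD(3)[OF a v k])
  have "?d (v k) (v 0) = \<bar>real k - real 0\<bar>" by (rule word_geodesicD(4)[OF a v k le0])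
  hence "?d m a = real k" unfolding m_def word_geodesicD(1)[OF a v] by simp
  moreover have "2 * real k \<le> ?d a b" unfolding k_def by linarith
  ultimately have ma: "2 * ?d m a \<le> ?d a b + 1" by linarith
  have "?d m b = \<bar>real k - real (wdist a b)\<bar>"
    using word_geodesicD(4)[OF a v k order_refl] unfolding m_def word_geodesicD(2)[OF a v] .
  hence "?d m b = ?d a b - real k" using k by simp
  moreover have "2 * real k + 1 \<ge> ?d a b" unfolding k_def by linarith
  ultimately have mb: "2 * ?d m b \<le> ?d a b + 1" by linarith
  show ?thesis
  proof (intro bexI[OF _ m] ballI)
    fix g assume g: "g \<in> carrier G"
    define Q where "Q = max (max (?d a (g \<otimes> a)) (?d a (g \<otimes> b))) (max (?d b (g \<otimes> a)) (?d b (g \<otimes> b)))"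
    have Q: "?d a (g \<otimes> a) \<le> Q" "?d a (g \<otimes> b) \<le> Q" "?d b (g \<otimes> a) \<le> Q" "?d b (g \<otimes> b) \<le> Q"
      by (simp_all add: Q_def)
    have c: "g \<otimes> m \<in> carrier G" "g \<otimes> a \<in> carrier G" "g \<otimes> b \<in> carrier G" using g m a b by auto
    have g_iso: "wdist (g \<otimes> a) (g \<otimes> b) = wdist a b" "wdist (g \<otimes> m) (g \<otimes> a) = wdist m a"
      "wdist (g \<otimes> m) (g \<otimes> b) = wdist m b"
      using g m a b by (simp_all add: wdist_left_mult)
    have "2 * ?d (g \<otimes> m) z \<le> 2 * Q - ?d a b + 1 + 2 * \<epsilon>"
      if z: "z \<in> carrier G" "?d z (g \<otimes> a) \<le> Q" "?d z (g \<otimes> b) \<le> Q" for z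
      using fp[OF c(1) z(1) c(2,3)] z(2,3) ma mb unfolding g_iso by linarith
    hence "2 * ?d (g \<otimes> m) a \<le> 2 * Q - ?d a b + 1 + 2 * \<epsilon>" "2 * ?d (g \<otimes> m) b \<le> 2 * Q - ?d a b + 1 + 2 * \<epsilon>"
      using a b Q by blast+
    thus "?d m (g \<otimes> m) \<le> Q - ?d a b + 1 + 2 * \<epsilon>"
      using fp[OF m c(1) a b] ma mb by linarith
  qed
qed

end

text \<open>If \<open>d\<close> is a limit of the metrics rescaled by \<open>N n\<close>, pulled back by \<open>u n\<close>, then by property FR its diameter
  is attained at some \<open>x\<close> and \<open>y\<close>, and the midpoint \<open>p\<close> of \<open>u n x\<close> and \<open>u n y\<close> has small displacement.  Left-invariance
  of \<open>d\<close> and the displacement of \<open>p\<close> involve finitely many products at a time, so it is enough that \<open>u n\<close> respects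
  each product for all large \<open>n\<close>.\<close>

theorem asymptotic_homs_have_small_displacement:
  fixes G :: "('a, 'm) monoid_scheme" (structure) and H :: "nat \<Rightarrow> ('b, 'n) monoid_scheme"
    and T :: "nat \<Rightarrow> 'b set" and u :: "nat \<Rightarrow> 'a \<Rightarrow> 'b" and N \<epsilon> :: "nat \<Rightarrow> real"
  defines "D \<equiv> \<lambda>n x y. real (word_dist (H n) (T n) x y)"
  assumes G: "group G" and FR: "property_FR G" and countable: "countable (carrier G)"
    and S: "finite S" "S \<subseteq> carrier G"
    and H: "\<And>n. generated_group (H n) (T n)"
    and four: "\<And>n. four_point (carrier (H n)) (D n) (\<epsilon> n)"
    and u: "\<And>n g. g \<in> carrier G \<Longrightarrow> u n g \<in> carrier (H n)"
    and mult: "\<And>g h. g \<in> carrier G \<Longrightarrow> h \<in> carrier G \<Longrightarrow>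
      \<forall>\<^sub>F n in sequentially. u n (g \<otimes>\<^bsub>G\<^esub> h) = u n g \<otimes>\<^bsub>H n\<^esub> u n h"
    and bound: "\<And>g. g \<in> carrier G \<Longrightarrow> \<exists>C. \<forall>n. real (word_length (H n) (T n) (u n g)) \<le> C * N n"
    and N_pos: "\<And>n. 0 < N n"
    and N_lim: "(\<lambda>n. 1 / N n) \<longlonglongrightarrow> 0" and \<epsilon>_lim: "(\<lambda>n. \<epsilon> n / N n) \<longlonglongrightarrow> 0"
  shows "\<exists>n. \<exists>p\<in>carrier (H n). \<forall>s\<in>S. D n p (u n s \<otimes>\<^bsub>H n\<^esub> p) < N n"
proof -
  interpret group G by fact
  interpret H: generated_group "H n" "T n" for n by (rule H)
  obtain C where C: "\<And>g n. g \<in> carrier G \<Longrightarrow> real (word_length (H n) (T n) (u n g)) \<le> C g * N n"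
    using bound by metis
  define E where "E n g h = D n (u n g) (u n h) / N n" for n g h
  have E_bound: "\<bar>E n g h\<bar> \<le> C g + C h" if g: "g \<in> carrier G" and h: "h \<in> carrier G" for n g h
  proof -
    have "D n (u n g) (u n h) \<le> (C g + C h) * N n"
      using H.wdist_le_len[OF u[OF g] u[OF h], of n] C[OF g, of n] C[OF h, of n]
      unfolding D_def by (simp add: distrib_right)
    thus ?thesis using N_pos[of n] by (simp add: E_def D_def field_simps)
  qed
  \<comment> \<open>Normalized to be uniformly bounded, as needed for the extraction of a pointwise convergent subsequence.\<close>
  define F where "F n = (\<lambda>(g, h). E n g h / (1 + (C g + C h)))" for n
  have F_le: "norm (F n q) \<le> 1" if q: "q \<in> carrier G \<times> carrier G" for n q
  proof -
    have "\<bar>E n (fst q) (snd q)\<bar> \<le> C (fst q) + C (snd q)" using q by (intro E_bound) auto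
    thus ?thesis by (simp add: F_def case_prod_beta abs_divide)
  qed
  obtain r where r: "strict_mono r"
    and r_lim: "\<And>q. q \<in> carrier G \<times> carrier G \<Longrightarrow> \<exists>l. (\<lambda>n. F (r n) q) \<longlonglongrightarrow> l"
  proof (rule function_convergent_subsequence[of "carrier G \<times> carrier G" F 1])
    show "countable (carrier G \<times> carrier G)" using countable by simp
  qed (use F_le in blast)+
  have "\<exists>l. (\<lambda>n. E (r n) g h) \<longlonglongrightarrow> l" if g: "g \<in> carrier G" and h: "h \<in> carrier G" for g h
  proof -
    obtain l where l: "(\<lambda>n. E (r n) g h / (1 + (C g + C h))) \<longlonglongrightarrow> l"
      using r_lim[of "(g, h)"] g h by (auto simp: F_def)
    have "1 + (C g + C h) \<noteq> 0" using E_bound[OF g h, of 0] by auto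
    thus ?thesis using tendsto_mult_right[OF l, of "1 + (C g + C h)"] by auto
  qed
  then obtain d where d: "\<And>g h. g \<in> carrier G \<Longrightarrow> h \<in> carrier G \<Longrightarrow> (\<lambda>n. E (r n) g h) \<longlonglongrightarrow> d g h"
    by metis
  have sub: "\<forall>\<^sub>F n in sequentially. P (r n)" if "\<forall>\<^sub>F n in sequentially. P n" for P
    using eventually_subseq[OF r that] .
  have sub_lim: "(\<lambda>n. f (r n)) \<longlonglongrightarrow> l" if "f \<longlonglongrightarrow> l" for f :: "nat \<Rightarrow> real" and l
    using LIMSEQ_subseq_LIMSEQ[OF that r] by (simp add: o_def)
  have zh: "zero_hyperbolic (carrier G) d"
  proof
    show "carrier G \<noteq> {}" by blast
    show "d g g = 0" if "g \<in> carrier G" for g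
      using d[OF that that] u[OF that] by (simp add: E_def D_def LIMSEQ_const_iff)
    show "d g h = d h g" if g: "g \<in> carrier G" and h: "h \<in> carrier G" for g h
    proof -
      have "E n g h = E n h g" for n
        using H.wdist_sym[OF u[OF g] u[OF h]] by (simp add: E_def D_def)
      thus ?thesis using LIMSEQ_unique[OF d[OF g h]] d[OF h g] by simp
    qed
    show "four_point (carrier G) d 0"
      unfolding four_point_def
    proof (intro ballI)
      fix x y z w assume c: "x \<in> carrier G" "y \<in> carrier G" "z \<in> carrier G" "w \<in> carrier G"
      have le: "E n x y + E n z w \<le> max (E n x z + E n y w) (E n x w + E n y z) + \<epsilon> n / N n" for n
      proof -
        have "(D n (u n x) (u n y) + D n (u n z) (u n w)) / N n \<le>
          (max (D n (u n x) (u n z) + D n (u n y) (u n w)) (D n (u n x) (u n w) + D n (u n y) (u n z)) + \<epsilon> n) / N n"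
          using N_pos[of n] by (intro divide_right_mono four_pointD[OF four] u c) simp
        thus ?thesis using N_pos[of n]
          by (simp add: E_def add_divide_distrib max_divide_distrib_right)
      qed
      show "d x y + d z w \<le> max (d x z + d y w) (d x w + d y z) + 0"
      proof (rule LIMSEQ_le)
        show "(\<lambda>n. E (r n) x y + E (r n) z w) \<longlonglongrightarrow> d x y + d z w"
          by (intro tendsto_add d c)
        show "(\<lambda>n. max (E (r n) x z + E (r n) y w) (E (r n) x w + E (r n) y z) + \<epsilon> (r n) / N (r n))
            \<longlonglongrightarrow> max (d x z + d y w) (d x w + d y z) + 0"
          by (intro tendsto_add tendsto_max d c sub_lim[OF \<epsilon>_lim])
      qed (use le in blast)
    qed
  qed
  have inv: "d (g \<otimes> x) (g \<otimes> y) = d x y"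
    if g: "g \<in> carrier G" and x: "x \<in> carrier G" and y: "y \<in> carrier G" for g x y
  proof (rule LIMSEQ_unique)
    have "\<forall>\<^sub>F n in sequentially. E (r n) (g \<otimes> x) (g \<otimes> y) = E (r n) x y"
      using sub[OF mult[OF g x]] sub[OF mult[OF g y]]
      by eventually_elim (simp add: E_def D_def H.wdist_left_mult u g x y)
    thus "(\<lambda>n. E (r n) x y) \<longlonglongrightarrow> d (g \<otimes> x) (g \<otimes> y)"
      using d[of "g \<otimes> x" "g \<otimes> y"] g x y by (simp add: tendsto_cong)
    show "(\<lambda>n. E (r n) x y) \<longlonglongrightarrow> d x y" by (rule d[OF x y])
  qed
  obtain x y where x: "x \<in> carrier G" and y: "y \<in> carrier G"
    and diam: "\<And>z w. z \<in> carrier G \<Longrightarrow> w \<in> carrier G \<Longrightarrow> d z w \<le> d x y"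
    using property_FR_diameter_attained[of G d, OF G FR zh inv] by metis
  define M where "M n s =
    max (max (E n x (s \<otimes> x)) (E n x (s \<otimes> y))) (max (E n y (s \<otimes> x)) (E n y (s \<otimes> y)))
    - E n x y + 1 / N n + 2 * (\<epsilon> n / N n)" for n s
  have M_ev: "\<forall>\<^sub>F n in sequentially. M (r n) s < 1" if s: "s \<in> S" for s
  proof -
    have sc: "s \<in> carrier G" using s S by auto
    let ?l = "max (max (d x (s \<otimes> x)) (d x (s \<otimes> y))) (max (d y (s \<otimes> x)) (d y (s \<otimes> y)))
      - d x y + 0 + 2 * 0"
    have "(\<lambda>n. M (r n) s) \<longlonglongrightarrow> ?l"
      unfolding M_def using sc x y
      by (intro tendsto_add tendsto_diff tendsto_max tendsto_mult tendsto_const d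
          sub_lim[OF N_lim] sub_lim[OF \<epsilon>_lim]) auto
    moreover have "?l < 1"
      using diam[of x "s \<otimes> x"] diam[of x "s \<otimes> y"] diam[of y "s \<otimes> x"] diam[of y "s \<otimes> y"] sc x y
      by (simp add: max_def)
    ultimately show ?thesis by (rule order_tendstoD)
  qed
  have "\<forall>\<^sub>F n in sequentially. \<forall>s\<in>S. M (r n) s < 1 \<and>
      u (r n) (s \<otimes> x) = u (r n) s \<otimes>\<^bsub>H (r n)\<^esub> u (r n) x \<and>
      u (r n) (s \<otimes> y) = u (r n) s \<otimes>\<^bsub>H (r n)\<^esub> u (r n) y"
  proof (rule eventually_ball_finite[OF S(1)], intro ballI)
    fix s assume s: "s \<in> S"
    hence sc: "s \<in> carrier G" using S(2) by auto
    show "\<forall>\<^sub>F n in sequentially. M (r n) s < 1 \<and>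
        u (r n) (s \<otimes> x) = u (r n) s \<otimes>\<^bsub>H (r n)\<^esub> u (r n) x \<and>
        u (r n) (s \<otimes> y) = u (r n) s \<otimes>\<^bsub>H (r n)\<^esub> u (r n) y"
      using M_ev[OF s] sub[OF mult[OF sc x]] sub[OF mult[OF sc y]] by eventually_elim blast
  qed
  then obtain j where j: "\<And>s. s \<in> S \<Longrightarrow> M (r j) s < 1 \<and>
      u (r j) (s \<otimes> x) = u (r j) s \<otimes>\<^bsub>H (r j)\<^esub> u (r j) x \<and>
      u (r j) (s \<otimes> y) = u (r j) s \<otimes>\<^bsub>H (r j)\<^esub> u (r j) y"
    unfolding eventually_sequentially by blast
  define n where "n = r j"
  obtain p where p: "p \<in> carrier (H n)"
    and disp: "\<And>g. g \<in> carrier (H n) \<Longrightarrow> D n p (g \<otimes>\<^bsub>H n\<^esub> p) \<le>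
      max (max (D n (u n x) (g \<otimes>\<^bsub>H n\<^esub> u n x)) (D n (u n x) (g \<otimes>\<^bsub>H n\<^esub> u n y)))
          (max (D n (u n y) (g \<otimes>\<^bsub>H n\<^esub> u n x)) (D n (u n y) (g \<otimes>\<^bsub>H n\<^esub> u n y)))
      - D n (u n x) (u n y) + 1 + 2 * \<epsilon> n"
    using H.midpoint_displacement[OF four[unfolded D_def] u[OF x] u[OF y], of n] unfolding D_def by blast
  have "D n p (u n s \<otimes>\<^bsub>H n\<^esub> p) < N n" if s: "s \<in> S" for s
  proof -
    have sc: "s \<in> carrier G" using s S(2) by auto
    have us: "u n (s \<otimes> x) = u n s \<otimes>\<^bsub>H n\<^esub> u n x" "u n (s \<otimes> y) = u n s \<otimes>\<^bsub>H n\<^esub> u n y"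
      and M1: "M n s < 1" using j[OF s] unfolding n_def[symmetric] by auto
    have "D n p (u n s \<otimes>\<^bsub>H n\<^esub> p) / N n \<le> M n s"
      using divide_right_mono[OF disp[OF u[OF sc]], of "N n"] N_pos[of n] unfolding M_def E_def us
      by (simp add: add_divide_distrib diff_divide_distrib max_divide_distrib_right)
    hence "D n p (u n s \<otimes>\<^bsub>H n\<^esub> p) / N n < 1" using M1 by linarith
    thus ?thesis using N_pos[of n] by simp
  qed
  thus ?thesis using p by blast
qed

section \<open>Lifting endomorphisms along the approximating sequence\<close>

lemma exponent_sum_presented_eq:
  assumes "presented_eq S R v w" "R \<subseteq> {[]}"
  shows "exponent_sum v = exponent_sum w"
  using assms by induction auto

context generated_group begin

lemma len_letter_val: "fst a \<in> carrier G \<Longrightarrow> len (letter_val G a) = len (fst a)"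
  by (simp add: letter_val_def len_inv)

lemma len_word_val_le:
  assumes "w \<in> words A" "A \<subseteq> carrier G" "\<And>a. a \<in> A \<Longrightarrow> len a \<le> N"
  shows "len (word_val G w) \<le> N * length w"
  using assms(1)
proof (induction w)
  case (Cons a w)
  hence a: "fst a \<in> carrier G" "word_val G w \<in> carrier G" "len (fst a) \<le> N"
    using assms by (auto intro: word_val_closed)
  have "len (letter_val G a \<otimes> word_val G w) \<le> len (letter_val G a) + len (word_val G w)"
    using a by (intro len_mult letter_val_closed)
  thus ?case using Cons a by (simp add: len_letter_val)
qed simp

text \<open>Von Dyck's theorem on the level of words: a substitution that kills the relators respects all relations.\<close>

lemma word_val_map_presented_eq:
  fixes T :: "'c set"
  assumes "presented_eq T R v w" and R: "R \<subseteq> words T" and f: "f ` T \<subseteq> carrier G"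
    and relators: "\<And>r. r \<in> R \<Longrightarrow> word_val G (map_word f r) = \<one>"
  shows "word_val G (map_word f v) = word_val G (map_word f w)"
proof -
  have fw: "map_word f w \<in> words (f ` T)" if "w \<in> words T" for w
    using that by (rule map_word_in_words) simp
  have closed: "word_val G (map_word f w) \<in> carrier G" if "w \<in> words T" for w
    by (rule word_val_closed[OF fw[OF that] f])
  have append: "word_val G (map_word f (v @ w)) = word_val G (map_word f v) \<otimes> word_val G (map_word f w)"
    if "v \<in> words T" "w \<in> words T" for v w
    unfolding map_word_simps by (rule word_val_append[OF fw[OF that(1)] fw[OF that(2)] f])
  have delete: "word_val G (map_word f (u @ q @ v)) = word_val G (map_word f (u @ v))"
    if uqv: "u \<in> words T" "q \<in> words T" "v \<in> words T" and q: "word_val G (map_word f q) = \<one>" for u q v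
  proof -
    have "word_val G (map_word f (q @ v)) = word_val G (map_word f v)"
      using append[OF uqv(2,3)] q closed[OF uqv(3)] by simp
    thus ?thesis using append[of u "q @ v"] append[of u v] uqv by (metis words_append)
  qed
  show ?thesis using assms(1)
  proof induction
    case (cancel u v s b)
    have "f s \<in> carrier G" using cancel f by blast
    hence "word_val G (map_word f [(s, b), (s, \<not> b)]) = \<one>" by (cases b) (simp_all add: letter_val_def)
    thus ?case using cancel by (intro delete) auto
  next
    case (relator u v r)
    thus ?case using R relators by (intro delete) auto
  qed metis+
qed

end

context lacunary_hyperbolic_approximation begin

lemma generated_limit: "generated_group G S"
  using group_limit generating_limit
  by (simp add: generated_group_def generated_group_axioms_def finite_generating_set_def)

lemma generated_seq: "generated_group (Gs k) (Ss k)"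
  using group_seq generating_seq
  by (simp add: generated_group_def generated_group_axioms_def finite_generating_set_def)

sublocale G: generated_group G S by (rule generated_limit)
sublocale Gs: generated_group "Gs k" "Ss k" for k by (rule generated_seq)

lemma \<eta>_hom: "\<eta> k \<in> hom (Gs k) G"
  using limit by (simp add: direct_limit_def)

sublocale \<eta>: group_hom "Gs k" G "\<eta> k" for k
  using \<eta>_hom by (simp add: group_hom_def group_hom_axioms_def group_limit group_seq)

lemma finite_S: "finite S"
  using generating_limit by (simp add: finite_generating_set_def)

lemma countable_limit: "countable (carrier G)"
proof -
  have "countable (words S)" unfolding words_def by (intro countable_lists countable_SIGMA) (auto simp: finite_S countable_finite)
  moreover have "carrier G \<subseteq> word_val G ` words S" using G.word_exists by blast
  ultimately show ?thesis by (meson countable_image countable_subset)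
qed

lemma len_\<eta>_le:
  assumes h: "h \<in> carrier (Gs k)"
  shows "G.len (\<eta> k h) \<le> Gs.len k h"
proof -
  obtain w where w: "w \<in> words (Ss k)" "length w = Gs.len k h" "word_val (Gs k) w = h"
    using Gs.length_attained[OF h] .
  have "\<eta> k h = word_val G (map_word (\<eta> k) w)"
    using word_val_map_word[OF group_seq group_limit \<eta>_hom w(1) Gs.S_carrier] w(3) by simp
  moreover have "map_word (\<eta> k) w \<in> words S"
    using w(1) by (rule map_word_in_words) (simp add: \<eta>_generators)
  ultimately show ?thesis using G.len_le[of "map_word (\<eta> k) w" "\<eta> k h"] w(2) by simp
qed

lemma generator_section: "\<exists>\<sigma>. \<sigma> ` S \<subseteq> Ss k \<and> (\<forall>s\<in>S. \<eta> k (\<sigma> s) = s)"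
proof -
  have "\<forall>s\<in>S. \<exists>t\<in>Ss k. \<eta> k t = s" using \<eta>_generators[of k] by blast
  then obtain \<sigma> where "\<forall>s\<in>S. \<sigma> s \<in> Ss k \<and> \<eta> k (\<sigma> s) = s" by metis
  thus ?thesis by blast
qed

lemma short_lift:
  assumes g: "g \<in> carrier G"
  shows "\<exists>h\<in>carrier (Gs k). \<eta> k h = g \<and> Gs.len k h \<le> G.len g"
proof -
  obtain \<sigma> where \<sigma>: "\<sigma> ` S \<subseteq> Ss k" "\<And>s. s \<in> S \<Longrightarrow> \<eta> k (\<sigma> s) = s"
    using generator_section by blast
  obtain w where w: "w \<in> words S" "length w = G.len g" "word_val G w = g"
    using G.length_attained[OF g] .
  let ?h = "word_val (Gs k) (map_word \<sigma> w)"
  have \<sigma>w: "map_word \<sigma> w \<in> words (Ss k)" using w(1) \<sigma>(1) by (rule map_word_in_words)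
  have "\<eta> k ?h = word_val G (map_word (\<lambda>s. \<eta> k (\<sigma> s)) w)"
    using word_val_map_word[OF group_seq group_limit \<eta>_hom \<sigma>w Gs.S_carrier] by (simp add: map_word_compose)
  also have "map_word (\<lambda>s. \<eta> k (\<sigma> s)) w = w" using w(1) \<sigma>(2) by (rule map_word_id)
  finally have "\<eta> k ?h = g" using w(3) by simp
  moreover have "Gs.len k ?h \<le> G.len g" using Gs.len_le[OF \<sigma>w HOL.refl] w(2) by simp
  moreover have "?h \<in> carrier (Gs k)" by (rule Gs.word_val_closed[OF \<sigma>w Gs.S_carrier])
  ultimately show ?thesis by blast
qed

lemma \<alpha>_hom: "\<alpha> k \<in> hom (Gs k) (Gs (Suc k))"
  using \<alpha>_epi[of k] by (simp add: epi_def)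

lemma transition_generators: "transition \<alpha> 0 k ` Ss 0 = Ss k"
proof (induction k)
  case (Suc k)
  have "transition \<alpha> 0 (Suc k) ` Ss 0 = \<alpha> k ` (transition \<alpha> 0 k ` Ss 0)"
    by (simp add: image_comp)
  thus ?case using Suc \<alpha>_generators by simp
qed simp

lemma transition_add: "transition \<alpha> k (m + n) x = transition \<alpha> (k + m) n (transition \<alpha> k m x)"
  by (induction n) (auto simp: add.assoc)

text \<open>A relation of the limit group holds already in \<open>Gs k\<close> for all large \<open>k\<close>.  The lifts are images
  of words over \<open>Ss 0\<close>, so that one stage at which they become equal serves for all later ones.\<close>

lemma relation_lift:
  assumes v: "v \<in> words S" and w: "w \<in> words S" and eq: "word_val G v = word_val G w"
  shows "\<exists>K. \<forall>k\<ge>K. \<exists>v'\<in>words (Ss k). \<exists>w'\<in>words (Ss k).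
    map_word (\<eta> k) v' = v \<and> map_word (\<eta> k) w' = w \<and> word_val (Gs k) v' = word_val (Gs k) w'"
proof -
  obtain \<sigma> where \<sigma>: "\<sigma> ` S \<subseteq> Ss 0" "\<And>s. s \<in> S \<Longrightarrow> \<eta> 0 (\<sigma> s) = s"
    using generator_section by blast
  have \<sigma>_words: "map_word \<sigma> w \<in> words (Ss 0)" if "w \<in> words S" for w
    using that \<sigma>(1) by (rule map_word_in_words)
  have \<eta>_\<sigma>: "\<eta> 0 (word_val (Gs 0) (map_word \<sigma> w)) = word_val G w" if w: "w \<in> words S" for w
  proof -
    have "map_word (\<lambda>s. \<eta> 0 (\<sigma> s)) w = w" using w \<sigma>(2) by (rule map_word_id)
    thus ?thesis
      using word_val_map_word[OF group_seq group_limit \<eta>_hom \<sigma>_words[OF w] Gs.S_carrier]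
      by (simp add: map_word_compose)
  qed
  have closed: "word_val (Gs 0) (map_word \<sigma> w) \<in> carrier (Gs 0)" if "w \<in> words S" for w
    by (rule Gs.word_val_closed[OF \<sigma>_words[OF that] Gs.S_carrier])
  obtain K where K: "transition \<alpha> 0 K (word_val (Gs 0) (map_word \<sigma> v)) =
      transition \<alpha> 0 K (word_val (Gs 0) (map_word \<sigma> w))"
    using limit closed[OF v] closed[OF w] \<eta>_\<sigma>[OF v] \<eta>_\<sigma>[OF w] eq unfolding direct_limit_def by metis
  have "\<exists>v'\<in>words (Ss k). \<exists>w'\<in>words (Ss k).
    map_word (\<eta> k) v' = v \<and> map_word (\<eta> k) w' = w \<and> word_val (Gs k) v' = word_val (Gs k) w'"
    if k: "K \<le> k" for k
  proof -
    let ?t = "transition \<alpha> 0 k"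
    have t_hom: "?t \<in> hom (Gs 0) (Gs k)" using transition_hom[of \<alpha> Gs 0 k] \<alpha>_hom by simp
    have t_words: "map_word (\<lambda>s. ?t (\<sigma> s)) w \<in> words (Ss k)" if "w \<in> words S" for w
      using that by (rule map_word_in_words) (use \<sigma>(1) transition_generators[of k] in blast)
    have t_val: "word_val (Gs k) (map_word (\<lambda>s. ?t (\<sigma> s)) w) = ?t (word_val (Gs 0) (map_word \<sigma> w))"
      if "w \<in> words S" for w
      using word_val_map_word[OF group_seq group_seq t_hom \<sigma>_words[OF that] Gs.S_carrier]
      by (simp add: map_word_compose)
    have "\<eta> k (?t (\<sigma> s)) = s" if s: "s \<in> S" for s
    proof -
      have "\<sigma> s \<in> carrier (Gs 0)" using s \<sigma>(1) Gs.S_carrier by blast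
      hence "\<eta> (0 + k) (?t (\<sigma> s)) = \<eta> 0 (\<sigma> s)"
        using limit by (intro transition_cocone[of \<alpha> Gs \<eta>, OF \<alpha>_hom]) (simp_all add: direct_limit_def)
      thus ?thesis using \<sigma>(2)[OF s] by simp
    qed
    hence t_\<eta>: "map_word (\<eta> k) (map_word (\<lambda>s. ?t (\<sigma> s)) w) = w" if "w \<in> words S" for w
      unfolding map_word_compose using that by (intro map_word_id)
    have "?t (word_val (Gs 0) (map_word \<sigma> v)) = ?t (word_val (Gs 0) (map_word \<sigma> w))"
      using transition_add[of 0 K "k - K"] K k by simp
    thus ?thesis using t_words[OF v] t_words[OF w] t_val[OF v] t_val[OF w] t_\<eta>[OF v] t_\<eta>[OF w] by metis
  qed
  thus ?thesis by blast
qed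

text \<open>Substituting short lifts \<open>c s\<close> of \<open>\<psi> s\<close> into a relator of length at most \<open>10 \<delta>\<close> gives an element of the ball
  on which \<open>\<eta> k\<close> is injective, and \<open>\<eta> k\<close> maps it to the image under \<open>\<psi>\<close> of the trivial element; hence it is trivial, and the
  substitution respects all relations.\<close>

lemma lifted_relation:
  assumes \<psi>: "\<psi> \<in> hom G G"
    and c: "\<And>s. s \<in> S \<Longrightarrow> c s \<in> carrier (Gs k)" "\<And>s. s \<in> S \<Longrightarrow> \<eta> k (c s) = \<psi> s"
      "\<And>s. s \<in> S \<Longrightarrow> Gs.len k (c s) \<le> N"
    and inj: "inj_on (\<eta> k) (word_ball (Gs k) (Ss k) \<one>\<^bsub>Gs k\<^esub> r)" and r: "10 * \<delta> k * real N \<le> real r"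
    and v: "v \<in> words (Ss k)" and w: "w \<in> words (Ss k)" and eq: "word_val (Gs k) v = word_val (Gs k) w"
  shows "word_val (Gs k) (map_word c (map_word (\<eta> k) v)) = word_val (Gs k) (map_word c (map_word (\<eta> k) w))"
proof -
  obtain R where R: "presentation (Gs k) (Ss k) R" and short: "\<And>\<rho>. \<rho> \<in> R \<Longrightarrow> real (length \<rho>) \<le> 10 * \<delta> k"
    using short_relators by blast
  have R_words: "R \<subseteq> words (Ss k)"
    and R_iff: "\<And>v w. v \<in> words (Ss k) \<Longrightarrow> w \<in> words (Ss k) \<Longrightarrow>
      word_val (Gs k) v = word_val (Gs k) w \<longleftrightarrow> presented_eq (Ss k) R v w"
    using R by (auto simp: presentation_def)
  let ?f = "\<lambda>t. c (\<eta> k t)"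
  have \<eta>S: "\<eta> k t \<in> S" if "t \<in> Ss k" for t using \<eta>_generators[of k] that by blast
  have f: "?f ` Ss k \<subseteq> carrier (Gs k)" using c(1) \<eta>S by blast
  have trivial: "word_val (Gs k) (map_word ?f \<rho>) = \<one>\<^bsub>Gs k\<^esub>" if \<rho>: "\<rho> \<in> R" for \<rho>
  proof -
    have \<rho>w: "\<rho> \<in> words (Ss k)" using \<rho> R_words by blast
    have "presented_eq (Ss k) R ([] @ \<rho> @ []) ([] @ [])" by (rule presented_eq.relator) (use \<rho> in auto)
    hence \<rho>1: "word_val (Gs k) \<rho> = \<one>\<^bsub>Gs k\<^esub>" using R_iff[OF \<rho>w, of "[]"] by simp
    let ?x = "word_val (Gs k) (map_word ?f \<rho>)"
    have fw: "map_word ?f \<rho> \<in> words (?f ` Ss k)" using \<rho>w by (rule map_word_in_words) simp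
    have x: "?x \<in> carrier (Gs k)" by (rule Gs.word_val_closed[OF fw f])
    have \<eta>\<rho>: "map_word (\<eta> k) \<rho> \<in> words S"
      using \<rho>w by (rule map_word_in_words) (simp add: \<eta>_generators)
    have "\<eta> k ?x = word_val G (map_word (\<lambda>t. \<eta> k (?f t)) \<rho>)"
      using word_val_map_word[OF group_seq group_limit \<eta>_hom fw f] by (simp add: map_word_compose)
    also have "map_word (\<lambda>t. \<eta> k (?f t)) \<rho> = map_word \<psi> (map_word (\<eta> k) \<rho>)"
      unfolding map_word_compose using \<rho>w by (rule map_word_cong) (simp add: c(2) \<eta>S)
    also have "word_val G \<dots> = \<psi> (word_val G (map_word (\<eta> k) \<rho>))"
      by (rule word_val_map_word[OF group_limit group_limit \<psi> \<eta>\<rho> G.S_carrier, symmetric])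
    also have "word_val G (map_word (\<eta> k) \<rho>) = \<eta> k (word_val (Gs k) \<rho>)"
      by (rule word_val_map_word[OF group_seq group_limit \<eta>_hom \<rho>w Gs.S_carrier, symmetric])
    also have "\<psi> \<dots> = \<one>\<^bsub>G\<^esub>"
      using hom_one[OF \<psi> group_limit group_limit] by (simp add: \<rho>1)
    finally have "\<eta> k ?x = \<eta> k \<one>\<^bsub>Gs k\<^esub>" by simp
    moreover have "Gs.len k ?x \<le> r"
    proof -
      have "Gs.len k ?x \<le> N * length (map_word ?f \<rho>)"
        by (rule Gs.len_word_val_le[OF fw f]) (use c(3) \<eta>S in auto)
      hence "real (Gs.len k ?x) \<le> real N * real (length \<rho>)" by (simp flip: of_nat_mult)
      also have "\<dots> \<le> real N * (10 * \<delta> k)" by (intro mult_left_mono short \<rho>) simp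
      also have "\<dots> \<le> real r" using r by (simp add: mult.commute)
      finally show ?thesis by simp
    qed
    ultimately show ?thesis
      using inj_onD[OF inj, of ?x "\<one>\<^bsub>Gs k\<^esub>"] x by (simp add: word_ball_def Gs.wdist_one)
  qed
  have "presented_eq (Ss k) R v w" using R_iff[OF v w] eq by simp
  thus ?thesis
    unfolding map_word_compose by (rule Gs.word_val_map_presented_eq[OF _ R_words f trivial])
qed

end

section \<open>Minimal representatives and the gap\<close>

context group begin

lemma inner_aut_hom: "g \<in> carrier G \<Longrightarrow> inner_aut G g \<in> hom G G"
  using inner_aut_auto[of g] by (simp add: auto_def)

lemma Out_representative:
  assumes "\<Phi> \<in> carrier (Out G)"
  shows "\<exists>\<phi>\<in>\<Phi>. \<phi> \<in> hom G G"
proof -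
  obtain \<psi> where \<psi>: "\<psi> \<in> auto G" and \<Phi>: "\<Phi> = Inn G #>\<^bsub>AutoGroup G\<^esub> \<psi>"
    using assms by (auto simp: Out_def FactGroup_def RCOSETS_def AutoGroup_def)
  define \<phi> where "\<phi> = compose (carrier G) (inner_aut G \<one>) \<psi>"
  have "\<psi> \<in> Bij (carrier G)" "inner_aut G \<one> \<in> Bij (carrier G)"
    using \<psi> inner_aut_auto[of \<one>] by (auto simp: auto_def)
  hence "\<phi> = inner_aut G \<one> \<otimes>\<^bsub>AutoGroup G\<^esub> \<psi>" by (simp add: \<phi>_def AutoGroup_def BijGroup_def)
  hence "\<phi> \<in> \<Phi>" unfolding \<Phi> r_coset_def Inn_def by blast
  moreover have "\<phi> \<in> hom G G"
    unfolding \<phi>_def using \<psi> inner_aut_hom[of \<one>] by (intro hom_compose) (auto simp: auto_def)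
  ultimately show ?thesis by blast
qed

end

context generated_group begin

lemma endo_size_le_iff:
  assumes "finite S"
  shows "endo_size G S \<phi> \<le> n \<longleftrightarrow> (\<forall>s\<in>S. len (\<phi> s) \<le> n)"
  using assms by (simp add: endo_size_def)

text \<open>The infimum in the definition of the norm is attained since it ranges over natural numbers.  If \<open>n = 0\<close>, the set of
  generators may be empty, and then no generator can witness minimality.\<close>

lemma minimal_endomorphism:
  assumes fin: "finite S" and n: "n \<in> out_norms G S"
  shows "\<exists>\<psi>\<in>hom G G. (\<forall>s\<in>S. len (\<psi> s) \<le> n) \<and>
    (0 < n \<longrightarrow> (\<forall>g\<in>carrier G. \<exists>s\<in>S. n \<le> len (g \<otimes> \<psi> s \<otimes> inv g)))"
proof -
  obtain \<Phi> where \<Phi>: "\<Phi> \<in> carrier (Out G)" "n = out_norm G S \<Phi>" using n by (auto simp: out_norms_def)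
  obtain \<phi> where \<phi>: "\<phi> \<in> \<Phi>" "\<phi> \<in> hom G G" using Out_representative[OF \<Phi>(1)] by blast
  let ?size = "\<lambda>g. endo_size G S (inner_aut G g \<circ> \<phi>)"
  have n_eq: "n = Inf (?size ` carrier G)"
    using out_norm_eq[OF S_carrier \<Phi>(1) \<phi>(1)] \<Phi>(2) by (simp add: endo_norm_def)
  have "n \<in> ?size ` carrier G" unfolding n_eq by (rule Inf_nat_def1) blast
  then obtain g where g: "g \<in> carrier G" "n = ?size g" by blast
  have min: "n \<le> ?size h" if "h \<in> carrier G" for h
    unfolding n_eq using that by (intro cInf_lower) auto
  have \<phi>_closed: "\<phi> s \<in> carrier G" if "s \<in> S" for s using \<phi>(2) that S_carrier by (auto simp: hom_def)
  define \<psi> where "\<psi> x = inner_aut G g (\<phi> x)" for x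
  have "\<psi> \<in> hom G G"
    using Group.hom_compose[OF \<phi>(2) inner_aut_hom[OF g(1)]] by (simp add: \<psi>_def[abs_def] comp_def)
  moreover have "\<forall>s\<in>S. len (\<psi> s) \<le> n"
    using endo_size_le_iff[OF fin, of "inner_aut G g \<circ> \<phi>" n] g(2) by (simp add: \<psi>_def)
  moreover have "\<exists>s\<in>S. n \<le> len (h \<otimes> \<psi> s \<otimes> inv h)" if "0 < n" and h: "h \<in> carrier G" for h
  proof (rule ccontr)
    assume "\<not> ?thesis"
    hence *: "len (h \<otimes> \<psi> s \<otimes> inv h) \<le> n - 1" if "s \<in> S" for s using that by fastforce
    have "len ((inner_aut G (h \<otimes> g) \<circ> \<phi>) s) \<le> n - 1" if s: "s \<in> S" for s
    proof -
      have "inner_aut G (h \<otimes> g) (\<phi> s) = inner_aut G h (\<psi> s)"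
        unfolding \<psi>_def by (rule inner_aut_mult[OF h g(1) \<phi>_closed[OF s], symmetric])
      moreover have "\<psi> s \<in> carrier G" using g(1) \<phi>_closed[OF s] by (simp add: \<psi>_def inner_aut_def)
      ultimately show ?thesis using *[OF s] by (simp add: inner_aut_def)
    qed
    hence "?size (h \<otimes> g) \<le> n - 1" using endo_size_le_iff[OF fin] by blast
    moreover have "n \<le> ?size (h \<otimes> g)" using g(1) h by (intro min) simp
    ultimately show False using \<open>0 < n\<close> by linarith
  qed
  ultimately show ?thesis by blast
qed

end

text \<open>The injectivity radius is a supremum, possibly infinite, and the admissible radius \<open>r\<close> has to be extracted from it.
  A natural number just below it is used since the supremum over the extended naturals is
  approached through strict inequalities.\<close>

lemma less_injectivity_radius_obtains:
  assumes "ereal (real n) < ereal (1 / 10) * ereal_of_enat (injectivity_radius H T f) / ereal \<delta>" and "0 < \<delta>"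
  obtains r where "10 * \<delta> * real n \<le> real r" "\<And>x. x \<in> carrier H \<Longrightarrow> inj_on f (word_ball H T x r)"
proof -
  let ?A = "{enat R | R. \<forall>x\<in>carrier H. inj_on f (word_ball H T x R)}"
  have "\<exists>m. enat m < injectivity_radius H T f \<and> 10 * \<delta> * real n \<le> real m + 1"
  proof (cases "injectivity_radius H T f")
    case (enat r)
    hence *: "10 * \<delta> * real n < real r" using assms by (simp add: field_simps)
    moreover have "0 \<le> 10 * \<delta> * real n" using \<open>0 < \<delta>\<close> by simp
    ultimately have "0 < r" by (metis le_less_trans of_nat_0_less_iff)
    thus ?thesis using * enat by (intro exI[of _ "r - 1"]) (auto simp: of_nat_diff)
  next
    case infinity
    thus ?thesis by (intro exI[of _ "nat \<lceil>10 * \<delta> * real n\<rceil>"]) (simp, linarith)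
  qed
  then obtain m where m: "enat m < injectivity_radius H T f" "10 * \<delta> * real n \<le> real m + 1" by blast
  obtain a where "a \<in> ?A" "enat m < a"
    using m(1) unfolding injectivity_radius_def less_Sup_iff by blast
  then obtain r where "m < r" "\<And>x. x \<in> carrier H \<Longrightarrow> inj_on f (word_ball H T x r)" by auto
  moreover from this(1) have "10 * \<delta> * real n \<le> real r" using m(2) by linarith
  ultimately show ?thesis using that by blast
qed

context lacunary_hyperbolic_approximation begin

text \<open>The relators of \<open>Gs k\<close> have length at most \<open>10 \<delta> k < 1\<close> for infinitely many \<open>k\<close>, so the exponent sum is a well-defined
  homomorphism from \<open>G\<close> to the integers.  It takes the value \<open>n\<close> at the \<open>n\<close>-th power of a generator, so
  the pulled back metric is unbounded.\<close>

lemma no_generators_if_frequently_free: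
  assumes FR: "property_FR G" and small: "\<And>K. \<exists>k\<ge>K. \<delta> k < 1 / 10"
  shows "S = {}"
proof (rule ccontr)
  assume "S \<noteq> {}"
  then obtain s where s: "s \<in> S" by blast
  have well_defined: "exponent_sum v = exponent_sum w"
    if v: "v \<in> words S" and w: "w \<in> words S" and eq: "word_val G v = word_val G w" for v w
  proof -
    obtain K where K: "\<And>k. k \<ge> K \<Longrightarrow> \<exists>v'\<in>words (Ss k). \<exists>w'\<in>words (Ss k).
        map_word (\<eta> k) v' = v \<and> map_word (\<eta> k) w' = w \<and> word_val (Gs k) v' = word_val (Gs k) w'"
      using relation_lift[OF v w eq] by blast
    obtain k where k: "k \<ge> K" "\<delta> k < 1 / 10" using small by blast
    obtain v' w' where vw': "v' \<in> words (Ss k)" "w' \<in> words (Ss k)" "map_word (\<eta> k) v' = v"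
      "map_word (\<eta> k) w' = w" "word_val (Gs k) v' = word_val (Gs k) w'" using K[OF k(1)] by blast
    obtain R where R: "presentation (Gs k) (Ss k) R" and short: "\<And>\<rho>. \<rho> \<in> R \<Longrightarrow> real (length \<rho>) \<le> 10 * \<delta> k"
      using short_relators by blast
    have "\<rho> = []" if "\<rho> \<in> R" for \<rho>
    proof -
      have "real (length \<rho>) < 1" using short[OF that] k(2) by linarith
      thus ?thesis by simp
    qed
    hence "R \<subseteq> {[]}" by blast
    moreover have "presented_eq (Ss k) R v' w'" using R vw' by (simp add: presentation_def)
    ultimately have "exponent_sum v' = exponent_sum w'" using exponent_sum_presented_eq by blast
    thus ?thesis using vw'(3,4) by auto
  qed
  have "\<forall>g\<in>carrier G. \<exists>w\<in>words S. word_val G w = g" using G.word_exists by blast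
  then obtain wd where wd: "\<And>g. g \<in> carrier G \<Longrightarrow> wd g \<in> words S"
    and wd_val: "\<And>g. g \<in> carrier G \<Longrightarrow> word_val G (wd g) = g" by metis
  define E where "E g = exponent_sum (wd g)" for g
  have E_mult: "E (g \<otimes>\<^bsub>G\<^esub> h) = E g + E h" if g: "g \<in> carrier G" and h: "h \<in> carrier G" for g h
  proof -
    have "word_val G (wd (g \<otimes>\<^bsub>G\<^esub> h)) = word_val G (wd g @ wd h)"
      using G.word_val_append[OF wd[OF g] wd[OF h] G.S_carrier] g h by (simp add: wd_val)
    hence "exponent_sum (wd (g \<otimes>\<^bsub>G\<^esub> h)) = exponent_sum (wd g @ wd h)"
      using g h by (intro well_defined) (simp_all add: wd)
    thus ?thesis by (simp add: E_def)
  qed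
  have sG: "s \<in> carrier G" using s G.S_carrier by blast
  have "exponent_sum (wd s) = exponent_sum [(s, True)]"
    using s sG by (intro well_defined) (simp_all add: wd wd_val letter_val_def)
  hence Es: "E s = 1" by (simp add: E_def)
  have E1: "E \<one>\<^bsub>G\<^esub> = 0" using E_mult[of "\<one>\<^bsub>G\<^esub>" "\<one>\<^bsub>G\<^esub>"] by simp
  define d where "d g h = \<bar>real_of_int (E g) - real_of_int (E h)\<bar>" for g h
  have "zero_hyperbolic (carrier G) d"
  proof
    show "four_point (carrier G) d 0"
      unfolding four_point_def d_def max_def by (auto simp: abs_if)
  qed (auto simp: d_def)
  moreover have "d (g \<otimes>\<^bsub>G\<^esub> x) (g \<otimes>\<^bsub>G\<^esub> y) = d x y"
    if "g \<in> carrier G" "x \<in> carrier G" "y \<in> carrier G" for g x y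
    using that by (simp add: d_def E_mult)
  ultimately obtain x y where diam: "\<And>z w. z \<in> carrier G \<Longrightarrow> w \<in> carrier G \<Longrightarrow> d z w \<le> d x y"
    using property_FR_diameter_attained[OF group_limit FR, of d] by blast
  have power: "s [^]\<^bsub>G\<^esub> n \<in> carrier G \<and> E (s [^]\<^bsub>G\<^esub> n) = int n" for n :: nat
    by (induction n) (auto simp: E1 E_mult Es sG)
  have "real n \<le> d x y" for n
    using diam[of "s [^]\<^bsub>G\<^esub> n" "\<one>\<^bsub>G\<^esub>"] power[of n] by (simp add: d_def E1)
  thus False using reals_Archimedean2[of "d x y"] by (meson not_less)
qed

text \<open>Substituting lifts of the elements \<open>\<psi> n s\<close> into words gives maps to \<open>Gs (k n)\<close> that are multiplicative in the
  limit, and minimality of \<open>\<psi> n\<close> among its conjugates contradicts their small displacement.\<close>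

lemma no_long_minimal_endomorphisms:
  fixes \<psi> :: "nat \<Rightarrow> 'a \<Rightarrow> 'a" and N k r :: "nat \<Rightarrow> nat"
  assumes FR: "property_FR G"
    and \<psi>: "\<And>n. \<psi> n \<in> hom G G"
    and short: "\<And>n s. s \<in> S \<Longrightarrow> G.len (\<psi> n s) \<le> N n"
    and minimal: "\<And>n g. g \<in> carrier G \<Longrightarrow> \<exists>s\<in>S. N n \<le> G.len (g \<otimes>\<^bsub>G\<^esub> \<psi> n s \<otimes>\<^bsub>G\<^esub> inv\<^bsub>G\<^esub> g)"
    and k: "\<And>n. n \<le> k n"
    and \<delta>_ge: "\<And>n. 1 / 10 \<le> \<delta> (k n)"
    and long: "\<And>n. (real n + 1) * \<delta> (k n) < real (N n)"
    and r: "\<And>n. 10 * \<delta> (k n) * real (N n) \<le> real (r n)"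
    and inj: "\<And>n x. x \<in> carrier (Gs (k n)) \<Longrightarrow> inj_on (\<eta> (k n)) (word_ball (Gs (k n)) (Ss (k n)) x (r n))"
  shows False
proof -
  have \<psi>_closed: "\<psi> n g \<in> carrier G" if "g \<in> carrier G" for n g using \<psi>[of n] that by (auto simp: hom_def)
  have SG: "s \<in> carrier G" if "s \<in> S" for s using that G.S_carrier by blast
  have "\<exists>h. h \<in> carrier (Gs (k n)) \<and> \<eta> (k n) h = \<psi> n s \<and> Gs.len (k n) h \<le> N n" if s: "s \<in> S" for n s
    using short_lift[OF \<psi>_closed[OF SG[OF s]], of "k n" n] short[OF s, of n] by (meson le_trans)
  hence "\<forall>n. \<forall>s\<in>S. \<exists>h. h \<in> carrier (Gs (k n)) \<and> \<eta> (k n) h = \<psi> n s \<and> Gs.len (k n) h \<le> N n" by blast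
  then obtain c where c_all: "\<forall>n. \<forall>s\<in>S.
      c n s \<in> carrier (Gs (k n)) \<and> \<eta> (k n) (c n s) = \<psi> n s \<and> Gs.len (k n) (c n s) \<le> N n"
    unfolding bchoice_iff choice_iff by blast
  have c: "c n s \<in> carrier (Gs (k n))" "\<eta> (k n) (c n s) = \<psi> n s" "Gs.len (k n) (c n s) \<le> N n"
    if "s \<in> S" for n s using c_all that by blast+
  have cS: "c n ` S \<subseteq> carrier (Gs (k n))" for n using c(1) by blast
  have "\<exists>w. w \<in> words S \<and> word_val G w = g \<and> (g \<in> S \<longrightarrow> w = [(g, True)])" if g: "g \<in> carrier G" for g
  proof (cases "g \<in> S")
    case True
    thus ?thesis using g by (intro exI[of _ "[(g, True)]"]) (simp add: letter_val_def)
  next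
    case False
    thus ?thesis using G.word_exists[OF g] by blast
  qed
  hence "\<forall>g\<in>carrier G. \<exists>w. w \<in> words S \<and> word_val G w = g \<and> (g \<in> S \<longrightarrow> w = [(g, True)])" by blast
  then obtain wd where wd_all: "\<forall>g\<in>carrier G.
      wd g \<in> words S \<and> word_val G (wd g) = g \<and> (g \<in> S \<longrightarrow> wd g = [(g, True)])"
    unfolding bchoice_iff by blast
  have wd: "wd g \<in> words S" "word_val G (wd g) = g" if "g \<in> carrier G" for g
    using wd_all that by blast+
  have wd_S: "wd s = [(s, True)]" if "s \<in> S" for s using wd_all SG that by blast
  \<comment> \<open>The word chosen for a generator is that letter, so that \<open>u n s\<close> is the lift \<open>c n s\<close> for all \<open>n\<close>, not only
    for large \<open>n\<close>.\<close>
  define u where "u n g = word_val (Gs (k n)) (map_word (c n) (wd g))" for n g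
  have cw: "map_word (c n) w \<in> words (c n ` S)" if "w \<in> words S" for n w
    using that by (rule map_word_in_words) simp
  have u_closed: "u n g \<in> carrier (Gs (k n))" if "g \<in> carrier G" for n g
    unfolding u_def by (rule Gs.word_val_closed[OF cw[OF wd(1)[OF that]] cS])
  have u_S: "u n s = c n s" if "s \<in> S" for n s
    using c(1)[OF that] by (simp add: u_def wd_S[OF that] letter_val_def)
  have N_pos: "0 < real (N n)" for n
  proof -
    have "0 < (real n + 1) * \<delta> (k n)" using \<delta>_pos[of "k n"] by simp
    thus ?thesis using long[of n] by (rule less_trans)
  qed
  have "\<exists>n. \<exists>p\<in>carrier (Gs (k n)). \<forall>s\<in>S. real (Gs.wdist (k n) p (u n s \<otimes>\<^bsub>Gs (k n)\<^esub> p)) < real (N n)"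
  proof (rule asymptotic_homs_have_small_displacement[OF group_limit FR countable_limit finite_S G.S_carrier,
        where T = "\<lambda>n. Ss (k n)" and \<epsilon> = "\<lambda>n. 4 * \<delta> (k n) + 2"])
    show "generated_group (Gs (k n)) (Ss (k n))" for n by (rule generated_seq)
    show "four_point (carrier (Gs (k n))) (\<lambda>x y. real (Gs.wdist (k n) x y)) (4 * \<delta> (k n) + 2)" for n
      using \<delta>_pos[of "k n"] by (intro Gs.four_point_if_hyperbolic hyperbolic) simp
    show "u n g \<in> carrier (Gs (k n))" if "g \<in> carrier G" for n g by (rule u_closed[OF that])
    show "\<forall>\<^sub>F n in sequentially. u n (g \<otimes>\<^bsub>G\<^esub> h) = u n g \<otimes>\<^bsub>Gs (k n)\<^esub> u n h"
      if g: "g \<in> carrier G" and h: "h \<in> carrier G" for g h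
    proof -
      have gh: "g \<otimes>\<^bsub>G\<^esub> h \<in> carrier G" using g h by simp
      have app: "wd g @ wd h \<in> words S" using wd(1)[OF g] wd(1)[OF h] by simp
      have "word_val G (wd (g \<otimes>\<^bsub>G\<^esub> h)) = word_val G (wd g @ wd h)"
        using G.word_val_append[OF wd(1)[OF g] wd(1)[OF h] G.S_carrier] g h gh by (simp add: wd(2))
      then obtain K where K: "\<And>j. j \<ge> K \<Longrightarrow> \<exists>v\<in>words (Ss j). \<exists>w\<in>words (Ss j).
          map_word (\<eta> j) v = wd (g \<otimes>\<^bsub>G\<^esub> h) \<and> map_word (\<eta> j) w = wd g @ wd h \<and>
          word_val (Gs j) v = word_val (Gs j) w"
        using relation_lift[OF wd(1)[OF gh] app] by blast
      have "u n (g \<otimes>\<^bsub>G\<^esub> h) = u n g \<otimes>\<^bsub>Gs (k n)\<^esub> u n h" if "K \<le> n" for n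
      proof -
        have "K \<le> k n" using that k[of n] by simp
        then obtain v w where vw: "v \<in> words (Ss (k n))" "w \<in> words (Ss (k n))"
          "map_word (\<eta> (k n)) v = wd (g \<otimes>\<^bsub>G\<^esub> h)" "map_word (\<eta> (k n)) w = wd g @ wd h"
          "word_val (Gs (k n)) v = word_val (Gs (k n)) w" using K by blast
        have "word_val (Gs (k n)) (map_word (c n) (map_word (\<eta> (k n)) v)) =
            word_val (Gs (k n)) (map_word (c n) (map_word (\<eta> (k n)) w))"
          by (rule lifted_relation[OF \<psi>[of n] c(1) c(2) c(3) inj[OF group.is_monoid[OF group_seq, THEN monoid.one_closed]] r vw(1,2,5)])
        hence "u n (g \<otimes>\<^bsub>G\<^esub> h) = word_val (Gs (k n)) (map_word (c n) (wd g) @ map_word (c n) (wd h))"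
          unfolding vw(3,4) by (simp add: u_def)
        also have "\<dots> = u n g \<otimes>\<^bsub>Gs (k n)\<^esub> u n h"
          unfolding u_def by (rule Gs.word_val_append[OF cw[OF wd(1)[OF g]] cw[OF wd(1)[OF h]] cS])
        finally show ?thesis .
      qed
      thus ?thesis unfolding eventually_sequentially by blast
    qed
    show "\<exists>C. \<forall>n. real (Gs.len (k n) (u n g)) \<le> C * real (N n)" if g: "g \<in> carrier G" for g
    proof (intro exI allI)
      fix n
      have "Gs.len (k n) (u n g) \<le> N n * length (map_word (c n) (wd g))"
        unfolding u_def by (rule Gs.len_word_val_le[OF cw[OF wd(1)[OF g]] cS]) (use c(3) in auto)
      hence "real (Gs.len (k n) (u n g)) \<le> real (N n * length (wd g))" by (simp only: of_nat_mono map_word_simps)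
      thus "real (Gs.len (k n) (u n g)) \<le> real (length (wd g)) * real (N n)" by (simp add: mult.commute)
    qed
    show "0 < real (N n)" for n by (rule N_pos)
    \<comment> \<open>Since \<open>\<delta> (k n) \<ge> 1/10\<close>, the additive constants are absorbed: \<open>1 \<le> 10 \<delta>\<close> and \<open>4 \<delta> + 2 \<le> 24 \<delta>\<close>.\<close>
    have \<delta>_N: "\<delta> (k n) / real (N n) \<le> inverse (real (Suc n))" for n
      using long[of n] N_pos[of n] by (simp add: field_simps)
    have zero: "(\<lambda>n. C * inverse (real (Suc n))) \<longlonglongrightarrow> 0" for C
      using tendsto_mult_right_zero[OF LIMSEQ_inverse_real_of_nat] .
    show "(\<lambda>n. 1 / real (N n)) \<longlonglongrightarrow> 0"
    proof (rule tendsto_sandwich[OF _ _ tendsto_const zero[of 10]])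
      have "1 / real (N n) \<le> 10 * inverse (real (Suc n))" for n
      proof -
        have "1 / real (N n) \<le> (10 * \<delta> (k n)) / real (N n)"
          using \<delta>_ge[of n] N_pos[of n] by (intro divide_right_mono) auto
        thus ?thesis using \<delta>_N[of n] by simp
      qed
      thus "\<forall>\<^sub>F n in sequentially. 1 / real (N n) \<le> 10 * inverse (real (Suc n))" by simp
    qed simp
    show "(\<lambda>n. (4 * \<delta> (k n) + 2) / real (N n)) \<longlonglongrightarrow> 0"
    proof (rule tendsto_sandwich[OF _ _ tendsto_const zero[of 24]])
      have "(4 * \<delta> (k n) + 2) / real (N n) \<le> 24 * inverse (real (Suc n))" for n
      proof -
        have "(4 * \<delta> (k n) + 2) / real (N n) \<le> (24 * \<delta> (k n)) / real (N n)"
          using \<delta>_ge[of n] N_pos[of n] by (intro divide_right_mono) auto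
        thus ?thesis using \<delta>_N[of n] by simp
      qed
      thus "\<forall>\<^sub>F n in sequentially. (4 * \<delta> (k n) + 2) / real (N n) \<le> 24 * inverse (real (Suc n))" by simp
      have "0 \<le> (4 * \<delta> (k n) + 2) / real (N n)" for n
        using \<delta>_pos[of "k n"] by simp
      thus "\<forall>\<^sub>F n in sequentially. 0 \<le> (4 * \<delta> (k n) + 2) / real (N n)" by simp
    qed
  qed
  then obtain n p where p: "p \<in> carrier (Gs (k n))"
    and disp: "\<And>s. s \<in> S \<Longrightarrow> Gs.wdist (k n) p (u n s \<otimes>\<^bsub>Gs (k n)\<^esub> p) < N n" by auto
  \<comment> \<open>Projecting to \<open>G\<close> does not increase lengths, so a vertex with small displacement gives a
    conjugate of \<open>\<psi> n\<close> that is shorter than the minimum.\<close>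
  define q where "q = \<eta> (k n) p"
  have q: "q \<in> carrier G" using p by (simp add: q_def)
  obtain s where s: "s \<in> S" and s_min: "N n \<le> G.len (inv\<^bsub>G\<^esub> q \<otimes>\<^bsub>G\<^esub> \<psi> n s \<otimes>\<^bsub>G\<^esub> inv\<^bsub>G\<^esub> (inv\<^bsub>G\<^esub> q))"
    using minimal[of "inv\<^bsub>G\<^esub> q" n] q by auto
  let ?h = "inv\<^bsub>Gs (k n)\<^esub> p \<otimes>\<^bsub>Gs (k n)\<^esub> (c n s \<otimes>\<^bsub>Gs (k n)\<^esub> p)"
  have "\<eta> (k n) ?h = inv\<^bsub>G\<^esub> q \<otimes>\<^bsub>G\<^esub> \<psi> n s \<otimes>\<^bsub>G\<^esub> inv\<^bsub>G\<^esub> (inv\<^bsub>G\<^esub> q)"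
    using p q c(1,2)[OF s, of n] \<psi>_closed[OF SG[OF s], of n] by (simp add: q_def G.m_assoc)
  moreover have "G.len (\<eta> (k n) ?h) \<le> Gs.len (k n) ?h"
    using p c(1)[OF s] by (intro len_\<eta>_le) simp
  moreover have "Gs.len (k n) ?h < N n" using disp[OF s] unfolding u_S[OF s] word_dist_def .
  ultimately show False using s_min by simp
qed

end

theorem proposition3p12:
  fixes G :: "('a, 'm) monoid_scheme" and S :: "'a set"
    and Gs :: "nat \<Rightarrow> ('b, 'n) monoid_scheme" and Ss :: "nat \<Rightarrow> 'b set"
    and \<alpha> :: "nat \<Rightarrow> 'b \<Rightarrow> 'b" and \<eta> :: "nat \<Rightarrow> 'b \<Rightarrow> 'a" and \<delta> :: "nat \<Rightarrow> real"
  assumes "lacunary_hyperbolic_approximation G S Gs Ss \<alpha> \<eta> \<delta>"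
    and "property_FR G"
    and "(\<lambda>k. ereal_of_enat (injectivity_radius (Gs k) (Ss k) (\<eta> k)) / ereal ((\<delta> k)\<^sup>2))
           \<longlonglongrightarrow> \<infinity>"
  shows "\<exists>A B :: real. 0 < A \<and> 0 < B \<and>
           (\<exists>k0. \<forall>k\<ge>k0.
              (\<lambda>n. ereal (real n)) ` out_norms G S \<inter>
              {ereal (A * \<delta> k)<..<
               ereal B * ereal_of_enat (injectivity_radius (Gs k) (Ss k) (\<eta> k)) / ereal (\<delta> k)}
              = {})"
proof (rule ccontr)
  interpret lacunary_hyperbolic_approximation G S Gs Ss \<alpha> \<eta> \<delta> by fact
  \<comment> \<open>With \<open>B = 1/10\<close> the upper end of the interval bounds \<open>10 \<delta> m\<close>, the length of a relator
    after substitution of words of length \<open>m\<close>, by the injectivity radius.\<close>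
  let ?bad = "\<lambda>A k m. m \<in> out_norms G S \<and> A * \<delta> k < real m \<and>
    ereal (real m) < ereal (1 / 10) * ereal_of_enat (injectivity_radius (Gs k) (Ss k) (\<eta> k)) / ereal (\<delta> k)"
  assume contr: "\<not> ?thesis"
  have bad: "\<exists>k\<ge>k0. \<exists>m. ?bad A k m" if "0 < A" for A k0
  proof (rule ccontr)
    assume none: "\<not> ?thesis"
    have "(\<lambda>n. ereal (real n)) ` out_norms G S \<inter>
              {ereal (A * \<delta> k)<..<
               ereal (1 / 10) * ereal_of_enat (injectivity_radius (Gs k) (Ss k) (\<eta> k)) / ereal (\<delta> k)}
              = {}" if "k \<ge> k0" for k
      using none that by auto
    hence "\<exists>k0. \<forall>k\<ge>k0. (\<lambda>n. ereal (real n)) ` out_norms G S \<inter>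
              {ereal (A * \<delta> k)<..<
               ereal (1 / 10) * ereal_of_enat (injectivity_radius (Gs k) (Ss k) (\<eta> k)) / ereal (\<delta> k)}
              = {}" by blast
    moreover have "(0::real) < 1 / 10" by simp
    ultimately show False using contr \<open>0 < A\<close> by blast
  qed
  have min: "0 < m \<and> (\<exists>\<psi>\<in>hom G G. (\<forall>s\<in>S. G.len (\<psi> s) \<le> m) \<and>
    (\<forall>g\<in>carrier G. \<exists>s\<in>S. m \<le> G.len (g \<otimes>\<^bsub>G\<^esub> \<psi> s \<otimes>\<^bsub>G\<^esub> inv\<^bsub>G\<^esub> g)))"
    if "?bad A k m" "0 < A" for A k m
  proof -
    have "0 < A * \<delta> k" using \<delta>_pos that(2) by simp
    hence "0 < m" using that(1) by (metis less_trans of_nat_0_less_iff)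
    thus ?thesis using G.minimal_endomorphism[OF finite_S, of m] that(1) by blast
  qed
  have "S \<noteq> {}"
  proof
    assume "S = {}"
    obtain k m where "?bad 1 k m" using bad[of 1 0] by auto
    from min[OF this] show False using \<open>S = {}\<close> by auto
  qed
  hence "\<not> (\<forall>K. \<exists>k\<ge>K. \<delta> k < 1 / 10)" using no_generators_if_frequently_free[OF assms(2)] by blast
  then obtain K where K: "\<And>k. k \<ge> K \<Longrightarrow> 1 / 10 \<le> \<delta> k" by (meson not_less)
  have "\<exists>k m r \<psi>. n \<le> k \<and> K \<le> k \<and> (real n + 1) * \<delta> k < real m \<and> 10 * \<delta> k * real m \<le> real r \<and>
      (\<forall>x\<in>carrier (Gs k). inj_on (\<eta> k) (word_ball (Gs k) (Ss k) x r)) \<and> \<psi> \<in> hom G G \<and>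
      (\<forall>s\<in>S. G.len (\<psi> s) \<le> m) \<and>
      (\<forall>g\<in>carrier G. \<exists>s\<in>S. m \<le> G.len (g \<otimes>\<^bsub>G\<^esub> \<psi> s \<otimes>\<^bsub>G\<^esub> inv\<^bsub>G\<^esub> g))" for n :: nat
  proof -
    have A: "0 < real n + 1" by simp
    obtain k m where k: "k \<ge> max n K" and m: "?bad (real n + 1) k m"
      using bad[OF A, of "max n K"] by blast
    obtain r where "10 * \<delta> k * real m \<le> real r" "\<And>x. x \<in> carrier (Gs k) \<Longrightarrow> inj_on (\<eta> k) (word_ball (Gs k) (Ss k) x r)"
      using less_injectivity_radius_obtains[OF m[THEN conjunct2, THEN conjunct2] \<delta>_pos] by blast
    moreover obtain \<psi> where "\<psi> \<in> hom G G" "\<forall>s\<in>S. G.len (\<psi> s) \<le> m"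
      "\<forall>g\<in>carrier G. \<exists>s\<in>S. m \<le> G.len (g \<otimes>\<^bsub>G\<^esub> \<psi> s \<otimes>\<^bsub>G\<^esub> inv\<^bsub>G\<^esub> g)"
      using min[OF m A] by blast
    moreover have "n \<le> k" "K \<le> k" using k by simp_all
    ultimately show ?thesis using m by blast
  qed
  then obtain k m r \<psi> where *: "\<And>n :: nat. n \<le> k n \<and> K \<le> k n \<and> (real n + 1) * \<delta> (k n) < real (m n) \<and>
      10 * \<delta> (k n) * real (m n) \<le> real (r n) \<and>
      (\<forall>x\<in>carrier (Gs (k n)). inj_on (\<eta> (k n)) (word_ball (Gs (k n)) (Ss (k n)) x (r n))) \<and> \<psi> n \<in> hom G G \<and>
      (\<forall>s\<in>S. G.len (\<psi> n s) \<le> m n) \<and>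
      (\<forall>g\<in>carrier G. \<exists>s\<in>S. m n \<le> G.len (g \<otimes>\<^bsub>G\<^esub> \<psi> n s \<otimes>\<^bsub>G\<^esub> inv\<^bsub>G\<^esub> g))" by metis
  show False
    by (rule no_long_minimal_endomorphisms[of \<psi> m k r, OF assms(2)]) (use * K in blast)+
qed

end
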